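(* Let $n\ge1$, let $E=\bigoplus_{i=1}^nE_{-i}$ be a graded vector bundle over a smooth manifold $M$ and let $(L,(\ell_r)_r,\rho)$, $L=sE$, be a split Lie $n$-algebroid over $M$. (1) The bundle map $\rho:L_0\to TM$ verifies $\rho(\ell_2(X,Y))=[\rho(X),\rho(Y)]$ for all $X,Y\in\Gamma(L_0)$, where $[-,-]$ is the bracket of vector fields. (2) The Lie $n$-algebroid is implemented by higher derived brackets: if $Q$ is the homological vector field (Chevalley–Eilenberg differential) on $\Gamma(\odot E^* )$ associated to $((\ell_r)_r,\rho)$ and if $\ell''_r$ and $\rho''$ are the derived brackets and the derived anchor of $Q$, then, for all $1\le r\le n+1$, $$\ell_r=(-1)^r\,s\,\ell''_r\,(s^{-1})^r\qquad\text{and}\qquad \rho=\rho''\,s^{-1}.$$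
   Context: Conventions. For $E=\bigoplus_{i=1}^nE_{-i}$ (finite rank smooth bundles, $E_{-i}$ in degree $-i$), $\mathcal A=\Gamma(\odot E^* )$ is the graded symmetric algebra with $E_{-i}^*$ in degree $i$. Elements of $\Gamma(\odot^rE^* )$ are viewed as graded symmetric $C^\infty(M)$-multilinear maps on $\Gamma(E)$, with $(f\odot g)(v_1,\ldots,v_{r_1+r_2})=\sum_{\sigma\in \mathrm{Sh}(r_1,r_2)}(-1)^{|g|(|v_{\sigma_1}|+\cdots+|v_{\sigma_{r_1}}|)}\varepsilon(\sigma)f(v_{\sigma_1},\ldots,v_{\sigma_{r_1}})g(v_{\sigma_{r_1+1}},\ldots,v_{\sigma_{r_1+r_2}})$ ($\mathrm{Sh}$: shuffles, $\varepsilon(\sigma)$: Koszul sign). $sE$ is the graded bundle with $(sE)_{-k+1}=E_{-k}$, $s$ is the shift, $s^i(X_1\odot\cdots\odot X_i)=(-1)^{\sum_j(i-j)|X_j|}sX_1\boxdot\cdots\boxdot sX_i$, with $\odot$, $\boxdot$ the graded symmetric, graded antisymmetric tensor products; $(s^{-1})^i$ is defined by the same formula with $s^{-1}$ (so $(s^i)^{-1}=(-1)^{i(i-1)/2}(s^{-1})^i$). A split Lie $n$-algebroid is a graded vector bundle $L=\bigoplus_{i=0}^{n-1}L_{-i}$ over $M$ with a bundle map $\rho:L_0\to TM$ and graded antisymmetric $i$-linear brackets $\ell_i:\Gamma(L)^{\times i}\to\Gamma(L)$, $1\le i\le n+1$, of degree $2-i$ (set $\ell_i=0$ otherwise), such that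 (a) for all $r\ge1$ and homogeneous $x_j\in\Gamma(L)$, $\sum_{i+j=r+1}\sum_{\sigma\in \mathrm{Sh}(i,j-1)}(-1)^{i(j-1)}\operatorname{sign}(\sigma)\varepsilon(\sigma)\ell_j(\ell_i(x_{\sigma_1},\ldots,x_{\sigma_i}),x_{\sigma_{i+1}},\ldots,x_{\sigma_r})=0$; (b) $\ell_i$ is $C^\infty(M)$-multilinear for $i\ne2$, while $\ell_2$ is $C^\infty(M)$-bilinear if both arguments are in nonzero degrees, and $\ell_2(x_0,fx)=f\ell_2(x_0,x)+(\rho(x_0)f)x$ for $x_0\in\Gamma(L_0)$, $x\in\Gamma(L)$, $f\in C^\infty(M)$. Associated homological vector field. Put $\rho'=\rho s$, $\ell'_r=(-1)^{r(r-1)/2}s^{-1}\ell_rs^r$, and extend $\rho'$ and $\omega_k\in\Gamma(E^*_{-k})$ by $0$ to $\Gamma(E)$. $Q$ is the degree $1$, square-zero derivation of $\mathcal A$ given on generators by $(Q\omega_0)(X_1)=-\rho'(X_1)\omega_0$ for $\omega_0\in C^\infty(M)$ and, for $\omega_k\in\Gamma(E_{-k}^* )$, $1\le k\le n$, $X_j\in\Gamma(E_{-a_j})$, $\sum a_j=k+1$, by $(Q\omega_k)(X_1,\ldots,X_r)=(-1)^k\omega_k(\ell'_r(X_1,\ldots,X_r))$ if $r\neq2$, and $(Q\omega_k)(X_1,X_2)=(-1)^k\omega_k(\ell'_2(X_1,X_2))-(-1)^k\rho'(X_1)\omega_k(X_2)-(-1)^{a_1a_2+k}\rho'(X_2)\omega_k(X_1)$.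 Derived brackets. For $X\in\Gamma(E_{-j})$, $i_X$ is the degree $-j$ derivation of $\mathcal A$ that vanishes on $C^\infty(M)$ and satisfies $i_X\omega_k=\delta_{jk}(-1)^{jk}\omega_k(X)$ for $\omega_k\in\Gamma(E_{-k}^* )$; $X\mapsto i_X$ identifies $\Gamma(E)$ with the derivations of $\mathcal A$ that lower the number of generators by one. Let $[-,-]$ be the graded commutator of derivations and write $Q=\sum_{p=0}^n{}^p\!Q$, where ${}^p\!Q$ maps $\Gamma(\odot^rE^* )$ to $\Gamma(\odot^{r+p}E^* )$. The derived brackets $\ell''_r$ on $\Gamma(E)$ and the derived anchor $\rho'':E_{-1}\to TM$ are defined by $$i_{\ell''_r(X_1,\ldots,X_r)}=[\ldots[[{}^{r-1}\!Q,i_{X_1}],i_{X_2}],\ldots,i_{X_r}],\qquad \rho''(X)f=[{}^1\!Q,i_X]f\quad(X\in\Gamma(E_{-1}),\ f\in C^\infty(M)).$$ *)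

theory Defs
  imports "HOL-Analysis.Analysis" "HOL-Combinatorics.Permutations"
begin

section \<open>Smooth manifolds\<close>

text \<open>
  A manifold is a whole type \<open>'m\<close> (Hausdorff, second countable) with an atlas of charts
  \<open>(U, \<phi>)\<close> into a finite-dimensional normed space \<open>'e\<close>. The class
  \<open>euclidean_space\<close> is avoided because it excludes dimension 0, and a Lie \<open>n\<close>-algebra
  is a Lie \<open>n\<close>-algebroid over a point.
\<close>

primrec Ck_on ::
  "nat \<Rightarrow> 'a::real_normed_vector set \<Rightarrow> ('a \<Rightarrow> 'b::real_normed_vector) \<Rightarrow> bool" where
  "Ck_on 0 S f \<longleftrightarrow> continuous_on S f"
| "Ck_on (Suc k) S f \<longleftrightarrow>
     (\<forall>x\<in>S. f differentiable (at x)) \<and> (\<forall>v. Ck_on k S (\<lambda>x. frechet_derivative f (at x) v))"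

text \<open>Only used for open \<open>S\<close> and a finite-dimensional domain.\<close>

definition smooth_on ::
  "'a::real_normed_vector set \<Rightarrow> ('a \<Rightarrow> 'b::real_normed_vector) \<Rightarrow> bool" where
  "smooth_on S f \<longleftrightarrow> (\<forall>k. Ck_on k S f)"

type_synonym ('m, 'e) atlas = "('m set \<times> ('m \<Rightarrow> 'e)) set"

definition smooth_manifold ::
  "('m::{t2_space,second_countable_topology}, 'e::real_normed_vector) atlas \<Rightarrow> bool" where
  "smooth_manifold A \<longleftrightarrow>
     (\<exists>B::'e set. finite B \<and> span B = UNIV) \<and>
     (\<Union>(U, \<phi>)\<in>A. U) = UNIV \<and>
     (\<forall>(U, \<phi>)\<in>A. open U \<and> open (\<phi> ` U) \<and> homeomorphism U (\<phi> ` U) \<phi> (inv_into U \<phi>)) \<and>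
     (\<forall>(U, \<phi>)\<in>A. \<forall>(V, \<psi>)\<in>A. smooth_on (\<phi> ` (U \<inter> V)) (\<psi> \<circ> inv_into U \<phi>))"

definition smooth_fun_on ::
  "('m, 'e::real_normed_vector) atlas \<Rightarrow> 'm set \<Rightarrow> ('m \<Rightarrow> real) \<Rightarrow> bool" where
  "smooth_fun_on A W f \<longleftrightarrow> (\<forall>(U, \<phi>)\<in>A. smooth_on (\<phi> ` (U \<inter> W)) (f \<circ> inv_into U \<phi>))"

definition Cinf :: "('m, 'e::real_normed_vector) atlas \<Rightarrow> ('m \<Rightarrow> real) set" where
  "Cinf A = {f. smooth_fun_on A UNIV f}"

text \<open>
  Tangent vectors at \<open>p\<close> are the derivations of \<open>C\<^sup>\<infinity>(M)\<close> at \<open>p\<close>; they are normalised to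
  vanish on non-smooth functions so that equality of tangent vectors is equality in HOL.
\<close>

definition tangent_space ::
  "('m, 'e::real_normed_vector) atlas \<Rightarrow> 'm \<Rightarrow> (('m \<Rightarrow> real) \<Rightarrow> real) set" where
  "tangent_space A p = {v.
     (\<forall>f. f \<notin> Cinf A \<longrightarrow> v f = 0) \<and>
     (\<forall>f\<in>Cinf A. \<forall>g\<in>Cinf A. \<forall>a b. v (\<lambda>q. a * f q + b * g q) = a * v f + b * v g) \<and>
     (\<forall>f\<in>Cinf A. \<forall>g\<in>Cinf A. v (\<lambda>q. f q * g q) = f p * v g + g p * v f)}"

definition vector_fields ::
  "('m, 'e::real_normed_vector) atlas \<Rightarrow> ('m \<Rightarrow> ('m \<Rightarrow> real) \<Rightarrow> real) set" where
  "vector_fields A = {X. (\<forall>p. X p \<in> tangent_space A p) \<and> (\<forall>f\<in>Cinf A. (\<lambda>p. X p f) \<in> Cinf A)}"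

definition lie_bracket ::
  "('m \<Rightarrow> ('m \<Rightarrow> real) \<Rightarrow> real) \<Rightarrow> ('m \<Rightarrow> ('m \<Rightarrow> real) \<Rightarrow> real) \<Rightarrow> 'm \<Rightarrow> ('m \<Rightarrow> real) \<Rightarrow> real" where
  "lie_bracket X Y = (\<lambda>p f. X p (\<lambda>q. Y q f) - Y p (\<lambda>q. X q f))"

section \<open>Graded vector bundles\<close>

text \<open>
  The fibres are subspaces of one ambient real vector space \<open>'v\<close> (no restriction up to
  isomorphism: \<open>'v\<close> carries no topology). The smooth structure is given by local
  trivialisations, i.e. by local frames \<open>(U, e)\<close> whose transition functions are smooth.
\<close>

record ('m, 'v) vbundle =
  fibre :: "'m \<Rightarrow> 'v set"
  bundle_rank :: nat
  frames :: "('m set \<times> (nat \<Rightarrow> 'm \<Rightarrow> 'v)) set"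

definition frame_coord ::
  "nat \<Rightarrow> (nat \<Rightarrow> 'm \<Rightarrow> 'v::real_vector) \<Rightarrow> nat \<Rightarrow> 'm \<Rightarrow> 'v \<Rightarrow> real" where
  "frame_coord r e i p v = representation ((\<lambda>j. e j p) ` {..<r}) v (e i p)"

definition vector_bundle ::
  "('m::topological_space, 'e::real_normed_vector) atlas \<Rightarrow> ('m, 'v::real_vector) vbundle \<Rightarrow> bool"
  where
  "vector_bundle A B \<longleftrightarrow>
     (\<forall>p. subspace (fibre B p)) \<and>
     (\<Union>(U, e)\<in>frames B. U) = UNIV \<and>
     (\<forall>(U, e)\<in>frames B. open U \<and>
        (\<forall>p\<in>U. inj_on (\<lambda>i. e i p) {..<bundle_rank B} \<and>
               independent ((\<lambda>i. e i p) ` {..<bundle_rank B}) \<and>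
               span ((\<lambda>i. e i p) ` {..<bundle_rank B}) = fibre B p)) \<and>
     (\<forall>(U, e)\<in>frames B. \<forall>(V, e')\<in>frames B. \<forall>i<bundle_rank B. \<forall>j<bundle_rank B.
        smooth_fun_on A (U \<inter> V) (\<lambda>p. frame_coord (bundle_rank B) e i p (e' j p)))"

definition sections ::
  "('m, 'e::real_normed_vector) atlas \<Rightarrow> ('m, 'v::real_vector) vbundle \<Rightarrow> ('m \<Rightarrow> 'v) set" where
  "sections A B = {x. (\<forall>p. x p \<in> fibre B p) \<and>
     (\<forall>(U, e)\<in>frames B. \<forall>i<bundle_rank B.
        smooth_fun_on A U (\<lambda>p. frame_coord (bundle_rank B) e i p (x p)))}"

text \<open>\<open>E d\<close> is the component of degree \<open>d\<close>, so that \<open>E\<^sub>-\<^sub>i\<close> is \<open>E (- i)\<close>.\<close>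

type_synonym ('m, 'v) gbundle = "int \<Rightarrow> ('m, 'v) vbundle"

definition graded_bundle ::
  "('m::topological_space, 'e::real_normed_vector) atlas \<Rightarrow> int \<Rightarrow> int \<Rightarrow>
   ('m, 'v::real_vector) gbundle \<Rightarrow> bool" where
  "graded_bundle A lo hi E \<longleftrightarrow>
     (\<forall>d. vector_bundle A (E d)) \<and> (\<forall>d. d \<notin> {lo..hi} \<longrightarrow> (\<forall>p. fibre (E d) p = {0}))"

definition shift :: "('m, 'v) gbundle \<Rightarrow> ('m, 'v) gbundle" where
  "shift E = (\<lambda>d. E (d - 1))"

text \<open>
  A homogeneous section is a pair \<open>(d, x)\<close> with \<open>x\<close> a section of \<open>E d\<close>. A multilinear map on
  \<open>\<Gamma>(E) = \<Oplus>\<^sub>d \<Gamma>(E d)\<close> is given by its values on lists of homogeneous sections; carrying the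
  degree along makes the Koszul signs well defined also for the zero section.
\<close>

type_synonym ('m, 'v) hsec = "int \<times> ('m \<Rightarrow> 'v)"

definition hsections ::
  "('m, 'e::real_normed_vector) atlas \<Rightarrow> ('m, 'v::real_vector) gbundle \<Rightarrow> ('m, 'v) hsec set" where
  "hsections A E = {X. snd X \<in> sections A (E (fst X))}"

definition hlists ::
  "('m, 'e::real_normed_vector) atlas \<Rightarrow> ('m, 'v::real_vector) gbundle \<Rightarrow> nat \<Rightarrow>
   ('m, 'v) hsec list set" where
  "hlists A E r = {Xs. length Xs = r \<and> set Xs \<subseteq> hsections A E}"

definition gscale :: "('m \<Rightarrow> real) \<Rightarrow> ('m, 'v::real_vector) hsec \<Rightarrow> ('m, 'v) hsec" where
  "gscale f X = (fst X, \<lambda>p. f p *\<^sub>R snd X p)"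

text \<open>Only used for summands of the same degree.\<close>

definition gadd :: "('m, 'v::real_vector) hsec \<Rightarrow> ('m, 'v) hsec \<Rightarrow> ('m, 'v) hsec" where
  "gadd X Y = (fst X, \<lambda>p. snd X p + snd Y p)"

definition tdeg :: "('m, 'v) hsec list \<Rightarrow> int" where
  "tdeg Xs = sum_list (map fst Xs)"

section \<open>Shuffles, Koszul signs and shifts\<close>

text \<open>Permutations act on \<open>{..<i + j}\<close>, that is, with indices starting at 0.\<close>

definition Sh :: "nat \<Rightarrow> nat \<Rightarrow> (nat \<Rightarrow> nat) set" where
  "Sh i j = {\<sigma>. \<sigma> permutes {..<i + j} \<and> strict_mono_on {..<i} \<sigma> \<and> strict_mono_on {i..<i + j} \<sigma>}"

definition koszul :: "(nat \<Rightarrow> nat) \<Rightarrow> ('m, 'v) hsec list \<Rightarrow> real" where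
  "koszul \<sigma> Xs =
     (\<Prod>(a, b)\<in>{(a, b). a < b \<and> b < length Xs \<and> \<sigma> b < \<sigma> a}.
        (-1) powi (fst (Xs ! \<sigma> a) * fst (Xs ! \<sigma> b)))"

definition susp :: "('m, 'v) hsec \<Rightarrow> ('m, 'v) hsec" where
  "susp X = (fst X + 1, snd X)"

definition desusp :: "('m, 'v) hsec \<Rightarrow> ('m, 'v) hsec" where
  "desusp X = (fst X - 1, snd X)"

text \<open>The exponent is \<open>\<Sum>\<^sub>j (r - j) |X\<^sub>j|\<close>, with \<open>j = 1, \<dots>, r\<close> rendered as \<open>j + 1\<close>.\<close>

definition shift_sign :: "('m, 'v) hsec list \<Rightarrow> real" where
  "shift_sign Xs =
     (-1) powi (\<Sum>j<length Xs. (int (length Xs) - int (j + 1)) * fst (Xs ! j))"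

type_synonym ('m, 'v) bracket = "('m, 'v) hsec list \<Rightarrow> ('m, 'v) hsec"

text \<open>The compositions \<open>b s\<^sup>r\<close> and \<open>b (s\<^sup>-\<^sup>1)\<^sup>r\<close> of an \<open>r\<close>-ary operation \<open>b\<close> with the shifts.\<close>

definition multi_susp :: "('m, 'v::real_vector) bracket \<Rightarrow> ('m, 'v) bracket" where
  "multi_susp b Xs = gscale (\<lambda>_. shift_sign Xs) (b (map susp Xs))"

definition multi_desusp :: "('m, 'v::real_vector) bracket \<Rightarrow> ('m, 'v) bracket" where
  "multi_desusp b Xs = gscale (\<lambda>_. shift_sign Xs) (b (map desusp Xs))"

section \<open>Split Lie n-algebroids\<close>

text \<open>Multilinearity of an \<open>r\<close>-ary operation over a set \<open>F\<close> of scalar functions.\<close>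

definition multilinear_over ::
  "('m \<Rightarrow> real) set \<Rightarrow> ('m, 'e::real_normed_vector) atlas \<Rightarrow> ('m, 'v::real_vector) gbundle \<Rightarrow>
   nat \<Rightarrow> ('m, 'v) bracket \<Rightarrow> bool" where
  "multilinear_over F A L r b \<longleftrightarrow>
     (\<forall>us vs X Y. \<forall>f\<in>F. \<forall>g\<in>F.
        us @ X # vs \<in> hlists A L r \<and> Y \<in> hsections A L \<and> fst X = fst Y \<longrightarrow>
        b (us @ gadd (gscale f X) (gscale g Y) # vs) =
          gadd (gscale f (b (us @ X # vs))) (gscale g (b (us @ Y # vs))))"

definition graded_antisymmetric ::
  "('m, 'e::real_normed_vector) atlas \<Rightarrow> ('m, 'v::real_vector) gbundle \<Rightarrow>
   nat \<Rightarrow> ('m, 'v) bracket \<Rightarrow> bool" where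
  "graded_antisymmetric A L r b \<longleftrightarrow>
     (\<forall>us vs X Y. us @ X # Y # vs \<in> hlists A L r \<longrightarrow>
        b (us @ X # Y # vs) = gscale (\<lambda>_. - ((-1) powi (fst X * fst Y))) (b (us @ Y # X # vs)))"

text \<open>A bundle map \<open>B \<rightarrow> TM\<close> over the identity: fibrewise linear and smooth.\<close>

type_synonym ('m, 'v) anchor = "'m \<Rightarrow> 'v \<Rightarrow> ('m \<Rightarrow> real) \<Rightarrow> real"

definition anchor_map ::
  "('m, 'e::real_normed_vector) atlas \<Rightarrow> ('m, 'v::real_vector) vbundle \<Rightarrow>
   ('m, 'v) anchor \<Rightarrow> bool" where
  "anchor_map A B \<rho> \<longleftrightarrow>
     (\<forall>p. \<forall>v\<in>fibre B p. \<rho> p v \<in> tangent_space A p) \<and>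
     (\<forall>p. \<forall>v\<in>fibre B p. \<forall>w\<in>fibre B p. \<forall>a b f.
        \<rho> p (a *\<^sub>R v + b *\<^sub>R w) f = a * \<rho> p v f + b * \<rho> p w f) \<and>
     (\<forall>x\<in>sections A B. (\<lambda>p. \<rho> p (x p)) \<in> vector_fields A)"

definition split_lie_algebroid ::
  "('m::topological_space, 'e::real_normed_vector) atlas \<Rightarrow> nat \<Rightarrow> ('m, 'v::real_vector) gbundle \<Rightarrow>
   (nat \<Rightarrow> ('m, 'v) bracket) \<Rightarrow> ('m, 'v) anchor \<Rightarrow> bool" where
  "split_lie_algebroid A n L l \<rho> \<longleftrightarrow>
     graded_bundle A (- (int n - 1)) 0 L \<and>
     anchor_map A (L 0) \<rho> \<and>
     (\<forall>r. \<forall>xs\<in>hlists A L r.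
        l r xs \<in> hsections A L \<and> fst (l r xs) = 2 - int r + tdeg xs) \<and>
     (\<forall>r. r \<notin> {1..n + 1} \<longrightarrow> (\<forall>xs\<in>hlists A L r. snd (l r xs) = (\<lambda>_. 0))) \<and>
     (\<forall>r. multilinear_over (range (\<lambda>a _. a)) A L r (l r)) \<and>
     (\<forall>r. graded_antisymmetric A L r (l r)) \<and>
     (\<forall>r\<ge>1. \<forall>xs\<in>hlists A L r. \<forall>p.
        (\<Sum>i=1..r. let j = r + 1 - i in \<Sum>\<sigma>\<in>Sh i (j - 1). let ys = permute_list \<sigma> xs in
           ((-1) ^ (i * (j - 1)) * real_of_int (sign \<sigma>) * koszul \<sigma> xs) *\<^sub>R
             snd (l j (l i (take i ys) # drop i ys)) p) = 0) \<and>
     (\<forall>r. r \<noteq> 2 \<longrightarrow> multilinear_over (Cinf A) A L r (l r)) \<and>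
     (\<forall>x\<in>hsections A L. \<forall>y\<in>hsections A L. \<forall>f\<in>Cinf A. fst x \<noteq> 0 \<and> fst y \<noteq> 0 \<longrightarrow>
        l 2 [gscale f x, y] = gscale f (l 2 [x, y]) \<and>
        l 2 [x, gscale f y] = gscale f (l 2 [x, y])) \<and>
     (\<forall>x\<in>hsections A L. \<forall>y\<in>hsections A L. \<forall>f\<in>Cinf A. fst x = 0 \<longrightarrow>
        l 2 [x, gscale f y] =
          gadd (gscale f (l 2 [x, y])) (gscale (\<lambda>p. \<rho> p (snd x p) f) y))"

section \<open>The algebra of graded symmetric forms and its derivations\<close>

text \<open>
  An element of \<open>\<Gamma>(\<odot>E\<^sup>*)\<close> collects its finitely many components in \<open>\<Gamma>(\<odot>\<^sup>r E\<^sup>*)\<close>: the component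
  of arity \<open>r\<close> is the restriction to lists of length \<open>r\<close>, a graded symmetric
  \<open>C\<^sup>\<infinity>(M)\<close>-multilinear map. Values outside the homogeneous sections are normalised to 0.
\<close>

type_synonym ('m, 'v) form = "('m, 'v) hsec list \<Rightarrow> 'm \<Rightarrow> real"

definition symalg ::
  "('m, 'e::real_normed_vector) atlas \<Rightarrow> ('m, 'v::real_vector) gbundle \<Rightarrow> ('m, 'v) form set" where
  "symalg A E = {\<omega>.
     (\<forall>Xs. \<not> set Xs \<subseteq> hsections A E \<longrightarrow> \<omega> Xs = (\<lambda>_. 0)) \<and>
     (\<forall>Xs. \<omega> Xs \<in> Cinf A) \<and>
     (\<exists>N. \<forall>Xs. length Xs > N \<longrightarrow> \<omega> Xs = (\<lambda>_. 0)) \<and>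
     (\<forall>us vs X Y. \<forall>f\<in>Cinf A. \<forall>g\<in>Cinf A.
        set (us @ X # Y # vs) \<subseteq> hsections A E \<and> fst X = fst Y \<longrightarrow>
        \<omega> (us @ gadd (gscale f X) (gscale g Y) # vs) =
          (\<lambda>p. f p * \<omega> (us @ X # vs) p + g p * \<omega> (us @ Y # vs) p)) \<and>
     (\<forall>us vs X Y. set (us @ X # Y # vs) \<subseteq> hsections A E \<longrightarrow>
        \<omega> (us @ X # Y # vs) = (\<lambda>p. (-1) powi (fst X * fst Y) * \<omega> (us @ Y # X # vs) p))}"

definition symalg_deg ::
  "('m, 'e::real_normed_vector) atlas \<Rightarrow> ('m, 'v::real_vector) gbundle \<Rightarrow> int \<Rightarrow> ('m, 'v) form set"
  where
  "symalg_deg A E k = {\<omega>\<in>symalg A E. \<forall>Xs. tdeg Xs \<noteq> - k \<longrightarrow> \<omega> Xs = (\<lambda>_. 0)}"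

definition arity_part :: "nat \<Rightarrow> ('m, 'v) form \<Rightarrow> ('m, 'v) form" where
  "arity_part r \<omega> = (\<lambda>Xs. if length Xs = r then \<omega> Xs else (\<lambda>_. 0))"

text \<open>\<open>\<Gamma>(E\<^sup>*\<^sub>-\<^sub>k)\<close>, extended by 0 to \<open>\<Gamma>(E)\<close>.\<close>

definition covectors ::
  "('m, 'e::real_normed_vector) atlas \<Rightarrow> ('m, 'v::real_vector) gbundle \<Rightarrow> int \<Rightarrow> ('m, 'v) form set"
  where
  "covectors A E k = {\<omega>\<in>symalg_deg A E k. arity_part 1 \<omega> = \<omega>}"

definition fun_form :: "('m \<Rightarrow> real) \<Rightarrow> ('m, 'v) form" where
  "fun_form f = (\<lambda>Xs. if Xs = [] then f else (\<lambda>_. 0))"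

text \<open>
  In the sign \<open>(-1)\<^bsup>|g| (|v\<^sub>\<sigma>\<^sub>1| + \<dots>)\<^esup>\<close> the degree of \<open>g\<close> is read off from its arguments: a
  homogeneous \<open>g\<close> vanishes unless their total degree is \<open>- |g|\<close>. This extends the formula
  bilinearly to inhomogeneous forms.
\<close>

definition sprod :: "('m, 'v) form \<Rightarrow> ('m, 'v) form \<Rightarrow> ('m, 'v) form" where
  "sprod f g = (\<lambda>Xs p.
     \<Sum>i\<le>length Xs. \<Sum>\<sigma>\<in>Sh i (length Xs - i). let Ys = permute_list \<sigma> Xs in
       (-1) powi (- tdeg (drop i Ys) * tdeg (take i Ys)) * koszul \<sigma> Xs *
         f (take i Ys) p * g (drop i Ys) p)"

type_synonym ('m, 'v) operator = "('m, 'v) form \<Rightarrow> ('m, 'v) form"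

text \<open>Derivations are normalised to 0 outside the algebra, so they are equal as HOL functions
  iff they agree on the algebra.\<close>

definition derivation ::
  "('m, 'e::real_normed_vector) atlas \<Rightarrow> ('m, 'v::real_vector) gbundle \<Rightarrow> int \<Rightarrow>
   ('m, 'v) operator \<Rightarrow> bool" where
  "derivation A E m D \<longleftrightarrow>
     (\<forall>\<omega>. \<omega> \<notin> symalg A E \<longrightarrow> D \<omega> = (\<lambda>_ _. 0)) \<and>
     (\<forall>\<omega>\<in>symalg A E. D \<omega> \<in> symalg A E) \<and>
     (\<forall>k. \<forall>\<omega>\<in>symalg_deg A E k. D \<omega> \<in> symalg_deg A E (k + m)) \<and>
     (\<forall>\<omega>\<in>symalg A E. \<forall>\<eta>\<in>symalg A E. \<forall>a b.
        D (\<lambda>Xs p. a * \<omega> Xs p + b * \<eta> Xs p) = (\<lambda>Xs p. a * D \<omega> Xs p + b * D \<eta> Xs p)) \<and>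
     (\<forall>k. \<forall>\<omega>\<in>symalg_deg A E k. \<forall>\<eta>\<in>symalg A E.
        D (sprod \<omega> \<eta>) =
          (\<lambda>Xs p. sprod (D \<omega>) \<eta> Xs p + (-1) powi (m * k) * sprod \<omega> (D \<eta>) Xs p))"

text \<open>The anchor \<open>\<rho> s\<close>, extended by 0 to \<open>\<Gamma>(E)\<close>, acting on functions.\<close>

definition anchor' :: "('m, 'v) anchor \<Rightarrow> ('m, 'v) hsec \<Rightarrow> ('m \<Rightarrow> real) \<Rightarrow> 'm \<Rightarrow> real" where
  "anchor' \<rho> X f = (\<lambda>p. if fst (susp X) = 0 then \<rho> p (snd (susp X) p) f else 0)"

definition bracket' :: "(nat \<Rightarrow> ('m, 'v::real_vector) bracket) \<Rightarrow> nat \<Rightarrow> ('m, 'v) bracket" where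
  "bracket' l r Xs = gscale (\<lambda>_. (-1) ^ (r * (r - 1) div 2)) (desusp (multi_susp (l r) Xs))"

definition homological_vector_field ::
  "('m, 'e::real_normed_vector) atlas \<Rightarrow> nat \<Rightarrow> ('m, 'v::real_vector) gbundle \<Rightarrow>
   (nat \<Rightarrow> ('m, 'v) bracket) \<Rightarrow> ('m, 'v) anchor \<Rightarrow> ('m, 'v) operator \<Rightarrow> bool" where
  "homological_vector_field A n E l \<rho> Q \<longleftrightarrow>
     derivation A E 1 Q \<and>
     (\<forall>\<omega>\<in>symalg A E. Q (Q \<omega>) = (\<lambda>_ _. 0)) \<and>
     (\<forall>f\<in>Cinf A. \<forall>X\<in>hsections A E. Q (fun_form f) [X] = (\<lambda>p. - anchor' \<rho> X f p)) \<and>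
     (\<forall>k\<in>{1..int n}. \<forall>\<omega>\<in>covectors A E k. \<forall>r\<ge>1. \<forall>Xs\<in>hlists A E r.
        tdeg Xs = - (k + 1) \<and> r \<noteq> 2 \<longrightarrow>
        Q \<omega> Xs = (\<lambda>p. (-1) powi k * \<omega> [bracket' l r Xs] p)) \<and>
     (\<forall>k\<in>{1..int n}. \<forall>\<omega>\<in>covectors A E k. \<forall>X\<in>hsections A E. \<forall>Y\<in>hsections A E.
        tdeg [X, Y] = - (k + 1) \<longrightarrow>
        Q \<omega> [X, Y] = (\<lambda>p. (-1) powi k * \<omega> [bracket' l 2 [X, Y]] p
                          - (-1) powi k * anchor' \<rho> X (\<omega> [Y]) p
                          - (-1) powi (fst X * fst Y + k) * anchor' \<rho> Y (\<omega> [X]) p))"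

section \<open>Derived brackets\<close>

text \<open>
  \<open>contraction A E X\<close> is \<open>i\<^sub>X\<close>; in its defining property \<open>fst X = - j\<close>. The degree \<open>k\<close> may range
  over all integers because the other \<open>E\<^sub>-\<^sub>k\<close> vanish.
\<close>

definition contraction ::
  "('m, 'e::real_normed_vector) atlas \<Rightarrow> ('m, 'v::real_vector) gbundle \<Rightarrow> ('m, 'v) hsec \<Rightarrow>
   ('m, 'v) operator" where
  "contraction A E X = (THE D. derivation A E (fst X) D \<and>
     (\<forall>f\<in>Cinf A. D (fun_form f) = (\<lambda>_ _. 0)) \<and>
     (\<forall>k. \<forall>\<omega>\<in>covectors A E k.
        D \<omega> = fun_form (\<lambda>p. if - fst X = k then (-1) powi (- fst X * k) * \<omega> [X] p else 0)))"

text \<open>The component \<open>\<^sup>pQ\<close> of \<open>Q\<close>, which raises the arity by \<open>p\<close>.\<close>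

definition op_part ::
  "('m, 'e::real_normed_vector) atlas \<Rightarrow> ('m, 'v::real_vector) gbundle \<Rightarrow> nat \<Rightarrow>
   ('m, 'v) operator \<Rightarrow> ('m, 'v) operator" where
  "op_part A E p Q \<omega> = (\<lambda>Xs.
     if \<omega> \<in> symalg A E \<and> p \<le> length Xs then Q (arity_part (length Xs - p) \<omega>) Xs else (\<lambda>_. 0))"

text \<open>Graded commutator of operators paired with their degrees.\<close>

definition gcomm ::
  "int \<times> ('m, 'v) operator \<Rightarrow> int \<times> ('m, 'v) operator \<Rightarrow> int \<times> ('m, 'v) operator" where
  "gcomm D D' = (fst D + fst D',
     \<lambda>\<omega> Xs p. snd D (snd D' \<omega>) Xs p - (-1) powi (fst D * fst D') * snd D' (snd D \<omega>) Xs p)"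

definition iterated_commutator ::
  "('m, 'e::real_normed_vector) atlas \<Rightarrow> ('m, 'v::real_vector) gbundle \<Rightarrow> ('m, 'v) operator \<Rightarrow>
   nat \<Rightarrow> ('m, 'v) hsec list \<Rightarrow> ('m, 'v) operator" where
  "iterated_commutator A E Q p Xs =
     snd (foldl gcomm (1, op_part A E p Q) (map (\<lambda>X. (fst X, contraction A E X)) Xs))"

text \<open>The degree is prescribed because the zero section has every degree.\<close>

definition derived_bracket ::
  "('m, 'e::real_normed_vector) atlas \<Rightarrow> ('m, 'v::real_vector) gbundle \<Rightarrow> ('m, 'v) operator \<Rightarrow>
   nat \<Rightarrow> ('m, 'v) bracket" where
  "derived_bracket A E Q r Xs = (THE Y. Y \<in> hsections A E \<and> fst Y = 1 + tdeg Xs \<and>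
     contraction A E Y = iterated_commutator A E Q (r - 1) Xs)"

text \<open>The derived anchor on sections \<open>X\<close> of degree \<open>-1\<close>, as a vector field.\<close>

definition derived_anchor ::
  "('m, 'e::real_normed_vector) atlas \<Rightarrow> ('m, 'v::real_vector) gbundle \<Rightarrow> ('m, 'v) operator \<Rightarrow>
   ('m, 'v) hsec \<Rightarrow> 'm \<Rightarrow> ('m \<Rightarrow> real) \<Rightarrow> real" where
  "derived_anchor A E Q X = (\<lambda>p f.
     if f \<in> Cinf A then iterated_commutator A E Q 1 [X] (fun_form f) [] p else 0)"

end

theory Submission
  imports Defs
begin

text \<open>
  (1) Apply the Jacobi identity to degree 0 sections \<open>x, y, f z\<close> and subtract \<open>f\<close> times the one for
  \<open>x, y, z\<close>: what remains is \<open>(\<rho>(\<ell>\<^sub>2(x, y)) f - [\<rho> x, \<rho> y] f) z = 0\<close>.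

  (2) A derivation is determined by its values on functions and covectors, because every form is
  locally generated by these and bump functions make derivations local. Hence \<open>i\<^sub>X\<close> is the insertion
  \<open>\<omega> \<mapsto> \<plusminus> \<omega>(X, \<dots>)\<close>, and an iterated commutator of \<open>\<^sup>r\<^sup>-\<^sup>1Q\<close> with \<open>r\<close> contractions, which lowers the
  arity by one, is the contraction with a section that can be read off from its values on covectors.
  There only the summand \<open>\<plusminus> i(X\<^sub>r) \<dots> i(X\<^sub>1) Q\<close> survives, since \<open>Q\<close> maps functions to forms of
  arity one; for \<open>r = 2\<close> the further summands cancel the anchor terms of \<open>Q\<close>.
\<close>

section \<open>Smooth functions on open sets\<close>

text \<open>Forms are encoded as multilinear maps on lists of global sections, so generation by
  functions and covectors has to be recovered. A local frame and its coframe become global only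
  after multiplication by a bump function \<open>\<theta>\<close>; every expansion therefore carries
  a factor \<open>\<theta>\<^sup>2\<close>, which is divided out at the point under consideration.
  The second obstacle is the sum over shuffles in \<open>sprod\<close>. Shuffles are replaced by the
  subsets of positions that they move to the front, which gives a recursion on the argument list; up
  to signs, this recursion is the Leibniz rule of a contraction. The signs in (2) have two sources.
  Each commutator with a contraction contributes -1 through its surviving summand, which gives
  (-1)^r, while the degree-dependent signs disappear because Q has degree 1. Lowering all degrees by
  one changes the exponent of the shift sign by 0 + 1 + ... + (r - 1), the exponent r(r-1)/2 built
  into \<open>bracket'\<close>. Finally, Q of a function has arity one because all degrees of the
  bundle are negative, so total degree -1 admits a single argument.\<close>

lemma Ck_on_subset:
  assumes "Ck_on k S f" and "T \<subseteq> S"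
  shows "Ck_on k T f"
  using assms
  by (induction k arbitrary: f) (auto intro: continuous_on_subset)

lemma Ck_on_Suc_imp_Ck_on:
  assumes "Ck_on (Suc k) S f"
  shows "Ck_on k S f"
  using assms
proof (induction k arbitrary: f)
  case 0
  then show ?case
    by (auto intro: continuous_at_imp_continuous_on differentiable_imp_continuous_within)
next
  case (Suc k)
  then show ?case
    using Ck_on.simps(2) by blast
qed

text \<open>Openness of \<open>S\<close> lets agreement on \<open>S\<close> pass to the derivatives,
  which are taken in the ambient space and would otherwise see values outside
  \<open>S\<close>.\<close>

lemma Ck_on_cong:
  fixes f g :: "'a::real_normed_vector \<Rightarrow> 'b::real_normed_vector"
  assumes "open S" and "\<And>x. x \<in> S \<Longrightarrow> f x = g x" and "Ck_on k S f"
  shows "Ck_on k S g"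
  using assms(2,3)
proof (induction k arbitrary: f g)
  case 0
  then show ?case
    using continuous_on_cong by (metis Ck_on.simps(1))
next
  case (Suc k)
  have der: "(g has_derivative frechet_derivative f (at x)) (at x)" if "x \<in> S" for x
  proof -
    have "(f has_derivative frechet_derivative f (at x)) (at x)"
      using Suc.prems(2) that by (simp add: frechet_derivative_works)
    then show ?thesis
      by (rule has_derivative_transform_within_open[OF _ assms(1) that Suc.prems(1)])
  qed
  have "frechet_derivative g (at x) = frechet_derivative f (at x)" if "x \<in> S" for x
    using frechet_derivative_at[OF der[OF that]] by simp
  then have "Ck_on k S (\<lambda>x. frechet_derivative g (at x) v)" for v
    using Suc.IH[of "\<lambda>x. frechet_derivative f (at x) v" "\<lambda>x. frechet_derivative g (at x) v"]
      Suc.prems(2) by simp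
  then show ?case
    using der by (auto simp: differentiable_def)
qed

lemma Ck_on_Un:
  assumes "open S" "open T" "Ck_on k S f" "Ck_on k T f"
  shows "Ck_on k (S \<union> T) f"
  using assms
  by (induction k arbitrary: f) (auto intro: continuous_on_open_Un)

text \<open>By uniqueness of derivatives, any pointwise derivative may replace the choice made by
  \<open>frechet_derivative\<close>, so the usual rules of calculus apply below.\<close>

lemma Ck_on_derivativeI:
  assumes "open S"
    and "\<And>x. x \<in> S \<Longrightarrow> (f has_derivative f' x) (at x)"
    and "\<And>v. Ck_on k S (\<lambda>x. f' x v)"
  shows "Ck_on (Suc k) S f"
proof -
  have eq: "f' x v = frechet_derivative f (at x) v" if "x \<in> S" for x v
    using frechet_derivative_at[OF assms(2)[OF that]] by simp
  have "Ck_on k S (\<lambda>x. frechet_derivative f (at x) v)" for v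
    by (rule Ck_on_cong[OF assms(1) eq assms(3)])
  then show ?thesis
    using assms(2) by (auto simp: differentiable_def)
qed

lemma Ck_on_Suc_has_derivative:
  assumes "Ck_on (Suc k) S f" "x \<in> S"
  shows "(f has_derivative frechet_derivative f (at x)) (at x)"
  using assms by (simp add: frechet_derivative_works)

lemma Ck_on_const:
  assumes "open S"
  shows "Ck_on k S (\<lambda>_. c)"
proof (induction k arbitrary: c)
  case (Suc k)
  show ?case
    by (rule Ck_on_derivativeI[OF assms has_derivative_const Suc])
qed simp

lemma Ck_on_add:
  assumes "open S" "Ck_on k S f" "Ck_on k S g"
  shows "Ck_on k S (\<lambda>x. f x + g x)"
  using assms(2,3)
proof (induction k arbitrary: f g)
  case (Suc k)
  show ?case
    by (rule Ck_on_derivativeI[OF assms(1)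
          has_derivative_add[OF Ck_on_Suc_has_derivative[OF Suc.prems(1)]
            Ck_on_Suc_has_derivative[OF Suc.prems(2)]] Suc.IH])
      (use Suc.prems in auto)
qed (auto intro: continuous_on_add)

lemma Ck_on_mult:
  fixes f g :: "'a::real_normed_vector \<Rightarrow> real"
  assumes "open S" "Ck_on k S f" "Ck_on k S g"
  shows "Ck_on k S (\<lambda>x. f x * g x)"
  using assms(2,3)
proof (induction k arbitrary: f g)
  case (Suc k)
  \<comment> \<open>The product rule leaves one factor undifferentiated, so both factors are needed
    at the lower order as well.\<close>
  have low: "Ck_on k S f" "Ck_on k S g"
    using Suc.prems by (blast intro: Ck_on_Suc_imp_Ck_on)+
  have der: "Ck_on k S (\<lambda>x. f x * frechet_derivative g (at x) v + frechet_derivative f (at x) v * g x)"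
    for v
    using Suc.prems by (intro Ck_on_add[OF assms(1)] Suc.IH low) auto
  show ?case
    by (rule Ck_on_derivativeI[OF assms(1)
          has_derivative_mult[OF Ck_on_Suc_has_derivative[OF Suc.prems(1)]
            Ck_on_Suc_has_derivative[OF Suc.prems(2)]]])
      (assumption | rule der)+
qed (auto intro: continuous_on_mult)

lemma Ck_on_bounded_linear:
  assumes "open S" "bounded_linear L" "Ck_on k S f"
  shows "Ck_on k S (\<lambda>x. L (f x))"
  using assms(3)
proof (induction k arbitrary: f)
  case 0
  then show ?case
    using bounded_linear.continuous_on[OF assms(2)] by auto
next
  case (Suc k)
  show ?case
    by (rule Ck_on_derivativeI[OF assms(1)
          bounded_linear.has_derivative[OF assms(2) Ck_on_Suc_has_derivative[OF Suc.prems]]])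
      (use Suc in auto)
qed

text \<open>All derivatives of \<open>flat 0\<close> are linear combinations of the functions \<open>flat m\<close>.\<close>

definition flat :: "nat \<Rightarrow> real \<Rightarrow> real" where
  "flat m x = (if x > 0 then exp (- inverse x) * inverse x ^ m else 0)"

text \<open>Substituting \<open>inverse x\<close> for \<open>x\<close> turns this into the decay of
  a power against the exponential.\<close>

lemma flat_tendsto_0: "((\<lambda>x. flat m x) \<longlongrightarrow> 0) (at (0::real))"
proof -
  have "((\<lambda>x. x ^ m / exp x) \<longlongrightarrow> (0::real)) at_top"
    by (rule tendsto_power_div_exp_0)
  then have "((\<lambda>x. inverse x ^ m / exp (inverse x)) \<longlongrightarrow> (0::real)) (at_right 0)"
    by (rule filterlim_compose[OF _ filterlim_inverse_at_top_right])
  then have R: "((\<lambda>x. flat m x) \<longlongrightarrow> 0) (at_right 0)"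
    by (rule Lim_transform_eventually)
      (auto simp: eventually_at_right_less flat_def exp_minus field_simps
        intro: eventually_at_rightI[of 0 1])
  have L: "((\<lambda>x. flat m x) \<longlongrightarrow> 0) (at_left 0)"
    by (rule Lim_transform_eventually[OF tendsto_const])
      (auto simp: flat_def intro: eventually_at_leftI[of "-1"])
  show ?thesis
    using L R by (simp add: filterlim_split_at)
qed

lemma flat_has_real_derivative:
  "(flat m has_real_derivative (flat (m + 2) x - real m * flat (m + 1) x)) (at x)"
proof -
  consider "x > 0" | "x < 0" | "x = 0" by linarith
  then show ?thesis
  proof cases
    case 1
    have inv: "(inverse has_real_derivative - (inverse x * inverse x)) (at x)"
      using DERIV_inverse[of x] 1 by simp
    have pow: "((\<lambda>x. inverse x ^ m) has_real_derivative - (real m * inverse x ^ (m + 1))) (at x)"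
      using DERIV_power[OF inv, of m] by (cases m) (simp_all add: algebra_simps)
    have ex: "((\<lambda>x. exp (- inverse x)) has_real_derivative
        exp (- inverse x) * (inverse x * inverse x)) (at x)"
      using DERIV_fun_exp[OF DERIV_minus[OF inv]] by simp
    have "((\<lambda>x. exp (- inverse x) * inverse x ^ m) has_real_derivative
        (flat (m + 2) x - real m * flat (m + 1) x)) (at x)"
      by (rule DERIV_cong[OF DERIV_mult[OF ex pow]]) (use 1 in \<open>simp add: flat_def algebra_simps\<close>)
    then show ?thesis
      by (rule has_field_derivative_transform_within_open[where S = "{0<..}"])
        (use 1 in \<open>auto simp: flat_def\<close>)
  next
    case 2
    have "((\<lambda>x. 0) has_real_derivative (flat (m + 2) x - real m * flat (m + 1) x)) (at x)"
      using 2 by (auto simp: flat_def)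
    then show ?thesis
      by (rule has_field_derivative_transform_within_open[where S = "{..<0}"])
        (use 2 in \<open>auto simp: flat_def\<close>)
  next
    case 3
    \<comment> \<open>At 0 the difference quotient of \<open>flat m\<close> is
      \<open>flat (Suc m)\<close>.\<close>
    have "((\<lambda>h. (flat m (0 + h) - flat m 0) / h) \<longlongrightarrow> 0) (at 0)"
      by (rule Lim_transform_eventually[OF flat_tendsto_0[of "Suc m"]])
        (auto simp: flat_def field_simps eventually_at_filter)
    then show ?thesis
      using 3 by (simp add: DERIV_def flat_def)
  qed
qed

text \<open>The exponent \<open>m\<close> varies in the induction because one derivative of
  \<open>flat m\<close> involves \<open>flat (m + 1)\<close> and
  \<open>flat (m + 2)\<close>.\<close>

lemma Ck_on_flat_compose:
  fixes u :: "'a::real_normed_vector \<Rightarrow> real"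
  assumes "open S" "\<And>k. Ck_on k S u"
  shows "Ck_on k S (\<lambda>x. flat m (u x))"
proof (induction k arbitrary: m)
  case 0
  have "continuous_on UNIV (flat m)"
    using flat_has_real_derivative
    by (meson DERIV_isCont continuous_at_imp_continuous_on)
  then show ?case
    using assms(2)[of 0]
    by (auto intro: continuous_on_compose2)
next
  case (Suc k)
  let ?u' = "\<lambda>x. frechet_derivative u (at x)"
  have "((\<lambda>x. flat m (u x)) has_derivative
      (\<lambda>v. (flat (m + 2) (u x) + (- real m) * flat (m + 1) (u x)) * ?u' x v)) (at x)"
    if "x \<in> S" for x
    using has_derivative_compose[OF Ck_on_Suc_has_derivative[OF assms(2) that]
        flat_has_real_derivative[unfolded has_field_derivative_def]]
    by simp
  moreover have "Ck_on k S (\<lambda>x. (flat (m + 2) (u x) + (- real m) * flat (m + 1) (u x)) * ?u' x v)"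
    for v
    using Suc assms(2)[of "Suc k"]
    by (intro Ck_on_mult Ck_on_add Ck_on_const assms(1)) auto
  ultimately show ?case
    by (rule Ck_on_derivativeI[OF assms(1)])
qed

section \<open>Bump functions\<close>

lemma coefficient_le_norm:
  fixes b w :: "'a::real_normed_vector"
  assumes "w \<in> span S"
  shows "\<bar>a\<bar> * infdist b (span S) \<le> norm (a *\<^sub>R b + w)"
proof (cases "a = 0")
  case False
  \<comment> \<open>Division by \<open>a\<close> turns the vector into \<open>b\<close> minus a
    point of the span, whose norm is at least the distance of \<open>b\<close> from the
    span.\<close>
  have "- (inverse a *\<^sub>R w) \<in> span S"
    using assms by (simp add: span_neg span_scale)
  then have "infdist b (span S) \<le> norm (b + inverse a *\<^sub>R w)"
    using infdist_le[of "- (inverse a *\<^sub>R w)" "span S" b] by (simp add: dist_norm)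
  then have "\<bar>a\<bar> * infdist b (span S) \<le> norm (a *\<^sub>R (b + inverse a *\<^sub>R w))"
    by (simp add: mult_left_mono)
  then show ?thesis using False by (simp add: scaleR_add_right)
qed simp

text \<open>The coefficient bound makes the \<open>b\<close>-coefficients of a convergent sequence
  Cauchy; completeness of the reals supplies the limit coefficient, and closedness of the smaller
  span takes care of the rest.\<close>

lemma closed_span_insert:
  fixes b :: "'a::real_normed_vector"
  assumes "closed (span S)"
  shows "closed (span (insert b S))"
proof (cases "b \<in> span S")
  case True
  then show ?thesis
    using assms by (simp add: span_redundant)
next
  case False
  have ne: "span S \<noteq> {}" using span_zero by blast
  define d where "d = infdist b (span S)"
  have "d > 0"
    using False assms ne infdist_pos_not_in_closed d_def by blast
  note bound = coefficient_le_norm[of _ S _ b, folded d_def]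
  show ?thesis
    unfolding closed_sequential_limits
  proof (intro allI impI, elim conjE)
    fix x l assume x: "\<forall>n. x n \<in> span (insert b S)" and lim: "x \<longlonglongrightarrow> l"
    obtain a where a: "x n - a n *\<^sub>R b \<in> span S" for n
      using x unfolding span_insert by auto metis
    have "Cauchy a"
      unfolding Cauchy_def
    proof (intro allI impI)
      fix e :: real assume "e > 0"
      then have "e * d > 0" using \<open>d > 0\<close> by simp
      then obtain M where M: "norm (x m - x n) < e * d" if "m \<ge> M" "n \<ge> M" for m n
        using LIMSEQ_imp_Cauchy[OF lim] unfolding Cauchy_def dist_norm by blast
      have "\<bar>a m - a n\<bar> < e" if "m \<ge> M" "n \<ge> M" for m n
      proof -
        have "\<bar>a m - a n\<bar> * d
            \<le> norm ((a m - a n) *\<^sub>R b + ((x m - a m *\<^sub>R b) - (x n - a n *\<^sub>R b)))"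
          by (rule bound) (simp add: a span_diff)
        also have "\<dots> = norm (x m - x n)" by (simp add: algebra_simps)
        also have "\<dots> < e * d" using M that by simp
        finally show ?thesis using \<open>d > 0\<close> by simp
      qed
      then show "\<exists>M. \<forall>m\<ge>M. \<forall>n\<ge>M. dist (a m) (a n) < e"
        by (auto simp: dist_norm)
    qed
    then obtain c where "a \<longlonglongrightarrow> c"
      using Cauchy_convergent convergent_def by blast
    then have "(\<lambda>n. x n - a n *\<^sub>R b) \<longlonglongrightarrow> l - c *\<^sub>R b"
      by (intro tendsto_intros lim)
    then have "l - c *\<^sub>R b \<in> span S"
      by (rule closed_sequentially[OF assms, rotated]) (rule a)
    then show "l \<in> span (insert b S)"
      unfolding span_insert by blast
  qed
qed

lemma closed_span_finite:
  fixes S :: "'a::real_normed_vector set"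
  assumes "finite S"
  shows "closed (span S)"
  using assms by (induction S) (simp_all add: closed_span_insert)

text \<open>The \<open>b\<close>-coordinate is bounded through the inverse distance of
  \<open>b\<close> from the span of the other basis vectors; that distance is positive because
  finite spans are closed.\<close>

lemma bounded_linear_representation:
  fixes B :: "'a::real_normed_vector set"
  assumes "finite B" "independent B" "span B = UNIV" "b \<in> B"
  shows "bounded_linear (\<lambda>x. representation B x b)"
proof -
  let ?S = "span (B - {b})"
  have ne: "?S \<noteq> {}" using span_zero by blast
  have "b \<notin> ?S" using assms(2,4) by (auto simp: dependent_def)
  define d where "d = infdist b ?S"
  have "d > 0"
    unfolding d_def
    by (rule infdist_pos_not_in_closed[OF closed_span_finite ne \<open>b \<notin> ?S\<close>]) (use assms in auto)
  have lin: "representation B (x + y) b = representation B x b + representation B y b"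
    "representation B (r *\<^sub>R x) b = r * representation B x b" for x y r
    using assms by (simp_all add: representation_add representation_scale)
  show ?thesis
  proof (rule bounded_linear_intro[where K = "inverse d"])
    fix x
    let ?a = "representation B x b"
    have "x = (\<Sum>v\<in>B. representation B x v *\<^sub>R v)"
      using assms by (simp add: sum_representation_eq)
    also have "\<dots> = ?a *\<^sub>R b + (\<Sum>v\<in>B - {b}. representation B x v *\<^sub>R v)"
      using assms by (simp add: sum.remove)
    finally obtain w where w: "x = ?a *\<^sub>R b + w" "w \<in> ?S"
      by (metis (no_types, lifting) span_base span_scale span_sum)
    have "\<bar>?a\<bar> * d \<le> norm x"
      using coefficient_le_norm[OF w(2), of ?a b] w(1) by (simp add: d_def)
    then show "norm ?a \<le> norm x * inverse d"
      using \<open>d > 0\<close> by (simp add: field_simps)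
  qed (use lin in auto)
qed

text \<open>The cube is a Minkowski sum of compact segments. It supplies the compact support of the
  bump function.\<close>

lemma compact_finite_cube:
  fixes B :: "'a::real_normed_vector set"
  assumes "finite B"
  shows "compact {x. \<exists>a. (\<forall>b\<in>B. \<bar>a b\<bar> \<le> c) \<and> x = (\<Sum>b\<in>B. a b *\<^sub>R b)}"
  using assms
proof (induction B)
  case (insert b B)
  let ?C = "\<lambda>B. {x. \<exists>a. (\<forall>b\<in>B. \<bar>a b\<bar> \<le> c) \<and> x = (\<Sum>b\<in>B. a b *\<^sub>R b)}"
  let ?I = "(\<lambda>t. t *\<^sub>R b) ` {- c..c}"
  have "?C (insert b B) = {x + y |x y. x \<in> ?I \<and> y \<in> ?C B}"
  proof (intro set_eqI iffI)
    fix x assume "x \<in> {x + y |x y. x \<in> ?I \<and> y \<in> ?C B}"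
    then obtain t a where ta: "t \<in> {- c..c}" "\<forall>b\<in>B. \<bar>a b\<bar> \<le> c"
      "x = t *\<^sub>R b + (\<Sum>b\<in>B. a b *\<^sub>R b)"
      by blast
    have "(\<Sum>v\<in>B. (a(b := t)) v *\<^sub>R v) = (\<Sum>v\<in>B. a v *\<^sub>R v)"
      using insert.hyps by (intro sum.cong) auto
    then have "x = (\<Sum>v\<in>insert b B. (a(b := t)) v *\<^sub>R v)"
      using ta insert.hyps by simp
    moreover have "\<forall>v\<in>insert b B. \<bar>(a(b := t)) v\<bar> \<le> c"
      using ta by auto
    ultimately show "x \<in> ?C (insert b B)" by blast
  next
    fix x assume "x \<in> ?C (insert b B)"
    then obtain a where "\<forall>v\<in>insert b B. \<bar>a v\<bar> \<le> c" "x = (\<Sum>v\<in>insert b B. a v *\<^sub>R v)"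
      by blast
    then have "x = a b *\<^sub>R b + (\<Sum>v\<in>B. a v *\<^sub>R v)" "a b *\<^sub>R b \<in> ?I"
      "(\<Sum>v\<in>B. a v *\<^sub>R v) \<in> ?C B"
      using insert.hyps by (simp, intro image_eqI[OF refl], simp add: abs_le_iff minus_le_iff, blast)
    then show "x \<in> {x + y |x y. x \<in> ?I \<and> y \<in> ?C B}" by blast
  qed
  moreover have "compact ?I"
    by (intro compact_continuous_image continuous_intros) auto
  ultimately show ?case
    using compact_sums[OF _ insert.IH, of ?I] by (simp only:)
qed simp

text \<open>The witness is \<open>flat 0\<close> of \<open>d\<close> squared minus the sum of
  squared coordinate differences. Smoothness is stated for composites with a smooth
  \<open>F\<close>, since it is needed only after a transition map between charts; this replaces a
  general chain rule.\<close>

lemma open_bump_fun: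
  fixes W :: "'a::real_normed_vector set"
  assumes B: "finite B" "span B = (UNIV :: 'a set)" and W: "open W" "x0 \<in> W"
  obtains \<beta> :: "'a \<Rightarrow> real" and K where "compact K" "K \<subseteq> W" "\<beta> x0 \<noteq> 0"
    "\<And>x. x \<notin> K \<Longrightarrow> \<beta> x = 0"
    "\<And>S (F :: 'b::real_normed_vector \<Rightarrow> 'a) k. \<lbrakk>open S; smooth_on S F\<rbrakk> \<Longrightarrow> Ck_on k S (\<lambda>y. \<beta> (F y))"
proof -
  obtain C where C: "C \<subseteq> B" "independent C" "span C = span B"
  proof -
    obtain C where C: "C \<subseteq> B" "independent C" "B \<subseteq> span C"
      using maximal_independent_subset[of B] by blast
    then have "span C = span B"
      by (intro subset_antisym span_mono span_minimal subspace_span)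
    with C(1,2) show thesis by (rule that)
  qed
  have fin: "finite C" using C(1) B(1) finite_subset by blast
  have sC: "span C = UNIV" using C B by simp
  define rp where "rp = (\<lambda>b x. representation C x b)"
  have bl: "bounded_linear (rp b)" if "b \<in> C" for b
    unfolding rp_def using bounded_linear_representation[OF fin C(2) sC that] .
  have rep: "x = (\<Sum>b\<in>C. rp b x *\<^sub>R b)" for x
    using C(2) fin sC by (simp add: rp_def sum_representation_eq)
  obtain e where e: "e > 0" "ball x0 e \<subseteq> W"
    using W openE by blast
  \<comment> \<open>The summand 1 keeps \<open>M\<close> positive in dimension 0, where
    \<open>C\<close> is empty. With \<open>d\<close> as below, points of the cube lie within
    \<open>d * M\<close>, that is \<open>e / 2\<close>, of \<open>x0\<close>.\<close>
  define M where "M = 1 + (\<Sum>b\<in>C. norm b)"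
  have "M > 0" unfolding M_def by (simp add: add_pos_nonneg sum_nonneg)
  define d where "d = e / (2 * M)"
  have "d > 0" using e \<open>M > 0\<close> by (simp add: d_def)
  define Q where "Q = {x. \<exists>a. (\<forall>b\<in>C. \<bar>a b\<bar> \<le> d) \<and> x = (\<Sum>b\<in>C. a b *\<^sub>R b)}"
  define K where "K = (\<lambda>x. x0 + x) ` Q"
  define u where "u = (\<lambda>x. d\<^sup>2 + (\<Sum>b\<in>C. - ((rp b x - rp b x0) * (rp b x - rp b x0))))"
  define \<beta> where "\<beta> = (\<lambda>x. flat 0 (u x))"
  have "compact Q" unfolding Q_def by (rule compact_finite_cube[OF fin])
  then have "compact K" unfolding K_def by (rule compact_translation)
  moreover have "K \<subseteq> W"
  proof
    fix x assume "x \<in> K"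
    then obtain a where a: "\<And>b. b \<in> C \<Longrightarrow> \<bar>a b\<bar> \<le> d" "x = x0 + (\<Sum>b\<in>C. a b *\<^sub>R b)"
      by (auto simp: K_def Q_def)
    have "dist x0 x \<le> (\<Sum>b\<in>C. norm (a b *\<^sub>R b))"
      using norm_sum[of "\<lambda>b. a b *\<^sub>R b" C] by (simp add: a(2) dist_norm del: norm_scaleR)
    also have "\<dots> \<le> (\<Sum>b\<in>C. d * norm b)"
      using a(1) by (intro sum_mono) (simp add: mult_right_mono)
    also have "\<dots> \<le> d * M"
      using \<open>d > 0\<close> by (simp add: M_def sum_distrib_left algebra_simps)
    also have "\<dots> < e" using \<open>M > 0\<close> e by (simp add: d_def)
    finally show "x \<in> W" using e(2) by auto
  qed
  moreover have "\<beta> x0 \<noteq> 0"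
    using \<open>d > 0\<close> by (simp add: \<beta>_def u_def flat_def)
  moreover have "\<beta> x = 0" if "x \<notin> K" for x
  proof (rule ccontr)
    assume "\<beta> x \<noteq> 0"
    then have "u x > 0" by (simp add: \<beta>_def flat_def split: if_splits)
    have "\<bar>rp b (x - x0)\<bar> \<le> d" if "b \<in> C" for b
    proof -
      have "(rp b x - rp b x0) * (rp b x - rp b x0)
          \<le> (\<Sum>b\<in>C. (rp b x - rp b x0) * (rp b x - rp b x0))"
        by (rule member_le_sum[OF that _ fin]) auto
      then have "(rp b x - rp b x0)\<^sup>2 < d\<^sup>2"
        using \<open>u x > 0\<close> by (simp add: u_def sum_negf power2_eq_square)
      then have "\<bar>rp b x - rp b x0\<bar> < d"
        using \<open>d > 0\<close> by (intro power2_less_imp_less[of "\<bar>_\<bar>"]) simp_all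
      moreover have "rp b (x - x0) = rp b x - rp b x0"
        using bl[OF that] by (simp add: linear_diff bounded_linear.linear)
      ultimately show ?thesis by simp
    qed
    then have "x - x0 \<in> Q"
      unfolding Q_def using rep[of "x - x0"]
      by (intro CollectI exI[of _ "\<lambda>b. rp b (x - x0)"] conjI ballI)
    then have "x \<in> K" unfolding K_def by (intro image_eqI[of _ _ "x - x0"]) simp_all
    then show False using that by simp
  qed
  moreover have "Ck_on k S (\<lambda>y. \<beta> (F y))"
    if S: "open S" and F: "smooth_on S F" for k S and F :: "'b \<Rightarrow> 'a"
  proof -
    have "Ck_on k S (\<lambda>y. \<Sum>b\<in>D. - ((rp b (F y) - rp b x0) * (rp b (F y) - rp b x0)))"
      if "finite D" "D \<subseteq> C" for k D
      using that
    proof (induction D)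
      case (insert b D)
      then have b: "Ck_on k S (\<lambda>y. rp b (F y) + - rp b x0)"
        using Ck_on_bounded_linear[OF S bl] F
        by (intro Ck_on_add[OF S] Ck_on_const[OF S]) (auto simp: smooth_on_def)
      have "Ck_on k S (\<lambda>y. (-1) * ((rp b (F y) + - rp b x0) * (rp b (F y) + - rp b x0)) +
          (\<Sum>b\<in>D. - ((rp b (F y) - rp b x0) * (rp b (F y) - rp b x0))))"
        using insert by (intro Ck_on_add[OF S] Ck_on_mult[OF S] Ck_on_const[OF S] b) auto
      then show ?case using insert.hyps by simp
    qed (simp add: Ck_on_const[OF S])
    then have "Ck_on k S (\<lambda>y. u (F y))" for k
      unfolding u_def by (intro Ck_on_add[OF S] Ck_on_const[OF S]) (simp add: fin)
    then show ?thesis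
      unfolding \<beta>_def by (rule Ck_on_flat_compose[OF S])
  qed
  ultimately show thesis by (rule that)
qed

section \<open>Smooth functions and bundles on manifolds\<close>

locale smooth_mfd =
  fixes A :: "('m::{t2_space,second_countable_topology}, 'e::real_normed_vector) atlas"
  assumes mfd: "smooth_manifold A"
begin

lemma chart_openD: "(U, \<phi>) \<in> A \<Longrightarrow> open U"
  using mfd by (auto simp: smooth_manifold_def)

lemma chart_homeomorphism: "(U, \<phi>) \<in> A \<Longrightarrow> homeomorphism U (\<phi> ` U) \<phi> (inv_into U \<phi>)"
  using mfd by (auto simp: smooth_manifold_def)

lemma chart_inv: "(U, \<phi>) \<in> A \<Longrightarrow> p \<in> U \<Longrightarrow> inv_into U \<phi> (\<phi> p) = p"
  using chart_homeomorphism by (blast dest: homeomorphism_apply1)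

lemma open_chart_image:
  assumes "(U, \<phi>) \<in> A" "open W"
  shows "open (\<phi> ` (U \<inter> W))"
proof -
  have "open (\<phi> ` U)" using mfd assms(1) by (auto simp: smooth_manifold_def)
  moreover have "openin (top_of_set (\<phi> ` U)) (\<phi> ` (U \<inter> W))"
    by (rule homeomorphism_imp_open_map[OF chart_homeomorphism[OF assms(1)]])
      (simp add: assms(2) openin_open_Int)
  ultimately show ?thesis by (rule openin_open_trans[rotated])
qed

lemma smooth_fun_onI:
  assumes "\<And>U \<phi> k. (U, \<phi>) \<in> A \<Longrightarrow> Ck_on k (\<phi> ` (U \<inter> W)) (f \<circ> inv_into U \<phi>)"
  shows "smooth_fun_on A W f"
  using assms by (auto simp: smooth_fun_on_def smooth_on_def)

lemma smooth_fun_onD: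
  assumes "smooth_fun_on A W f" "(U, \<phi>) \<in> A"
  shows "Ck_on k (\<phi> ` (U \<inter> W)) (f \<circ> inv_into U \<phi>)"
  using assms by (auto simp: smooth_fun_on_def smooth_on_def)

lemma smooth_fun_on_subset: "smooth_fun_on A W f \<Longrightarrow> V \<subseteq> W \<Longrightarrow> smooth_fun_on A V f"
  by (intro smooth_fun_onI, rule Ck_on_subset[OF smooth_fun_onD]) auto

lemma smooth_fun_on_cong:
  assumes "open W" "\<And>p. p \<in> W \<Longrightarrow> f p = g p" "smooth_fun_on A W f"
  shows "smooth_fun_on A W g"
  by (intro smooth_fun_onI, rule Ck_on_cong[OF open_chart_image _ smooth_fun_onD[OF assms(3)]])
    (use assms chart_inv in auto)

lemma smooth_fun_on_Un:
  assumes "open W" "open V" "smooth_fun_on A W f" "smooth_fun_on A V f"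
  shows "smooth_fun_on A (W \<union> V) f"
  using assms
  by (intro smooth_fun_onI) (auto simp: Int_Un_distrib image_Un
      intro!: Ck_on_Un open_chart_image smooth_fun_onD)

lemma smooth_fun_on_const: "open W \<Longrightarrow> smooth_fun_on A W (\<lambda>_. c)"
  by (intro smooth_fun_onI) (simp add: comp_def Ck_on_const open_chart_image)

lemma smooth_fun_on_add:
  assumes "open W" "smooth_fun_on A W f" "smooth_fun_on A W g"
  shows "smooth_fun_on A W (\<lambda>p. f p + g p)"
proof (rule smooth_fun_onI)
  fix U \<phi> k assume "(U, \<phi>) \<in> A"
  from Ck_on_add[OF open_chart_image[OF this assms(1)] smooth_fun_onD[OF assms(2) this]
      smooth_fun_onD[OF assms(3) this]]
  show "Ck_on k (\<phi> ` (U \<inter> W)) ((\<lambda>p. f p + g p) \<circ> inv_into U \<phi>)"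
    by (simp add: comp_def)
qed

lemma smooth_fun_on_mult:
  assumes "open W" "smooth_fun_on A W f" "smooth_fun_on A W g"
  shows "smooth_fun_on A W (\<lambda>p. f p * g p)"
proof (rule smooth_fun_onI)
  fix U \<phi> k assume "(U, \<phi>) \<in> A"
  from Ck_on_mult[OF open_chart_image[OF this assms(1)] smooth_fun_onD[OF assms(2) this]
      smooth_fun_onD[OF assms(3) this]]
  show "Ck_on k (\<phi> ` (U \<inter> W)) ((\<lambda>p. f p * g p) \<circ> inv_into U \<phi>)"
    by (simp add: comp_def)
qed

lemma Cinf_const: "(\<lambda>_. c) \<in> Cinf A"
  by (simp add: Cinf_def smooth_fun_on_const)

lemma Cinf_add: "f \<in> Cinf A \<Longrightarrow> g \<in> Cinf A \<Longrightarrow> (\<lambda>p. f p + g p) \<in> Cinf A"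
  by (simp add: Cinf_def smooth_fun_on_add)

lemma Cinf_mult: "f \<in> Cinf A \<Longrightarrow> g \<in> Cinf A \<Longrightarrow> (\<lambda>p. f p * g p) \<in> Cinf A"
  by (simp add: Cinf_def smooth_fun_on_mult)

lemma Cinf_smooth_fun_on: "f \<in> Cinf A \<Longrightarrow> smooth_fun_on A W f"
  by (auto simp: Cinf_def intro: smooth_fun_on_subset)

text \<open>A bump of compact support is pulled back along a chart. Since the manifold is Hausdorff,
  the support is closed in all of it, so \<open>U\<close> and \<open>- K\<close> form an open cover
  on which the extension by 0 is visibly smooth.\<close>

lemma bump_fun:
  assumes "open W" "p \<in> W"
  obtains \<theta> K where "\<theta> \<in> Cinf A" "closed K" "K \<subseteq> W" "\<theta> p \<noteq> 0" "\<And>q. q \<notin> K \<Longrightarrow> \<theta> q = 0"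
proof -
  obtain B :: "'e set" where B: "finite B" "span B = UNIV"
    using mfd by (auto simp: smooth_manifold_def)
  have "p \<in> (\<Union>(U, \<phi>)\<in>A. U)"
    using mfd by (simp add: smooth_manifold_def)
  then obtain U \<phi> where U: "(U, \<phi>) \<in> A" "p \<in> U"
    by blast
  let ?V = "\<phi> ` (U \<inter> W)"
  have V: "open ?V" "\<phi> p \<in> ?V"
    using open_chart_image[OF U(1) assms(1)] U(2) assms(2) by auto
  obtain \<beta> L where \<beta>: "compact L" "L \<subseteq> ?V" "\<beta> (\<phi> p) \<noteq> (0::real)" "\<And>x. x \<notin> L \<Longrightarrow> \<beta> x = 0"
    and smooth: "\<And>S (F :: 'e \<Rightarrow> 'e) k. \<lbrakk>open S; smooth_on S F\<rbrakk> \<Longrightarrow> Ck_on k S (\<lambda>y. \<beta> (F y))"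
    using open_bump_fun[OF B V] by metis
  define K where "K = inv_into U \<phi> ` L"
  define \<theta> where "\<theta> = (\<lambda>q. if q \<in> U then \<beta> (\<phi> q) else 0)"
  have "L \<subseteq> \<phi> ` U" using \<beta>(2) by auto
  then have "compact K"
    unfolding K_def
    using chart_homeomorphism[OF U(1)]
    by (intro compact_continuous_image \<beta>(1)) (auto simp: homeomorphism_def intro: continuous_on_subset)
  then have "closed K" by (rule compact_imp_closed)
  have "K \<subseteq> U \<inter> W"
    using \<beta>(2) chart_inv[OF U(1)] by (auto simp: K_def)
  have zero: "\<theta> q = 0" if "q \<notin> K" for q
  proof (cases "q \<in> U")
    case True
    then have "\<phi> q \<notin> L"
      using that chart_inv[OF U(1)] by (force simp: K_def)
    then show ?thesis by (simp add: \<theta>_def \<beta>(4))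
  qed (simp add: \<theta>_def)
  have "smooth_fun_on A U \<theta>"
  proof (rule smooth_fun_onI)
    fix V \<psi> k assume V: "(V, \<psi>) \<in> A"
    have open_VU: "open (\<psi> ` (V \<inter> U))" by (rule open_chart_image[OF V chart_openD[OF U(1)]])
    have "smooth_on (\<psi> ` (V \<inter> U)) (\<phi> \<circ> inv_into V \<psi>)"
      using mfd V U(1) unfolding smooth_manifold_def by blast
    from smooth[OF open_VU this] have "Ck_on k (\<psi> ` (V \<inter> U)) (\<lambda>y. \<beta> ((\<phi> \<circ> inv_into V \<psi>) y))" .
    then show "Ck_on k (\<psi> ` (V \<inter> U)) (\<theta> \<circ> inv_into V \<psi>)"
      by (rule Ck_on_cong[OF open_VU, rotated]) (auto simp: \<theta>_def chart_inv[OF V])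
  qed
  moreover have "smooth_fun_on A (- K) \<theta>"
    by (rule smooth_fun_on_cong[OF _ _ smooth_fun_on_const[of _ 0]])
      (use \<open>closed K\<close> zero in \<open>auto simp: open_Compl\<close>)
  ultimately have "smooth_fun_on A (U \<union> - K) \<theta>"
    by (intro smooth_fun_on_Un chart_openD[OF U(1)] open_Compl \<open>closed K\<close>)
  moreover have "U \<union> - K = UNIV" using \<open>K \<subseteq> U \<inter> W\<close> by auto
  ultimately have "\<theta> \<in> Cinf A" by (simp add: Cinf_def)
  moreover have "\<theta> p \<noteq> 0" using U(2) \<beta>(3) by (simp add: \<theta>_def)
  ultimately show thesis
    using that \<open>closed K\<close> \<open>K \<subseteq> U \<inter> W\<close> zero by blast
qed

lemma smooth_fun_on_extend_by_0:
  assumes "open V" "open W" "closed K" "K \<subseteq> W" "smooth_fun_on A (V \<inter> W) f"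
    and "\<theta> \<in> Cinf A" "\<And>q. q \<notin> K \<Longrightarrow> \<theta> q = 0"
  shows "smooth_fun_on A V (\<lambda>q. if q \<in> W then \<theta> q * f q else 0)"
proof -
  let ?g = "\<lambda>q. if q \<in> W then \<theta> q * f q else 0"
  have "smooth_fun_on A (V \<inter> W) ?g"
    by (rule smooth_fun_on_cong[OF _ _ smooth_fun_on_mult[OF _ Cinf_smooth_fun_on assms(5)]])
      (use assms in auto)
  moreover have "smooth_fun_on A (V - K) ?g"
    by (rule smooth_fun_on_cong[OF _ _ smooth_fun_on_const[of _ 0]]) (use assms in auto)
  ultimately have "smooth_fun_on A (V \<inter> W \<union> (V - K)) ?g"
    using assms by (intro smooth_fun_on_Un) auto
  moreover have "V \<inter> W \<union> (V - K) = V" using assms(4) by auto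
  ultimately show ?thesis by simp
qed

end

lemma representation_bij_sum:
  fixes e :: "nat \<Rightarrow> 'v::real_vector"
  assumes "inj_on e {..<r}" "independent (e ` {..<r})" "v \<in> span (e ` {..<r})"
  shows "(\<Sum>i<r. representation (e ` {..<r}) v (e i) *\<^sub>R e i) = v"
proof -
  have "(\<Sum>b\<in>e ` {..<r}. representation (e ` {..<r}) v b *\<^sub>R b) = v"
    by (rule sum_representation_eq) (use assms in auto)
  then show ?thesis using assms(1) by (simp add: sum.reindex)
qed

locale mfd_bundle = smooth_mfd A
  for A :: "('m::{t2_space,second_countable_topology}, 'e::real_normed_vector) atlas" +
  fixes B :: "('m, 'v::real_vector) vbundle"
  assumes is_bundle: "vector_bundle A B"
begin

lemma frame_transition_smooth:
  "\<lbrakk>(U, e) \<in> frames B; (V, e') \<in> frames B; i < bundle_rank B; j < bundle_rank B\<rbrakk>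
    \<Longrightarrow> smooth_fun_on A (U \<inter> V) (\<lambda>p. frame_coord (bundle_rank B) e i p (e' j p))"
  using is_bundle unfolding vector_bundle_def by fast

lemma frame_openD: "(U, e) \<in> frames B \<Longrightarrow> open U"
  using is_bundle by (auto simp: vector_bundle_def)

lemma frame_at:
  assumes "(U, e) \<in> frames B" "p \<in> U"
  shows "inj_on (\<lambda>i. e i p) {..<bundle_rank B}" "independent ((\<lambda>i. e i p) ` {..<bundle_rank B})"
    "span ((\<lambda>i. e i p) ` {..<bundle_rank B}) = fibre B p"
proof -
  have "inj_on (\<lambda>i. e i p) {..<bundle_rank B} \<and> independent ((\<lambda>i. e i p) ` {..<bundle_rank B}) \<and>
      span ((\<lambda>i. e i p) ` {..<bundle_rank B}) = fibre B p"
    using is_bundle assms unfolding vector_bundle_def by blast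
  then show "inj_on (\<lambda>i. e i p) {..<bundle_rank B}" "independent ((\<lambda>i. e i p) ` {..<bundle_rank B})"
    "span ((\<lambda>i. e i p) ` {..<bundle_rank B}) = fibre B p"
    by blast+
qed

lemma frame_in_fibre:
  assumes "(U, e) \<in> frames B" "p \<in> U" "i < bundle_rank B"
  shows "e i p \<in> fibre B p"
  using frame_at(3)[OF assms(1,2)] assms(3) by (metis imageI lessThan_iff span_base)

lemma frame_coord_lin:
  assumes "(U, e) \<in> frames B" "p \<in> U" "v \<in> fibre B p" "w \<in> fibre B p"
  shows "frame_coord (bundle_rank B) e i p (a *\<^sub>R v + b *\<^sub>R w) =
    a * frame_coord (bundle_rank B) e i p v + b * frame_coord (bundle_rank B) e i p w"
proof -
  have "v \<in> span ((\<lambda>i. e i p) ` {..<bundle_rank B})" "w \<in> span ((\<lambda>i. e i p) ` {..<bundle_rank B})"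
    using assms(3,4) frame_at(3)[OF assms(1,2)] by blast+
  then show ?thesis
    unfolding frame_coord_def using frame_at(2)[OF assms(1,2)]
    by (simp add: representation_add representation_scale span_scale)
qed

lemma frame_coord_sum:
  assumes "(U, e) \<in> frames B" "p \<in> U" "v \<in> fibre B p"
  shows "(\<Sum>i<bundle_rank B. frame_coord (bundle_rank B) e i p v *\<^sub>R e i p) = v"
  unfolding frame_coord_def
  using representation_bij_sum[OF frame_at(1,2)[OF assms(1,2)]] frame_at(3)[OF assms(1,2)] assms(3)
  by simp

lemma subspace_fibre: "subspace (fibre B p)"
  using is_bundle by (auto simp: vector_bundle_def)

lemma section_fibre: "x \<in> sections A B \<Longrightarrow> x p \<in> fibre B p"
  by (auto simp: sections_def)

lemma section_smooth:
  "\<lbrakk>x \<in> sections A B; (U, e) \<in> frames B; i < bundle_rank B\<rbrakk>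
    \<Longrightarrow> smooth_fun_on A U (\<lambda>p. frame_coord (bundle_rank B) e i p (x p))"
  unfolding sections_def by fast

lemma sections_lin:
  assumes "x \<in> sections A B" "y \<in> sections A B" "f \<in> Cinf A" "g \<in> Cinf A"
  shows "(\<lambda>p. f p *\<^sub>R x p + g p *\<^sub>R y p) \<in> sections A B"
  unfolding sections_def
proof (safe)
  fix p show "f p *\<^sub>R x p + g p *\<^sub>R y p \<in> fibre B p"
    using subspace_fibre section_fibre assms by (simp add: subspace_add subspace_scale)
next
  fix U e i assume U: "(U, e) \<in> frames B" "i < bundle_rank B"
  have "smooth_fun_on A U (\<lambda>p. f p * frame_coord (bundle_rank B) e i p (x p) +
      g p * frame_coord (bundle_rank B) e i p (y p))"
    by (intro smooth_fun_on_add smooth_fun_on_mult frame_openD[OF U(1)]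
        Cinf_smooth_fun_on[OF assms(3)] Cinf_smooth_fun_on[OF assms(4)]
        section_smooth[OF assms(1) U] section_smooth[OF assms(2) U])
  then show "smooth_fun_on A U (\<lambda>p. frame_coord (bundle_rank B) e i p (f p *\<^sub>R x p + g p *\<^sub>R y p))"
    by (rule smooth_fun_on_cong[OF frame_openD[OF U(1)], rotated])
      (simp add: frame_coord_lin[OF U(1)] section_fibre assms)
qed

lemma sections_0: "(\<lambda>_. 0) \<in> sections A B"
  unfolding sections_def
proof (safe)
  fix U e i assume U: "(U, e) \<in> frames B" "i < bundle_rank B"
  show "smooth_fun_on A U (\<lambda>p. frame_coord (bundle_rank B) e i p 0)"
    by (rule smooth_fun_on_cong[OF _ _ smooth_fun_on_const[of _ 0]])
      (use U frame_openD in \<open>auto simp: frame_coord_def representation_zero\<close>)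
qed (simp add: subspace_fibre subspace_0)

text \<open>Smoothness in another frame is smoothness of the transition functions, extended by 0.
  Local frames thus become global sections.\<close>

lemma cutoff_frame_section:
  assumes "(U, e) \<in> frames B" "i < bundle_rank B"
    and "\<theta> \<in> Cinf A" "closed K" "K \<subseteq> U" "\<And>q. q \<notin> K \<Longrightarrow> \<theta> q = 0"
  shows "(\<lambda>q. if q \<in> U then \<theta> q *\<^sub>R e i q else 0) \<in> sections A B"
  unfolding sections_def
proof (safe)
  fix p show "(if p \<in> U then \<theta> p *\<^sub>R e i p else 0) \<in> fibre B p"
    using frame_in_fibre[OF assms(1) _ assms(2)] subspace_fibre[of p]
    by (simp add: subspace_0 subspace_scale)
next
  fix V e' j assume V: "(V, e') \<in> frames B" "j < bundle_rank B"
  note in_fibre = frame_in_fibre[OF assms(1) _ assms(2)]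
  have "smooth_fun_on A (V \<inter> U) (\<lambda>p. frame_coord (bundle_rank B) e' j p (e i p))"
    by (rule frame_transition_smooth[OF V(1) assms(1) V(2) assms(2)])
  then have "smooth_fun_on A V
      (\<lambda>q. if q \<in> U then \<theta> q * frame_coord (bundle_rank B) e' j q (e i q) else 0)"
    by (rule smooth_fun_on_extend_by_0[OF frame_openD[OF V(1)] frame_openD[OF assms(1)] assms(4,5)
          _ assms(3,6)])
  then show "smooth_fun_on A V (\<lambda>p. frame_coord (bundle_rank B) e' j p
      (if p \<in> U then \<theta> p *\<^sub>R e i p else 0))"
    by (rule smooth_fun_on_cong[OF frame_openD[OF V(1)], rotated])
      (use frame_coord_lin[OF V(1) _ in_fibre in_fibre, of _ _ 0] in
        \<open>simp add: frame_coord_def representation_zero\<close>)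
qed

lemma cutoff_coframe_smooth:
  assumes "(U, e) \<in> frames B" "i < bundle_rank B"
    and "\<theta> \<in> Cinf A" "closed K" "K \<subseteq> U" "\<And>q. q \<notin> K \<Longrightarrow> \<theta> q = 0"
    and "x \<in> sections A B"
  shows "(\<lambda>q. if q \<in> U then \<theta> q * frame_coord (bundle_rank B) e i q (x q) else 0) \<in> Cinf A"
  unfolding Cinf_def mem_Collect_eq
  by (rule smooth_fun_on_extend_by_0[OF open_UNIV frame_openD[OF assms(1)] assms(4,5) _ assms(3,6)])
    (simp add: section_smooth assms)

end

section \<open>Shuffle products\<close>

text \<open>A sign given by a parity test: sign identities reduce to case distinctions on
  parities.\<close>

definition pm :: "int \<Rightarrow> real" where
  "pm a = (if even a then 1 else - 1)"

lemma minus_one_powi [simp]: "(- 1 :: real) powi a = pm a"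
  by (simp add: pm_def power_int_minus_left)

lemma pm_0 [simp]: "pm 0 = 1"
  by (simp add: pm_def)

lemma pm_add: "pm (a + b) = pm a * pm b"
  by (simp add: pm_def)

lemma pm_minus [simp]: "pm (- a) = pm a"
  by (simp add: pm_def)

lemma pm_pm [simp]: "pm a * pm a = 1" "pm a * (pm a * x) = x"
  by (simp_all add: pm_def)

lemma tdeg_simps [simp]: "tdeg [] = 0" "tdeg (X # Xs) = fst X + tdeg Xs"
  "tdeg (Xs @ Ys) = tdeg Xs + tdeg Ys"
  by (simp_all add: tdeg_def)

section \<open>Shuffles encoded by subsets of positions\<close>

lemma strict_mono_on_Sh:
  assumes "\<sigma> \<in> Sh i j"
  shows "\<lbrakk>a < b; b < i\<rbrakk> \<Longrightarrow> \<sigma> a < \<sigma> b" "\<lbrakk>i \<le> a; a < b; b < i + j\<rbrakk> \<Longrightarrow> \<sigma> a < \<sigma> b"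
  using assms by (auto simp: Sh_def strict_mono_on_def)

lemma inj_Sh: "\<sigma> \<in> Sh i j \<Longrightarrow> inj \<sigma>"
  by (auto simp: Sh_def dest: permutes_inj)

lemma Sh_image:
  assumes "\<sigma> \<in> Sh i j"
  shows "\<sigma> ` {..<i} \<subseteq> {..<i + j}" "\<sigma> ` {i..<i + j} = {..<i + j} - \<sigma> ` {..<i}"
proof -
  have im: "\<sigma> ` {..<i + j} = {..<i + j}"
    using assms by (auto simp: Sh_def dest: permutes_image)
  then show "\<sigma> ` {..<i} \<subseteq> {..<i + j}" by auto
  have "\<sigma> ` {i..<i + j} = \<sigma> ` ({..<i + j} - {..<i})"
    by (rule arg_cong[where f = "image \<sigma>"]) auto
  also have "\<dots> = \<sigma> ` {..<i + j} - \<sigma> ` {..<i}"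
    by (rule image_set_diff[OF inj_Sh[OF assms]])
  finally show "\<sigma> ` {i..<i + j} = {..<i + j} - \<sigma> ` {..<i}" using im by simp
qed

lemma sorted_list_of_set_mono_image:
  fixes \<sigma> :: "nat \<Rightarrow> nat"
  assumes "\<And>a b. \<lbrakk>m \<le> a; a < b; b < n\<rbrakk> \<Longrightarrow> \<sigma> a < \<sigma> b"
  shows "sorted_list_of_set (\<sigma> ` {m..<n}) = map \<sigma> [m..<n]"
proof -
  have "sorted_wrt (<) (map \<sigma> [m..<n])"
    using assms by (auto simp: sorted_wrt_map sorted_wrt_iff_nth_less)
  then have "sorted_list_of_set (set (map \<sigma> [m..<n])) = map \<sigma> [m..<n]"
    by (metis sorted_list_of_set.idem_if_sorted_distinct strict_sorted_iff)
  then show ?thesis by simp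
qed

lemma map_Sh:
  assumes "\<sigma> \<in> Sh i j"
  shows "map \<sigma> [0..<i] = sorted_list_of_set (\<sigma> ` {..<i})"
    "map \<sigma> [i..<i + j] = sorted_list_of_set ({..<i + j} - \<sigma> ` {..<i})"
  using sorted_list_of_set_mono_image[of 0 i \<sigma>] sorted_list_of_set_mono_image[of i "i + j" \<sigma>]
    strict_mono_on_Sh[OF assms] Sh_image(2)[OF assms]
  by (auto simp: lessThan_atLeast0)

text \<open>Both blocks of a shuffle are increasing, so it is determined by the image of the first
  block. Conversely, listing a subset and then its complement in increasing order gives a
  shuffle.\<close>

lemma bij_betw_Sh:
  "bij_betw (\<lambda>\<sigma>. \<sigma> ` {..<i}) (Sh i j) {I. I \<subseteq> {..<i + j} \<and> card I = i}"
proof (rule bij_betw_imageI)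
  show "inj_on (\<lambda>\<sigma>. \<sigma> ` {..<i}) (Sh i j)"
  proof (rule inj_onI)
    fix \<sigma> \<tau> assume st: "\<sigma> \<in> Sh i j" "\<tau> \<in> Sh i j" "\<sigma> ` {..<i} = \<tau> ` {..<i}"
    have "map \<sigma> [0..<i] = map \<tau> [0..<i]" "map \<sigma> [i..<i + j] = map \<tau> [i..<i + j]"
      using map_Sh[OF st(1)] map_Sh[OF st(2)] st(3) by simp_all
    then have "\<sigma> a = \<tau> a" if "a < i + j" for a
      using that by (cases "a < i") simp_all
    moreover have "\<sigma> a = \<tau> a" if "\<not> a < i + j" for a
      using that st(1,2) by (auto simp: Sh_def permutes_def)
    ultimately show "\<sigma> = \<tau>" by blast
  qed
  show "(\<lambda>\<sigma>. \<sigma> ` {..<i}) ` Sh i j = {I. I \<subseteq> {..<i + j} \<and> card I = i}"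
  proof (intro equalityI subsetI)
    fix I assume "I \<in> (\<lambda>\<sigma>. \<sigma> ` {..<i}) ` Sh i j"
    then obtain \<sigma> where s: "\<sigma> \<in> Sh i j" "I = \<sigma> ` {..<i}" by blast
    then show "I \<in> {I. I \<subseteq> {..<i + j} \<and> card I = i}"
      using Sh_image(1)[OF s(1)] inj_Sh[OF s(1)]
      by (simp add: card_image inj_on_subset[OF inj_Sh[OF s(1)] subset_UNIV])
  next
    fix I assume "I \<in> {I. I \<subseteq> {..<i + j} \<and> card I = i}"
    then have I: "I \<subseteq> {..<i + j}" "card I = i" by auto
    then have finI: "finite I" using finite_subset by blast
    define L where "L = sorted_list_of_set I @ sorted_list_of_set ({..<i + j} - I)"
    define \<sigma> where "\<sigma> = (\<lambda>k. if k < i + j then L ! k else k)"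
    have lenI: "length (sorted_list_of_set I) = i" using I by simp
    have setL: "set L = {..<i + j}" using I finI by (auto simp: L_def)
    have lenL: "length L = i + j" 
      using I finI by (simp add: L_def card_Diff_subset)
    have dist: "distinct L" using finI by (auto simp: L_def)
    have "bij_betw \<sigma> {..<i + j} {..<i + j}"
    proof (rule iffD1[OF bij_betw_cong])
      show "bij_betw ((!) L) {..<i + j} {..<i + j}"
        by (rule bij_betw_nth[OF dist]) (simp_all add: lenL setL)
    qed (simp add: \<sigma>_def)
    then have perm: "\<sigma> permutes {..<i + j}"
      by (rule bij_imp_permutes) (simp add: \<sigma>_def)
    have s1: "\<sigma> a < \<sigma> b" if "a < b" "b < i" for a b
      using that lenI I sorted_wrt_nth_less[OF strict_sorted_list_of_set[of I] \<open>a < b\<close>]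
      by (simp add: \<sigma>_def L_def nth_append)
    have s2: "\<sigma> a < \<sigma> b" if "i \<le> a" "a < b" "b < i + j" for a b
      using that lenI I lenL
        sorted_wrt_nth_less[OF strict_sorted_list_of_set[of "{..<i + j} - I"], of "a - i" "b - i"]
      by (auto simp: \<sigma>_def L_def nth_append)
    have "\<sigma> \<in> Sh i j"
      using perm s1 s2 by (auto simp: Sh_def strict_mono_on_def)
    moreover have "\<sigma> ` {..<i} = I"
    proof -
      have "\<sigma> ` {..<i} = (!) (sorted_list_of_set I) ` {..<i}"
        using lenI by (intro image_cong) (auto simp: \<sigma>_def L_def nth_append)
      also have "\<dots> = set (sorted_list_of_set I)"
        using lenI by (auto simp: set_conv_nth)
      finally show ?thesis using finI by simp
    qed
    ultimately show "I \<in> (\<lambda>\<sigma>. \<sigma> ` {..<i}) ` Sh i j" by blast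
  qed
qed

lemma nths_eq_map_nth:
  "nths xs I = map ((!) xs) (sorted_list_of_set (I \<inter> {..<length xs}))"
proof -
  have "nths xs I = map ((!) xs) (filter (\<lambda>i. i \<in> I) [0..<length xs])"
  proof (induction xs rule: rev_induct)
    case (snoc x xs)
    have "map ((!) (xs @ [x])) (filter (\<lambda>i. i \<in> I) [0..<length xs]) =
        map ((!) xs) (filter (\<lambda>i. i \<in> I) [0..<length xs])"
      by (rule map_cong) (auto simp: nth_append)
    then show ?case using snoc by (simp add: nths_append nths_singleton)
  qed simp
  moreover have "filter (\<lambda>i. i \<in> I) [0..<length xs] = sorted_list_of_set (I \<inter> {..<length xs})"
    by (rule sorted_distinct_set_unique) (auto simp: sorted_wrt_filter)
  ultimately show ?thesis by simp
qed

text \<open>Each block of the permuted list keeps the original order, so it is a sublist and the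
  permutation disappears from the formula.\<close>

lemma nths_Sh:
  assumes "\<sigma> \<in> Sh i j" "length xs = i + j"
  shows "take i (permute_list \<sigma> xs) = nths xs (\<sigma> ` {..<i})"
    "drop i (permute_list \<sigma> xs) = nths xs (- \<sigma> ` {..<i})"
proof -
  have u: "[0..<i + j] = [0..<i] @ [i..<i + j]" by (rule upt_add_eq_append) simp
  have "permute_list \<sigma> xs = map ((!) xs) (map \<sigma> [0..<i]) @ map ((!) xs) (map \<sigma> [i..<i + j])"
    unfolding permute_list_def assms(2) u by (simp only: map_append map_map comp_def)
  moreover have "\<sigma> ` {..<i} \<inter> {..<i + j} = \<sigma> ` {..<i}"
    using Sh_image(1)[OF assms(1)] by auto
  moreover have "- \<sigma> ` {..<i} \<inter> {..<i + j} = {..<i + j} - \<sigma> ` {..<i}" by auto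
  ultimately show "take i (permute_list \<sigma> xs) = nths xs (\<sigma> ` {..<i})"
    "drop i (permute_list \<sigma> xs) = nths xs (- \<sigma> ` {..<i})"
    unfolding nths_eq_map_nth assms(2)
    by (simp_all add: map_Sh[OF assms(1), symmetric] del: map_map)
qed

text \<open>Koszul sign for moving the positions in \<open>I\<close> to the front. Neutral factors
  for all other pairs keep the index set triangular, so that position 0 splits off in
  inductions.\<close>

definition subset_sign :: "nat set \<Rightarrow> ('m, 'v) hsec list \<Rightarrow> real" where
  "subset_sign I Xs =
     (\<Prod>u<length Xs. \<Prod>v<u. if u \<in> I \<and> v \<notin> I then pm (fst (Xs ! u) * fst (Xs ! v)) else 1)"

text \<open>Inversions of a shuffle occur only between its two blocks; applying the shuffle to both
  entries matches them with the pairs counted by \<open>subset_sign\<close>.\<close>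

lemma koszul_Sh:
  assumes "\<sigma> \<in> Sh i j" "length Xs = i + j"
  shows "koszul \<sigma> Xs = subset_sign (\<sigma> ` {..<i}) Xs"
proof -
  let ?I = "\<sigma> ` {..<i}" and ?n = "i + j"
  let ?w = "\<lambda>(u, v). pm (fst (Xs ! u) * fst (Xs ! v))"
  let ?P = "{(u, v). v < u \<and> u < ?n \<and> u \<in> ?I \<and> v \<notin> ?I}"
  have "bij_betw (map_prod \<sigma> \<sigma>) {(a, b). a < b \<and> b < ?n \<and> \<sigma> b < \<sigma> a} ?P"
  proof (rule bij_betw_imageI)
    show "inj_on (map_prod \<sigma> \<sigma>) {(a, b). a < b \<and> b < ?n \<and> \<sigma> b < \<sigma> a}"
      using inj_Sh[OF assms(1)] by (auto simp: inj_on_def inj_def)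
    show "map_prod \<sigma> \<sigma> ` {(a, b). a < b \<and> b < ?n \<and> \<sigma> b < \<sigma> a} = ?P"
    proof (intro equalityI subsetI)
      fix z assume "z \<in> map_prod \<sigma> \<sigma> ` {(a, b). a < b \<and> b < ?n \<and> \<sigma> b < \<sigma> a}"
      then obtain a b where ab: "a < b" "b < ?n" "\<sigma> b < \<sigma> a" "z = (\<sigma> a, \<sigma> b)" by auto
      then have "a < i" "i \<le> b"
        using strict_mono_on_Sh[OF assms(1), of a b] by (meson leI less_asym le_less_trans)+
      then have "\<sigma> b \<notin> ?I" "\<sigma> a \<in> ?I"
        using inj_eq[OF inj_Sh[OF assms(1)]] by auto
      moreover have "\<sigma> a < ?n"
        using Sh_image(1)[OF assms(1)] \<open>a < i\<close> by auto
      ultimately show "z \<in> ?P"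
        using ab by simp
    next
      fix z assume "z \<in> ?P"
      then obtain a v where a: "a < i" "z = (\<sigma> a, v)" "v < \<sigma> a" "\<sigma> a < ?n" "v \<notin> ?I" by auto
      then have "v \<in> \<sigma> ` {i..<?n}" using Sh_image(2)[OF assms(1)] by auto
      then obtain b where "i \<le> b" "b < ?n" "v = \<sigma> b" by auto
      then show "z \<in> map_prod \<sigma> \<sigma> ` {(a, b). a < b \<and> b < ?n \<and> \<sigma> b < \<sigma> a}"
        using a by (intro image_eqI[of _ _ "(a, b)"]) auto
    qed
  qed
  then have "koszul \<sigma> Xs = prod ?w ?P"
    unfolding koszul_def assms(2)
    by (subst prod.reindex_bij_betw[symmetric]) (auto intro!: prod.cong)
  also have "\<dots> = (\<Prod>(u, v)\<in>(SIGMA u:{..<?n}. {..<u}). if u \<in> ?I \<and> v \<notin> ?I then ?w (u, v) else 1)"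
    by (rule prod.mono_neutral_cong_left) (auto intro: finite_SigmaI split: if_splits)
  also have "\<dots> = subset_sign ?I Xs"
    unfolding subset_sign_def assms(2) by (subst prod.Sigma) auto
  finally show ?thesis .
qed

lemma sum_Sh_eq_sum_Pow:
  fixes F :: "('m, 'v) hsec list \<Rightarrow> ('m, 'v) hsec list \<Rightarrow> real"
  shows "(\<Sum>i\<le>length Xs. \<Sum>\<sigma>\<in>Sh i (length Xs - i).
      koszul \<sigma> Xs * F (take i (permute_list \<sigma> Xs)) (drop i (permute_list \<sigma> Xs))) =
    (\<Sum>I\<in>Pow {..<length Xs}. subset_sign I Xs * F (nths Xs I) (nths Xs (- I)))"
proof -
  let ?n = "length Xs"
  let ?G = "\<lambda>I. subset_sign I Xs * F (nths Xs I) (nths Xs (- I))"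
  have "(\<Sum>i\<le>?n. \<Sum>\<sigma>\<in>Sh i (?n - i).
      koszul \<sigma> Xs * F (take i (permute_list \<sigma> Xs)) (drop i (permute_list \<sigma> Xs))) =
      (\<Sum>i\<le>?n. \<Sum>I | I \<in> Pow {..<?n} \<and> card I = i. ?G I)"
  proof (rule sum.cong[OF refl])
    fix i assume "i \<in> {..?n}"
    then have n: "?n = i + (?n - i)" by simp
    have "(\<Sum>\<sigma>\<in>Sh i (?n - i).
        koszul \<sigma> Xs * F (take i (permute_list \<sigma> Xs)) (drop i (permute_list \<sigma> Xs))) =
        (\<Sum>\<sigma>\<in>Sh i (?n - i). ?G (\<sigma> ` {..<i}))"
      by (rule sum.cong[OF refl]) (simp add: nths_Sh[OF _ n] koszul_Sh[OF _ n])
    also have "\<dots> = (\<Sum>I | I \<in> Pow {..<?n} \<and> card I = i. ?G I)"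
      by (rule sum.reindex_bij_betw) (use bij_betw_Sh[of i "?n - i"] n in simp)
    finally show "(\<Sum>\<sigma>\<in>Sh i (?n - i).
        koszul \<sigma> Xs * F (take i (permute_list \<sigma> Xs)) (drop i (permute_list \<sigma> Xs))) =
        (\<Sum>I | I \<in> Pow {..<?n} \<and> card I = i. ?G I)" .
  qed
  also have "\<dots> = sum ?G (Pow {..<?n})"
    by (rule sum.group) (auto intro: card_mono[of "{..<?n}", simplified])
  finally show ?thesis .
qed

text \<open>If position 0 is not selected, all selected entries move past \<open>X\<close>, which
  costs the sign of \<open>fst X\<close> times their total degree.\<close>

lemma subset_sign_Cons:
  "subset_sign I (X # Xs) =
    (if 0 \<in> I then 1 else pm (fst X * tdeg (nths Xs {j. Suc j \<in> I}))) *
      subset_sign {j. Suc j \<in> I} Xs"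
proof -
  have "(\<Prod>u<length Xs. if u \<in> J then pm (fst (Xs ! u) * fst X) else 1) =
      pm (fst X * tdeg (nths Xs J))" for J
  proof (induction Xs arbitrary: J)
    case (Cons Y Xs)
    then show ?case
      using Cons[of "{j. Suc j \<in> J}"]
      by (simp add: prod.lessThan_Suc_shift nths_Cons distrib_left pm_add mult.commute
          del: prod.lessThan_Suc cong: if_cong)
  qed simp
  from this[of "{j. Suc j \<in> I}"] show ?thesis
    by (simp add: subset_sign_def prod.lessThan_Suc_shift prod.distrib del: prod.lessThan_Suc
        cong: if_cong)
qed

lemma sum_Pow_Suc:
  "(\<Sum>I\<in>Pow {..<Suc n}. G I) =
    (\<Sum>J\<in>Pow {..<n}. G (insert 0 (Suc ` J))) + (\<Sum>J\<in>Pow {..<n}. G (Suc ` J))"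
  for G :: "nat set \<Rightarrow> 'a::ab_group_add"
proof -
  have P: "Pow {..<Suc n} = insert 0 ` (image Suc ` Pow {..<n}) \<union> image Suc ` Pow {..<n}"
    by (simp add: lessThan_Suc_eq_insert_0 Pow_insert image_Pow_surj Un_commute)
  have inj: "inj_on (image Suc) (Pow {..<n})" 
    by (meson inj_Suc inj_image_eq_iff inj_onI)
  have inj0: "inj_on (insert 0) (image Suc ` Pow {..<n})"
    by (rule inj_onI) (metis (no_types, lifting) Diff_insert_absorb image_iff nat.distinct(1))
  show ?thesis
    unfolding P
    by (subst sum.union_disjoint) (auto simp: sum.reindex inj inj0 comp_def)
qed

lemma sprod_alt:
  "sprod f g Xs p = (\<Sum>I\<in>Pow {..<length Xs}. subset_sign I Xs *
      (pm (tdeg (nths Xs (- I)) * tdeg (nths Xs I)) * f (nths Xs I) p * g (nths Xs (- I)) p))"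
proof -
  have "sprod f g Xs p = (\<Sum>i\<le>length Xs. \<Sum>\<sigma>\<in>Sh i (length Xs - i).
      koszul \<sigma> Xs * (\<lambda>A B. pm (tdeg B * tdeg A) * f A p * g B p)
        (take i (permute_list \<sigma> Xs)) (drop i (permute_list \<sigma> Xs)))"
    unfolding sprod_def Let_def by (intro sum.cong refl) (simp add: mult_ac)
  also note sum_Sh_eq_sum_Pow
  finally show ?thesis .
qed

lemma sprod_Nil: "sprod f g [] p = f [] p * g [] p"
  by (simp add: sprod_alt subset_sign_def)

text \<open>The first argument goes either into the first or into the second factor. This recursion
  makes all identities for \<open>sprod\<close> provable by induction on the list of arguments.\<close>

lemma sprod_Cons:
  "sprod f g (X # Xs) p =
    sprod (\<lambda>Ys. f (X # Ys)) (\<lambda>Ys p. pm (fst X * tdeg Ys) * g Ys p) Xs p +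
    sprod f (\<lambda>Ys. g (X # Ys)) Xs p"
proof -
  have 1: "nths (X # Xs) (insert 0 (Suc ` J)) = X # nths Xs J"
    "nths (X # Xs) (- insert 0 (Suc ` J)) = nths Xs (- J)"
    "nths (X # Xs) (Suc ` J) = nths Xs J"
    "nths (X # Xs) (- Suc ` J) = X # nths Xs (- J)"
    "subset_sign (insert 0 (Suc ` J)) (X # Xs) = subset_sign J Xs"
    "subset_sign (Suc ` J) (X # Xs) = pm (fst X * tdeg (nths Xs J)) * subset_sign J Xs" for J
  proof -
    have e: "{j. Suc j \<in> insert 0 (Suc ` J)} = J" "{j. Suc j \<in> - insert 0 (Suc ` J)} = - J"
      "{j. Suc j \<in> Suc ` J} = J" "{j. Suc j \<in> - Suc ` J} = - J"
      by auto
    show "nths (X # Xs) (insert 0 (Suc ` J)) = X # nths Xs J"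
      "nths (X # Xs) (- insert 0 (Suc ` J)) = nths Xs (- J)"
      "nths (X # Xs) (Suc ` J) = nths Xs J"
      "nths (X # Xs) (- Suc ` J) = X # nths Xs (- J)"
      "subset_sign (insert 0 (Suc ` J)) (X # Xs) = subset_sign J Xs"
      "subset_sign (Suc ` J) (X # Xs) = pm (fst X * tdeg (nths Xs J)) * subset_sign J Xs"
      unfolding nths_Cons subset_sign_Cons e by auto
  qed
  show ?thesis
    unfolding sprod_alt
    by (simp only: list.size(4) add_0_right add_Suc_right One_nat_def sum_Pow_Suc 1 tdeg_simps)
      (simp add: distrib_left distrib_right pm_add mult_ac)
qed

section \<open>The algebra of graded symmetric forms\<close>

lemma tdeg_nths_add: "tdeg (nths Xs I) + tdeg (nths Xs (- I)) = tdeg Xs"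
proof (induction Xs arbitrary: I)
  case (Cons X Xs)
  have "{j. Suc j \<in> - I} = - {j. Suc j \<in> I}" by auto
  then show ?case using Cons[of "{j. Suc j \<in> I}"] by (simp add: nths_Cons)
qed simp

lemma length_nths_add: "length (nths Xs I) + length (nths Xs (- I)) = length Xs"
proof (induction Xs arbitrary: I)
  case (Cons X Xs)
  have "{j. Suc j \<in> - I} = - {j. Suc j \<in> I}" by auto
  then show ?case using Cons[of "{j. Suc j \<in> I}"] by (simp add: nths_Cons)
qed simp

lemma set_nths_Un: "set (nths Xs I) \<union> set (nths Xs (- I)) = set Xs"
  by (auto simp: set_nths in_set_conv_nth) blast

lemma sprod_cong:
  assumes "\<And>Ys. set Ys \<subseteq> set Xs \<Longrightarrow> f Ys p = f' Ys p" "\<And>Ys. set Ys \<subseteq> set Xs \<Longrightarrow> g Ys p = g' Ys p"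
  shows "sprod f g Xs p = sprod f' g' Xs p"
  unfolding sprod_alt by (simp add: assms set_nths_subset)

lemma sprod_lin_left:
  "sprod (\<lambda>Ys p. a p * f Ys p + b p * f' Ys p) g Xs p = a p * sprod f g Xs p + b p * sprod f' g Xs p"
  unfolding sprod_alt sum_distrib_left sum.distrib[symmetric]
  by (intro sum.cong refl) (simp add: algebra_simps)

lemma sprod_lin_right:
  "sprod f (\<lambda>Ys p. a p * g Ys p + b p * g' Ys p) Xs p = a p * sprod f g Xs p + b p * sprod f g' Xs p"
  unfolding sprod_alt sum_distrib_left sum.distrib[symmetric]
  by (intro sum.cong refl) (simp add: algebra_simps)

lemma sprod_fun_form: "sprod (fun_form h) g Xs p = h p * g Xs p"
proof (induction Xs arbitrary: g)
  case (Cons X Xs)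
  have "sprod (\<lambda>Ys. fun_form h (X # Ys)) g' Xs p = 0" for g'
    by (simp add: sprod_alt fun_form_def)
  then show ?case using Cons by (simp add: sprod_Cons)
qed (simp add: sprod_Nil fun_form_def)

lemma fst_gadd [simp]: "fst (gadd X Y) = fst X"
  and fst_gscale [simp]: "fst (gscale f X) = fst X"
  and snd_gadd: "snd (gadd X Y) = (\<lambda>p. snd X p + snd Y p)"
  and snd_gscale: "snd (gscale f X) = (\<lambda>p. f p *\<^sub>R snd X p)"
  by (simp_all add: gadd_def gscale_def)

locale graded_mfd_bundle = smooth_mfd A
  for A :: "('m::{t2_space,second_countable_topology}, 'e::real_normed_vector) atlas" +
  fixes E :: "('m, 'v::real_vector) gbundle" and n :: nat
  assumes graded: "graded_bundle A (- int n) (-1) E"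
begin

sublocale component: mfd_bundle A "E d" for d
  using graded by unfold_locales (auto simp: graded_bundle_def)

abbreviation "H \<equiv> hsections A E"
abbreviation "S \<equiv> symalg A E"
abbreviation "C \<equiv> Cinf A"

lemma fibre_outside: "d \<notin> {- int n..-1} \<Longrightarrow> fibre (E d) p = {0}"
  using graded by (auto simp: graded_bundle_def)

lemma hsec_outside: "X \<in> H \<Longrightarrow> fst X \<notin> {- int n..-1} \<Longrightarrow> snd X = (\<lambda>_. 0)"
  using component.section_fibre[of "snd X" "fst X"] fibre_outside[of "fst X"]
  by (auto simp: hsections_def)

lemma hsec_lin:
  assumes "X \<in> H" "Y \<in> H" "fst X = fst Y" "f \<in> C" "g \<in> C"
  shows "gadd (gscale f X) (gscale g Y) \<in> H"
  using component.sections_lin[of "snd X" "fst X" "snd Y" f g] assms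
  by (simp add: hsections_def snd_gadd snd_gscale)

lemma hsec_gscale:
  assumes "X \<in> H" "f \<in> C"
  shows "gscale f X \<in> H"
  using component.sections_lin[of "snd X" "fst X" "snd X" f "\<lambda>_. 0"] assms Cinf_const[of 0]
  by (simp add: hsections_def snd_gscale)

lemma symalg_outside: "\<omega> \<in> S \<Longrightarrow> \<not> set Xs \<subseteq> H \<Longrightarrow> \<omega> Xs = (\<lambda>_. 0)"
  by (simp add: symalg_def)

lemma symalg_Cinf: "\<omega> \<in> S \<Longrightarrow> \<omega> Xs \<in> C"
  by (simp add: symalg_def)

lemma symalg_bound: "\<omega> \<in> S \<Longrightarrow> \<exists>N. \<forall>Xs. length Xs > N \<longrightarrow> \<omega> Xs = (\<lambda>_. 0)"
  by (simp add: symalg_def)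

lemma symalg_lin:
  "\<lbrakk>\<omega> \<in> S; f \<in> C; g \<in> C; set us \<subseteq> H; X \<in> H; Y \<in> H; set vs \<subseteq> H; fst X = fst Y\<rbrakk> \<Longrightarrow>
    \<omega> (us @ gadd (gscale f X) (gscale g Y) # vs) p =
      f p * \<omega> (us @ X # vs) p + g p * \<omega> (us @ Y # vs) p"
  by (cases X; cases Y) (simp add: symalg_def)

lemma symalg_swap:
  assumes "\<omega> \<in> S" "set us \<subseteq> H" "X \<in> H" "Y \<in> H" "set vs \<subseteq> H"
  shows "\<omega> (us @ X # Y # vs) p = pm (fst X * fst Y) * \<omega> (us @ Y # X # vs) p"
proof -
  have *: "\<forall>us vs X Y. set (us @ X # Y # vs) \<subseteq> H \<longrightarrow>
      \<omega> (us @ X # Y # vs) = (\<lambda>p. (-1) powi (fst X * fst Y) * \<omega> (us @ Y # X # vs) p)"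
    using assms(1) unfolding symalg_def mem_Collect_eq by (elim conjE)
  have "set (us @ X # Y # vs) \<subseteq> H" using assms by simp
  from *[rule_format, OF this] show ?thesis by simp
qed

lemma symalgI:
  assumes "\<And>Xs p. \<not> set Xs \<subseteq> H \<Longrightarrow> \<omega> Xs p = 0"
    and "\<And>Xs. \<omega> Xs \<in> C"
    and "\<And>Xs p. length Xs > N \<Longrightarrow> \<omega> Xs p = 0"
    and "\<And>us vs X Y f g p. \<lbrakk>f \<in> C; g \<in> C; set us \<subseteq> H; X \<in> H; Y \<in> H; set vs \<subseteq> H; fst X = fst Y\<rbrakk>
      \<Longrightarrow> \<omega> (us @ gadd (gscale f X) (gscale g Y) # vs) p =
        f p * \<omega> (us @ X # vs) p + g p * \<omega> (us @ Y # vs) p"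
    and "\<And>us vs X Y p. \<lbrakk>set us \<subseteq> H; X \<in> H; Y \<in> H; set vs \<subseteq> H\<rbrakk>
      \<Longrightarrow> \<omega> (us @ X # Y # vs) p = pm (fst X * fst Y) * \<omega> (us @ Y # X # vs) p"
  shows "\<omega> \<in> S"
proof -
  have "\<forall>us vs X Y. \<forall>f\<in>C. \<forall>g\<in>C. set (us @ X # Y # vs) \<subseteq> H \<and> fst X = fst Y \<longrightarrow>
      \<omega> (us @ gadd (gscale f X) (gscale g Y) # vs) =
        (\<lambda>p. f p * \<omega> (us @ X # vs) p + g p * \<omega> (us @ Y # vs) p)"
    by (intro allI ballI impI ext assms(4)) simp_all
  moreover have "\<forall>us vs X Y. set (us @ X # Y # vs) \<subseteq> H \<longrightarrow>
      \<omega> (us @ X # Y # vs) = (\<lambda>p. (-1) powi (fst X * fst Y) * \<omega> (us @ Y # X # vs) p)"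
    unfolding minus_one_powi by (intro allI impI ext assms(5)) simp_all
  moreover have "\<forall>Xs. \<not> set Xs \<subseteq> H \<longrightarrow> \<omega> Xs = (\<lambda>_. 0)"
    by (intro allI impI ext assms(1))
  moreover have "\<exists>N. \<forall>Xs. length Xs > N \<longrightarrow> \<omega> Xs = (\<lambda>_. 0)"
    by (intro exI[of _ N] allI impI ext assms(3))
  ultimately show ?thesis
    unfolding symalg_def mem_Collect_eq using assms(2) by blast
qed

section \<open>Closure properties of the algebra of forms\<close>

lemma symalg_0: "(\<lambda>_ _. 0) \<in> S"
  by (rule symalgI[where N = 0]) (simp_all add: Cinf_const)

lemma symalg_lincomb:
  assumes "\<omega> \<in> S" "\<eta> \<in> S" "a \<in> C" "b \<in> C"
  shows "(\<lambda>Xs p. a p * \<omega> Xs p + b p * \<eta> Xs p) \<in> S"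
proof -
  obtain N M where N: "\<And>Xs. length Xs > N \<Longrightarrow> \<omega> Xs = (\<lambda>_. 0)" "\<And>Xs. length Xs > M \<Longrightarrow> \<eta> Xs = (\<lambda>_. 0)"
    using assms symalg_bound by meson
  show ?thesis
  proof (rule symalgI[where N = "max N M"])
    fix us vs p and X Y :: "('m, 'v) hsec"
    assume *: "set us \<subseteq> H" "X \<in> H" "Y \<in> H" "set vs \<subseteq> H"
    show "a p * \<omega> (us @ X # Y # vs) p + b p * \<eta> (us @ X # Y # vs) p = pm (fst X * fst Y) * (a p * \<omega> (us @ Y # X # vs) p + b p * \<eta> (us @ Y # X # vs) p)"
      by (simp add: symalg_swap[OF assms(1) *] symalg_swap[OF assms(2) *] algebra_simps)
  next
    fix us vs f g p and X Y :: "('m, 'v) hsec"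
    assume *: "f \<in> C" "g \<in> C" "set us \<subseteq> H" "X \<in> H" "Y \<in> H" "set vs \<subseteq> H" "fst X = fst Y"
    show "a p * \<omega> (us @ gadd (gscale f X) (gscale g Y) # vs) p + b p * \<eta> (us @ gadd (gscale f X) (gscale g Y) # vs) p = f p * (a p * \<omega> (us @ X # vs) p + b p * \<eta> (us @ X # vs) p) + g p * (a p * \<omega> (us @ Y # vs) p + b p * \<eta> (us @ Y # vs) p)"
      by (simp add: symalg_lin[OF assms(1) *] symalg_lin[OF assms(2) *] *(7) algebra_simps)
  qed (simp_all add: assms N symalg_outside symalg_Cinf Cinf_add Cinf_mult)
qed

lemma symalg_scale:
  assumes "\<omega> \<in> S" "a \<in> C"
  shows "(\<lambda>Xs p. a p * \<omega> Xs p) \<in> S"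
  using symalg_lincomb[OF assms(1,1) assms(2) Cinf_const[of 0]] by simp

text \<open>The recursion \<open>sprod_Cons\<close> twists the second factor by such a sign; the
  twisted factor has to lie in the algebra again for inductions on the argument list.\<close>

lemma symalg_tdeg_sign:
  assumes "\<omega> \<in> S"
  shows "(\<lambda>Xs p. pm (x * tdeg Xs) * \<omega> Xs p) \<in> S"
proof -
  obtain N where N: "\<And>Xs. length Xs > N \<Longrightarrow> \<omega> Xs = (\<lambda>_. 0)"
    using assms symalg_bound by meson
  show ?thesis
  proof (rule symalgI[where N = "N"])
    fix us vs p and X Y :: "('m, 'v) hsec"
    assume *: "set us \<subseteq> H" "X \<in> H" "Y \<in> H" "set vs \<subseteq> H"
    show "pm (x * tdeg (us @ X # Y # vs)) * \<omega> (us @ X # Y # vs) p = pm (fst X * fst Y) * (pm (x * tdeg (us @ Y # X # vs)) * \<omega> (us @ Y # X # vs) p)"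
      by (simp add: symalg_swap[OF assms *] algebra_simps)
  next
    fix us vs f g p and X Y :: "('m, 'v) hsec"
    assume *: "f \<in> C" "g \<in> C" "set us \<subseteq> H" "X \<in> H" "Y \<in> H" "set vs \<subseteq> H" "fst X = fst Y"
    show "pm (x * tdeg (us @ gadd (gscale f X) (gscale g Y) # vs)) * \<omega> (us @ gadd (gscale f X) (gscale g Y) # vs) p = f p * (pm (x * tdeg (us @ X # vs)) * \<omega> (us @ X # vs) p) + g p * (pm (x * tdeg (us @ Y # vs)) * \<omega> (us @ Y # vs) p)"
      by (simp add: symalg_lin[OF assms *] *(7) algebra_simps)
  qed (simp_all add: assms N symalg_outside symalg_Cinf Cinf_const Cinf_mult)
qed

lemma symalg_insert:
  assumes "\<omega> \<in> S" "X \<in> H"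
  shows "(\<lambda>Xs. \<omega> (X # Xs)) \<in> S"
proof -
  obtain N where N: "\<And>Xs. length Xs > N \<Longrightarrow> \<omega> Xs = (\<lambda>_. 0)"
    using assms symalg_bound by meson
  show ?thesis
  proof (intro symalgI[where N = N])
    fix us vs p and Y Z :: "('m, 'v) hsec"
    assume "set us \<subseteq> H" "Y \<in> H" "Z \<in> H" "set vs \<subseteq> H"
    then show "\<omega> (X # us @ Y # Z # vs) p = pm (fst Y * fst Z) * \<omega> (X # us @ Z # Y # vs) p"
      using symalg_swap[OF assms(1), of "X # us" Y Z vs] assms(2) by simp
  next
    fix us vs f g p and Y Z :: "('m, 'v) hsec"
    assume "f \<in> C" "g \<in> C" "set us \<subseteq> H" "Y \<in> H" "Z \<in> H" "set vs \<subseteq> H" "fst Y = fst Z"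
    then show "\<omega> (X # us @ gadd (gscale f Y) (gscale g Z) # vs) p =
        f p * \<omega> (X # us @ Y # vs) p + g p * \<omega> (X # us @ Z # vs) p"
      using symalg_lin[OF assms(1), of f g "X # us" Y Z vs] assms(2) by simp
  qed (simp_all add: assms N symalg_outside symalg_Cinf)
qed

lemma symalg_arity_part:
  assumes "\<omega> \<in> S"
  shows "arity_part r \<omega> \<in> S"
proof -
  obtain N where N: "\<And>Xs. length Xs > N \<Longrightarrow> \<omega> Xs = (\<lambda>_. 0)"
    using assms symalg_bound by meson
  show ?thesis
  proof (rule symalgI[where N = "N"])
    fix us vs p and X Y :: "('m, 'v) hsec"
    assume *: "set us \<subseteq> H" "X \<in> H" "Y \<in> H" "set vs \<subseteq> H"
    show "arity_part r \<omega> (us @ X # Y # vs) p = pm (fst X * fst Y) * (arity_part r \<omega> (us @ Y # X # vs) p)"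
      by (simp add: arity_part_def symalg_swap[OF assms *] algebra_simps)
  next
    fix us vs f g p and X Y :: "('m, 'v) hsec"
    assume *: "f \<in> C" "g \<in> C" "set us \<subseteq> H" "X \<in> H" "Y \<in> H" "set vs \<subseteq> H" "fst X = fst Y"
    show "arity_part r \<omega> (us @ gadd (gscale f X) (gscale g Y) # vs) p = f p * (arity_part r \<omega> (us @ X # vs) p) + g p * (arity_part r \<omega> (us @ Y # vs) p)"
      by (simp add: arity_part_def symalg_lin[OF assms *] *(7) algebra_simps)
  qed (simp_all add: arity_part_def assms N symalg_outside symalg_Cinf Cinf_const)
qed

lemma symalg_fun_form: "f \<in> C \<Longrightarrow> fun_form f \<in> S"
  by (rule symalgI[where N = 0]) (auto simp: fun_form_def Cinf_const)

lemma Cinf_sum: "finite I \<Longrightarrow> (\<And>i. i \<in> I \<Longrightarrow> f i \<in> C) \<Longrightarrow> (\<lambda>p. \<Sum>i\<in>I. f i p) \<in> C"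
  by (induction I rule: finite_induct) (simp_all add: Cinf_const Cinf_add)

text \<open>Induction on the arguments before the modified one, with both factors varying because
  each earlier argument is absorbed by one of them.\<close>

lemma sprod_lin_arg:
  assumes "\<omega> \<in> S" "\<eta> \<in> S" "f \<in> C" "g \<in> C" "set us \<subseteq> H" "X \<in> H" "Y \<in> H" "set vs \<subseteq> H" "fst X = fst Y"
  shows "sprod \<omega> \<eta> (us @ gadd (gscale f X) (gscale g Y) # vs) p =
    f p * sprod \<omega> \<eta> (us @ X # vs) p + g p * sprod \<omega> \<eta> (us @ Y # vs) p"
  using assms(1,2,5)
proof (induction us arbitrary: \<omega> \<eta>)
  case Nil
  let ?Z = "gadd (gscale f X) (gscale g Y)" and ?t = "\<lambda>Ys p. pm (fst Y * tdeg Ys) * \<eta> Ys p"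
  have "sprod (\<lambda>Ys. \<omega> (?Z # Ys)) ?t vs p =
      sprod (\<lambda>Ys p. f p * \<omega> (X # Ys) p + g p * \<omega> (Y # Ys) p) ?t vs p"
    by (rule sprod_cong) (use symalg_lin[OF Nil(1), of f g "[]" X Y] assms in \<open>auto\<close>)
  moreover have "sprod \<omega> (\<lambda>Ys. \<eta> (?Z # Ys)) vs p =
      sprod \<omega> (\<lambda>Ys p. f p * \<eta> (X # Ys) p + g p * \<eta> (Y # Ys) p) vs p"
    by (rule sprod_cong) (use symalg_lin[OF Nil(2), of f g "[]" X Y] assms in \<open>auto\<close>)
  ultimately show ?case
    by (simp add: sprod_Cons sprod_lin_left sprod_lin_right assms(9) algebra_simps)
next
  case (Cons u us)
  then show ?case
    using Cons.IH[OF symalg_insert[OF Cons.prems(1)] symalg_tdeg_sign[OF Cons.prems(2)], of u "fst u"]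
      Cons.IH[OF Cons.prems(1) symalg_insert[OF Cons.prems(2)], of u]
    by (simp add: sprod_Cons algebra_simps)
qed

text \<open>The two arguments enter the factors in four ways: both left, both right, or one in each;
  the swap interchanges the last two possibilities.\<close>

lemma sprod_swap_arg:
  assumes "\<omega> \<in> S" "\<eta> \<in> S" "set us \<subseteq> H" "X \<in> H" "Y \<in> H" "set vs \<subseteq> H"
  shows "sprod \<omega> \<eta> (us @ X # Y # vs) p = pm (fst X * fst Y) * sprod \<omega> \<eta> (us @ Y # X # vs) p"
  using assms(1,2,3)
proof (induction us arbitrary: \<omega> \<eta>)
  case Nil
  define s where "s = pm (fst X * fst Y)"
  let ?t = "\<lambda>Z \<eta> Ys p. pm (fst Z * tdeg Ys) * \<eta> Ys p"
  have 1: "sprod (\<lambda>Ys. \<omega> (X # Y # Ys)) (?t Y (?t X \<eta>)) vs p =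
      s * sprod (\<lambda>Ys. \<omega> (Y # X # Ys)) (?t X (?t Y \<eta>)) vs p"
  proof -
    \<comment> \<open>The vanishing second summand only gives the scalar multiple the shape required
      by \<open>sprod_lin_left\<close>.\<close>
    have "sprod (\<lambda>Ys. \<omega> (X # Y # Ys)) (?t Y (?t X \<eta>)) vs p =
        sprod (\<lambda>Ys p. s * \<omega> (Y # X # Ys) p + 0 * \<omega> [] p) (?t X (?t Y \<eta>)) vs p"
      by (rule sprod_cong) (use symalg_swap[OF Nil(1), of "[]" X Y] assms in \<open>simp_all add: s_def mult.left_commute\<close>)
    then show ?thesis by (simp only: sprod_lin_left)
  qed
  have 2: "sprod \<omega> (\<lambda>Ys. \<eta> (X # Y # Ys)) vs p = s * sprod \<omega> (\<lambda>Ys. \<eta> (Y # X # Ys)) vs p"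
  proof -
    have "sprod \<omega> (\<lambda>Ys. \<eta> (X # Y # Ys)) vs p =
        sprod \<omega> (\<lambda>Ys p. s * \<eta> (Y # X # Ys) p + 0 * \<eta> [] p) vs p"
      by (rule sprod_cong) (use symalg_swap[OF Nil(2), of "[]" X Y] assms in \<open>simp_all add: s_def\<close>)
    then show ?thesis by (simp only: sprod_lin_right)
  qed
  \<comment> \<open>One argument goes into each factor: the twist of the second factor, evaluated
    with \<open>W\<close> in front, releases the sign of the exchange.\<close>
  have 3: "sprod (\<lambda>Ys. \<omega> (Z # Ys)) (\<lambda>Ys p. pm (fst Z * tdeg (W # Ys)) * \<eta> (W # Ys) p) vs p =
      pm (fst Z * fst W) * sprod (\<lambda>Ys. \<omega> (Z # Ys)) (?t Z (\<lambda>Ys. \<eta> (W # Ys))) vs p" for Z W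
  proof -
    have "sprod (\<lambda>Ys. \<omega> (Z # Ys)) (\<lambda>Ys p. pm (fst Z * tdeg (W # Ys)) * \<eta> (W # Ys) p) vs p =
        sprod (\<lambda>Ys. \<omega> (Z # Ys)) (\<lambda>Ys p. pm (fst Z * fst W) * ?t Z (\<lambda>Ys. \<eta> (W # Ys)) Ys p
          + 0 * \<eta> [] p) vs p"
      by (rule sprod_cong) (simp_all add: pm_add distrib_left)
    then show ?thesis by (simp only: sprod_lin_right)
  qed
  have "s * s = 1" by (simp add: s_def)
  then show ?case
    unfolding append_Nil sprod_Cons 1 2 3 s_def[symmetric] mult.commute[of "fst Y" "fst X"]
    by (simp add: algebra_simps)
next
  case (Cons u us)
  then show ?case
    using Cons.IH[OF symalg_insert[OF Cons.prems(1)] symalg_tdeg_sign[OF Cons.prems(2)], of u "fst u"]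
      Cons.IH[OF Cons.prems(1) symalg_insert[OF Cons.prems(2)], of u]
    by (simp add: sprod_Cons algebra_simps)
qed

lemma sprod_symalg:
  assumes "\<omega> \<in> S" "\<eta> \<in> S"
  shows "sprod \<omega> \<eta> \<in> S"
proof -
  obtain N M where NM: "\<And>Xs. length Xs > N \<Longrightarrow> \<omega> Xs = (\<lambda>_. 0)" "\<And>Xs. length Xs > M \<Longrightarrow> \<eta> Xs = (\<lambda>_. 0)"
    using assms symalg_bound by meson
  show ?thesis
  proof (rule symalgI[where N = "N + M"])
    fix Xs p assume "\<not> set Xs \<subseteq> H"
    then have "\<not> set (nths Xs I) \<subseteq> H \<or> \<not> set (nths Xs (- I)) \<subseteq> H" for I
      using set_nths_Un[of Xs I] by blast
    then have "\<omega> (nths Xs I) p * \<eta> (nths Xs (- I)) p = 0" for I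
      using symalg_outside assms by (metis mult_eq_0_iff)
    then show "sprod \<omega> \<eta> Xs p = 0"
      unfolding sprod_alt by (intro sum.neutral) (simp add: mult.assoc)
  next
    fix Xs :: "('m, 'v) hsec list" and p assume "length Xs > N + M"
    then have "length (nths Xs I) > N \<or> length (nths Xs (- I)) > M" for I
      using length_nths_add[of Xs I] by linarith
    then have "\<omega> (nths Xs I) p * \<eta> (nths Xs (- I)) p = 0" for I
      using NM by (metis mult_eq_0_iff)
    then show "sprod \<omega> \<eta> Xs p = 0"
      unfolding sprod_alt by (intro sum.neutral) (simp add: mult.assoc)
  next
    fix Xs
    have "(\<lambda>p. \<Sum>I\<in>Pow {..<length Xs}. subset_sign I Xs *
      (pm (tdeg (nths Xs (- I)) * tdeg (nths Xs I)) * \<omega> (nths Xs I) p * \<eta> (nths Xs (- I)) p)) \<in> C"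
      by (intro Cinf_sum Cinf_mult Cinf_const symalg_Cinf assms) simp
    then show "sprod \<omega> \<eta> Xs \<in> C" by (simp add: sprod_alt[abs_def])
  qed (use assms sprod_lin_arg sprod_swap_arg in blast)+
qed

section \<open>Contractions\<close>

lemma derivationD:
  assumes "derivation A E m D"
  shows "\<omega> \<notin> S \<Longrightarrow> D \<omega> = (\<lambda>_ _. 0)"
    and "\<omega> \<in> S \<Longrightarrow> D \<omega> \<in> S"
    and "\<omega> \<in> symalg_deg A E k \<Longrightarrow> D \<omega> \<in> symalg_deg A E (k + m)"
    and "\<lbrakk>\<omega> \<in> S; \<eta> \<in> S\<rbrakk> \<Longrightarrow>
      D (\<lambda>Xs p. a * \<omega> Xs p + b * \<eta> Xs p) = (\<lambda>Xs p. a * D \<omega> Xs p + b * D \<eta> Xs p)"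
    and "\<lbrakk>\<omega> \<in> symalg_deg A E k; \<eta> \<in> S\<rbrakk> \<Longrightarrow>
      D (sprod \<omega> \<eta>) = (\<lambda>Xs p. sprod (D \<omega>) \<eta> Xs p + pm (m * k) * sprod \<omega> (D \<eta>) Xs p)"
  using assms unfolding derivation_def minus_one_powi by blast+

lemma derivation_0: "derivation A E m D \<Longrightarrow> D (\<lambda>_ _. 0) = (\<lambda>_ _. 0)"
  using derivationD(4)[OF _ symalg_0 symalg_0, of m D 0 0] by simp

lemma symalg_sum:
  assumes "finite J" "\<And>j. j \<in> J \<Longrightarrow> F j \<in> S"
  shows "(\<lambda>Xs p. \<Sum>j\<in>J. c j * F j Xs p) \<in> S"
  using assms
proof (induction J rule: finite_induct)
  case (insert j J)
  then show ?case
    using symalg_lincomb[of "F j" "\<lambda>Xs p. \<Sum>j\<in>J. c j * F j Xs p" "\<lambda>_. c j" "\<lambda>_. 1"]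
    by (simp add: Cinf_const)
qed (simp add: symalg_0)

lemma derivation_sum:
  assumes "derivation A E m D" "finite J" "\<And>j. j \<in> J \<Longrightarrow> F j \<in> S"
  shows "D (\<lambda>Xs p. \<Sum>j\<in>J. c j * F j Xs p) = (\<lambda>Xs p. \<Sum>j\<in>J. c j * D (F j) Xs p)"
  using assms(2,3)
proof (induction J rule: finite_induct)
  case (insert j J)
  then show ?case
    using derivationD(4)[OF assms(1), of "F j" "\<lambda>Xs p. \<Sum>j\<in>J. c j * F j Xs p" "c j" 1]
    by (simp add: symalg_sum)
qed (simp add: derivation_0[OF assms(1)])

lemma symalg_degI:
  "\<lbrakk>\<omega> \<in> S; \<And>Xs p. tdeg Xs \<noteq> - k \<Longrightarrow> \<omega> Xs p = 0\<rbrakk> \<Longrightarrow> \<omega> \<in> symalg_deg A E k"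
  by (auto simp: symalg_deg_def)

lemma symalg_degD:
  "\<omega> \<in> symalg_deg A E k \<Longrightarrow> \<omega> \<in> S"
  "\<omega> \<in> symalg_deg A E k \<Longrightarrow> tdeg Xs \<noteq> - k \<Longrightarrow> \<omega> Xs = (\<lambda>_. 0)"
  by (auto simp: symalg_deg_def)

lemma covectorsD:
  assumes "\<omega> \<in> covectors A E k"
  shows "\<omega> \<in> symalg_deg A E k" "\<omega> \<in> S" "length Xs \<noteq> 1 \<Longrightarrow> \<omega> Xs = (\<lambda>_. 0)"
    "fst X \<noteq> - k \<Longrightarrow> \<omega> [X] = (\<lambda>_. 0)"
proof -
  show *: "\<omega> \<in> symalg_deg A E k" using assms by (simp add: covectors_def)
  then show "\<omega> \<in> S" by (rule symalg_degD)
  show "length Xs \<noteq> 1 \<Longrightarrow> \<omega> Xs = (\<lambda>_. 0)"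
  proof -
    have "arity_part 1 \<omega> Xs = \<omega> Xs" using assms by (simp add: covectors_def)
    then show "length Xs \<noteq> 1 \<Longrightarrow> \<omega> Xs = (\<lambda>_. 0)" by (simp add: arity_part_def)
  qed
  show "fst X \<noteq> - k \<Longrightarrow> \<omega> [X] = (\<lambda>_. 0)"
    by (rule symalg_degD(2)[OF *]) simp
qed

lemma fun_form_deg: "f \<in> C \<Longrightarrow> fun_form f \<in> symalg_deg A E 0"
  by (rule symalg_degI[OF symalg_fun_form]) (auto simp: fun_form_def)

text \<open>On a form of degree k only lists with \<open>fst X + tdeg Xs = - k\<close> contribute,
  so the sign is that of \<open>fst X * k\<close>. Reading it off the arguments also covers
  inhomogeneous forms, as in \<open>sprod\<close>.\<close>

definition interior :: "('m, 'v) hsec \<Rightarrow> ('m, 'v) operator" where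
  "interior X \<omega> =
     (if \<omega> \<in> S then (\<lambda>Xs p. pm (fst X * (fst X + tdeg Xs)) * \<omega> (X # Xs) p) else (\<lambda>_ _. 0))"

lemma interior_symalg:
  assumes "X \<in> H" "\<omega> \<in> S"
  shows "interior X \<omega> \<in> S"
  using symalg_scale[OF symalg_tdeg_sign[OF symalg_insert[OF assms(2,1)], of "fst X"]
      Cinf_const[of "pm (fst X * fst X)"]] assms(2)
  by (simp add: interior_def distrib_left pm_add mult.assoc)

text \<open>The two summands of \<open>sprod_Cons\<close> are the two summands of the Leibniz rule;
  what remains is to compare signs for each subset of positions.\<close>

lemma derivation_interior:
  assumes X: "X \<in> H"
  shows "derivation A E (fst X) (interior X)"
  unfolding derivation_def minus_one_powi
proof (intro conjI allI impI ballI)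
  fix \<omega> k assume "\<omega> \<in> symalg_deg A E k"
  then show "interior X \<omega> \<in> symalg_deg A E (k + fst X)"
    by (intro symalg_degI interior_symalg X) (auto simp: interior_def symalg_deg_def)
next
  fix \<omega> \<eta> a b assume "\<omega> \<in> S" "\<eta> \<in> S"
  then show "interior X (\<lambda>Xs p. a * \<omega> Xs p + b * \<eta> Xs p) =
      (\<lambda>Xs p. a * interior X \<omega> Xs p + b * interior X \<eta> Xs p)"
    using symalg_lincomb[OF _ _ Cinf_const[of a] Cinf_const[of b]]
    by (simp add: interior_def algebra_simps)
next
  fix \<omega> k \<eta> assume \<omega>: "\<omega> \<in> symalg_deg A E k" and \<eta>: "\<eta> \<in> S"
  define x where "x = fst X"
  have \<omega>S: "\<omega> \<in> S" using \<omega> by (rule symalg_degD)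
  show "interior X (sprod \<omega> \<eta>) =
      (\<lambda>Xs p. sprod (interior X \<omega>) \<eta> Xs p + pm (fst X * k) * sprod \<omega> (interior X \<eta>) Xs p)"
  proof (intro ext)
    fix Xs p
    have s1: "pm (x * (x + (a + b))) * (pm (b * a) * u * (pm (x * b) * v)) =
        pm (b * a) * (pm (x * (x + a)) * u) * v" for a b u v
      by (auto simp: pm_def)
    have 1: "pm (x * (x + tdeg Xs)) *
        sprod (\<lambda>Ys. \<omega> (X # Ys)) (\<lambda>Ys p. pm (x * tdeg Ys) * \<eta> Ys p) Xs p =
        sprod (interior X \<omega>) \<eta> Xs p"
      unfolding sprod_alt sum_distrib_left
    proof (rule sum.cong[OF refl])
      fix I
      show "pm (x * (x + tdeg Xs)) * (subset_sign I Xs * (pm (tdeg (nths Xs (- I)) * tdeg (nths Xs I)) *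
          \<omega> (X # nths Xs I) p * (pm (x * tdeg (nths Xs (- I))) * \<eta> (nths Xs (- I)) p))) =
        subset_sign I Xs * (pm (tdeg (nths Xs (- I)) * tdeg (nths Xs I)) *
          interior X \<omega> (nths Xs I) p * \<eta> (nths Xs (- I)) p)"
        unfolding tdeg_nths_add[of Xs I, symmetric] mult.left_commute[of _ "subset_sign I Xs"] s1
        by (simp add: interior_def \<omega>S x_def)
    qed
    have 2: "pm (x * (x + tdeg Xs)) * sprod \<omega> (\<lambda>Ys. \<eta> (X # Ys)) Xs p =
        pm (x * k) * sprod \<omega> (interior X \<eta>) Xs p"
      unfolding sprod_alt sum_distrib_left
    proof (rule sum.cong[OF refl])
      fix I
      show "pm (x * (x + tdeg Xs)) * (subset_sign I Xs * (pm (tdeg (nths Xs (- I)) * tdeg (nths Xs I)) *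
          \<omega> (nths Xs I) p * \<eta> (X # nths Xs (- I)) p)) =
        pm (x * k) * (subset_sign I Xs * (pm (tdeg (nths Xs (- I)) * tdeg (nths Xs I)) *
          \<omega> (nths Xs I) p * interior X \<eta> (nths Xs (- I)) p))"
      \<comment> \<open>Homogeneity of \<open>\<omega>\<close> enters here: it fixes the degree of
        the arguments that the contraction has to pass.\<close>
      proof (cases "tdeg (nths Xs I) = - k")
        case True
        have s3: "pm (x * (x + (- k + b))) * (pm (b * - k) * u * v) =
            pm (x * k) * (pm (b * - k) * u * (pm (x * (x + b)) * v))" for b u v
          by (auto simp: pm_def)
        show ?thesis
          unfolding tdeg_nths_add[of Xs I, symmetric] mult.left_commute[of _ "subset_sign I Xs"] True s3
          by (simp add: interior_def \<eta> x_def)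
      qed (simp add: symalg_degD(2)[OF \<omega>])
    qed
    show "interior X (sprod \<omega> \<eta>) Xs p =
        sprod (interior X \<omega>) \<eta> Xs p + pm (fst X * k) * sprod \<omega> (interior X \<eta>) Xs p"
      using 1 2 sprod_symalg[OF \<omega>S \<eta>]
      by (simp add: interior_def[of X "sprod \<omega> \<eta>"] sprod_Cons x_def distrib_left)
  qed
qed (simp_all add: interior_symalg X, simp add: interior_def)

lemma interior_covector:
  assumes "\<omega> \<in> covectors A E k"
  shows "interior X \<omega> = fun_form (\<lambda>p. pm (fst X) * \<omega> [X] p)"
  using covectorsD(2,3)[OF assms]
  by (auto simp: interior_def fun_form_def fun_eq_iff pm_def)

lemma interior_fun_form:
  assumes "f \<in> C"
  shows "interior X (fun_form f) = (\<lambda>_ _. 0)"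
  using assms by (simp add: interior_def fun_form_def)

subsection \<open>Local frames and the uniqueness of derivations\<close>

text \<open>A zero section equals \<open>0 X + 0 X\<close>, so linearity in that argument
  applies.\<close>

lemma symalg_zero_mem:
  assumes "\<omega> \<in> S" "X \<in> set Xs" "snd X = (\<lambda>_. 0)"
  shows "\<omega> Xs p = 0"
proof (cases "set Xs \<subseteq> H")
  case True
  obtain us vs where Xs: "Xs = us @ X # vs" using assms(2) split_list by metis
  have "gadd (gscale (\<lambda>_. 0) X) (gscale (\<lambda>_. 0) X) = X"
    using assms(3) by (simp add: gadd_def gscale_def prod_eq_iff)
  then show ?thesis
    using symalg_lin[OF assms(1) Cinf_const[of 0] Cinf_const[of 0], of us X X vs p] True by (simp add: Xs)
qed (use symalg_outside[OF assms(1)] in simp)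

lemma symalg_zero_arg: "\<omega> \<in> S \<Longrightarrow> snd X = (\<lambda>_. 0) \<Longrightarrow> \<omega> (X # Xs) p = 0"
  by (rule symalg_zero_mem[of _ X]) simp_all

lemma symalg_sum_arg:
  assumes "\<omega> \<in> S" "finite J" "\<And>j. j \<in> J \<Longrightarrow> f j \<in> C" "\<And>j. j \<in> J \<Longrightarrow> (d, x j) \<in> H" "set Xs \<subseteq> H"
  shows "(d, \<lambda>q. \<Sum>j\<in>J. f j q *\<^sub>R x j q) \<in> H \<and>
    \<omega> ((d, \<lambda>q. \<Sum>j\<in>J. f j q *\<^sub>R x j q) # Xs) p = (\<Sum>j\<in>J. f j p * \<omega> ((d, x j) # Xs) p)"
  using assms(2,3,4)
proof (induction J rule: finite_induct)
  case empty
  then show ?case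
    using component.sections_0[of d] by (simp add: hsections_def symalg_zero_arg[OF assms(1)])
next
  case (insert j J)
  let ?Y = "(d, \<lambda>q. \<Sum>j\<in>J. f j q *\<^sub>R x j q)"
  have Y: "?Y \<in> H" "f j \<in> C" "(d, x j) \<in> H" using insert by simp_all
  have "(d, \<lambda>q. \<Sum>j\<in>insert j J. f j q *\<^sub>R x j q) = gadd (gscale (f j) (d, x j)) (gscale (\<lambda>_. 1) ?Y)"
    using insert.hyps by (simp add: gadd_def gscale_def)
  then show ?case
    using insert.hyps insert.IH[OF insert.prems] assms(5) hsec_lin[OF Y(3,1) _ Y(2) Cinf_const[of 1]]
      symalg_lin[OF assms(1) Y(2) Cinf_const[of 1] _ Y(3,1), of "[]" Xs p]
    by simp
qed

lemma covectorI:
  assumes "\<And>x. x \<in> sections A (E d) \<Longrightarrow> \<phi> x \<in> C"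
    and "\<And>x y f g p. \<lbrakk>x \<in> sections A (E d); y \<in> sections A (E d)\<rbrakk> \<Longrightarrow>
      \<phi> (\<lambda>q. f q *\<^sub>R x q + g q *\<^sub>R y q) p = f p * \<phi> x p + g p * \<phi> y p"
  shows "(\<lambda>Xs. if length Xs = 1 \<and> hd Xs \<in> H \<and> fst (hd Xs) = d then \<phi> (snd (hd Xs)) else (\<lambda>_. 0))
    \<in> covectors A E (- d)" (is "?\<omega> \<in> _")
proof -
  have "?\<omega> \<in> S"
  proof (rule symalgI[where N = 1])
    fix us vs f g p and X Y :: "('m, 'v) hsec"
    assume *: "f \<in> C" "g \<in> C" "set us \<subseteq> H" "X \<in> H" "Y \<in> H" "set vs \<subseteq> H" "fst X = fst Y"
    show "?\<omega> (us @ gadd (gscale f X) (gscale g Y) # vs) p =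
        f p * ?\<omega> (us @ X # vs) p + g p * ?\<omega> (us @ Y # vs) p"
    proof (cases "us = [] \<and> vs = []")
      case True
      then show ?thesis
        using * hsec_lin[OF *(4,5,7,1,2)] assms(2)[of "snd X" "snd Y" f g p]
        by (auto simp: snd_gadd snd_gscale hsections_def)
    next
      case False
      then have "length (us @ Z # vs) \<noteq> 1" for Z :: "('m, 'v) hsec" by (cases us) auto
      then show ?thesis by (simp only: simp_thms if_False mult_zero_right add_0_right)
    qed
  next
    fix Xs p assume "\<not> set Xs \<subseteq> H"
    then show "?\<omega> Xs p = 0" by (cases Xs) auto
  next
    fix Xs show "?\<omega> Xs \<in> C" using assms(1) by (auto simp: Cinf_const hsections_def)
  qed auto
  moreover have "tdeg Xs = d" if "length Xs = 1" "fst (hd Xs) = d" for Xs :: "('m, 'v) hsec list"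
    using that by (cases Xs) auto
  ultimately have "?\<omega> \<in> symalg_deg A E (- d)"
    by (intro symalg_degI) auto
  then show ?thesis
    by (auto simp: covectors_def arity_part_def fun_eq_iff)
qed

text \<open>Frames of the finitely many relevant components are cut off on a common neighbourhood of
  \<open>p\<close>. Section and covector each carry a factor \<open>\<theta>\<close>, whence its
  square; the expansion then holds globally, both sides being 0 where \<open>\<theta>\<close>
  is.\<close>

lemma dual_frames:
  obtains \<theta> J e \<epsilon> where "\<theta> \<in> C" "\<theta> p \<noteq> 0" "finite (J :: (int \<times> nat) set)"
    "\<And>j. j \<in> J \<Longrightarrow> e j \<in> H" "\<And>j. j \<in> J \<Longrightarrow> \<epsilon> j \<in> covectors A E (- fst (e j))"
    "\<And>Y q. Y \<in> H \<Longrightarrow> (\<theta> q * \<theta> q) *\<^sub>R snd Y q =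
      (\<Sum>j | j \<in> J \<and> fst (e j) = fst Y. \<epsilon> j [Y] q *\<^sub>R snd (e j) q)"
proof -
  have "\<exists>F. F \<in> frames (E d) \<and> p \<in> fst F" for d
  proof -
    have "p \<in> (\<Union>(U, e)\<in>frames (E d). U)"
      using component.is_bundle[of d] by (simp add: vector_bundle_def)
    then show ?thesis by auto
  qed
  then obtain F where F: "\<And>d. F d \<in> frames (E d)" "\<And>d. p \<in> fst (F d)" by metis
  define U where "U = (\<lambda>d. fst (F d))"
  define b where "b = (\<lambda>d. snd (F d))"
  let ?R = "\<lambda>d. bundle_rank (E d)"
  have fr: "(U d, b d) \<in> frames (E d)" for d using F(1)[of d] by (simp add: U_def b_def)
  \<comment> \<open>A finite intersection over the degrees that may carry a nonzero fibre, hence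
    open.\<close>
  define W where "W = (\<Inter>d\<in>{- int n..-1}. U d)"
  have "open W" unfolding W_def by (intro open_INT) (auto intro: component.frame_openD[OF fr])
  moreover have "p \<in> W" using F(2) by (simp add: W_def U_def)
  ultimately obtain \<theta> K where \<theta>: "\<theta> \<in> C" "closed K" "K \<subseteq> W" "\<theta> p \<noteq> 0" "\<And>q. q \<notin> K \<Longrightarrow> \<theta> q = 0"
    using bump_fun by metis
  have KU: "K \<subseteq> U d" if "d \<in> {- int n..-1}" for d using \<theta>(3) that by (auto simp: W_def)
  define J where "J = (SIGMA d:{- int n..-1}. {..<?R d})"
  define e where "e = (\<lambda>(d, i). (d, \<lambda>q. if q \<in> U d then \<theta> q *\<^sub>R b d i q else 0))"
  define \<phi> where "\<phi> = (\<lambda>d i x q. if q \<in> U d then \<theta> q * frame_coord (?R d) (b d) i q (x q) else 0)"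
  define \<epsilon> where "\<epsilon> = (\<lambda>(d, i) Xs. if length Xs = 1 \<and> hd Xs \<in> H \<and> fst (hd Xs) = d
    then \<phi> d i (snd (hd Xs)) else (\<lambda>_. 0))"
  have "finite J" by (simp add: J_def)
  moreover have "e j \<in> H" if jJ: "j \<in> J" for j
  proof -
    obtain d i where j: "j = (d, i)" "d \<in> {- int n..-1}" "i < ?R d" using jJ by (cases j) (auto simp: J_def)
    then show ?thesis
      using component.cutoff_frame_section[OF fr j(3) \<theta>(1,2) KU[OF j(2)] \<theta>(5)]
      by (simp add: e_def hsections_def)
  qed
  moreover have "\<epsilon> j \<in> covectors A E (- fst (e j))" if jJ: "j \<in> J" for j
  proof -
    obtain d i where j: "j = (d, i)" "d \<in> {- int n..-1}" "i < ?R d" using jJ by (cases j) (auto simp: J_def)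
    have "\<phi> d i x \<in> C" if "x \<in> sections A (E d)" for x
      unfolding \<phi>_def by (rule component.cutoff_coframe_smooth[OF fr j(3) \<theta>(1,2) KU[OF j(2)] \<theta>(5) that])
    moreover have "\<phi> d i (\<lambda>q. f q *\<^sub>R x q + g q *\<^sub>R y q) p = f p * \<phi> d i x p + g p * \<phi> d i y p"
      if "x \<in> sections A (E d)" "y \<in> sections A (E d)" for x y f g p
      using component.frame_coord_lin[OF fr, of p d "x p" "y p" i "f p" "g p"]
        component.section_fibre[OF that(1)] component.section_fibre[OF that(2)]
      by (simp add: \<phi>_def algebra_simps)
    ultimately have "\<epsilon> (d, i) \<in> covectors A E (- d)"
      unfolding \<epsilon>_def prod.case by (rule covectorI)
    then show ?thesis by (simp add: j e_def)
  qed
  moreover have "(\<theta> q * \<theta> q) *\<^sub>R snd Y q =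
      (\<Sum>j | j \<in> J \<and> fst (e j) = fst Y. \<epsilon> j [Y] q *\<^sub>R snd (e j) q)" if "Y \<in> H" for Y q
  proof (cases "fst Y \<in> {- int n..-1}")
    case True
    define d where "d = fst Y"
    have "{j. j \<in> J \<and> fst (e j) = fst Y} = Pair d ` {..<?R d}"
      using True by (auto simp: J_def e_def d_def)
    moreover have "\<epsilon> (d, i) [Y] q *\<^sub>R snd (e (d, i)) q =
        (if q \<in> U d then (\<theta> q * \<theta> q) *\<^sub>R (frame_coord (?R d) (b d) i q (snd Y q) *\<^sub>R b d i q) else 0)"
      for i using that by (simp add: \<epsilon>_def e_def \<phi>_def d_def)
    ultimately have "(\<Sum>j | j \<in> J \<and> fst (e j) = fst Y. \<epsilon> j [Y] q *\<^sub>R snd (e j) q) =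
        (\<Sum>i<?R d. if q \<in> U d then (\<theta> q * \<theta> q) *\<^sub>R (frame_coord (?R d) (b d) i q (snd Y q) *\<^sub>R b d i q) else 0)"
      by (simp add: sum.reindex inj_on_def)
    also have "\<dots> = (\<theta> q * \<theta> q) *\<^sub>R snd Y q"
    proof (cases "q \<in> U d")
      case inU: True
      have "snd Y q \<in> fibre (E d) q"
        using that component.section_fibre by (auto simp: hsections_def d_def)
      then show ?thesis
        using component.frame_coord_sum[OF fr inU] inU
        by (simp only: if_True scaleR_sum_right[symmetric])
    next
      case False
      then have "q \<notin> K" using KU[OF True] by (auto simp: d_def)
      then show ?thesis using False \<theta>(5) by simp
    qed
    finally show ?thesis ..
  next
    case False
    then have "{j. j \<in> J \<and> fst (e j) = fst Y} = {}" by (auto simp: J_def e_def)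
    then show ?thesis unfolding \<open>{j. j \<in> J \<and> fst (e j) = fst Y} = {}\<close> hsec_outside[OF that False]
      by (simp only: sum.empty scaleR_zero_right)
  qed
  ultimately show thesis using that \<theta>(1,4) by blast
qed

text \<open>Covectors separate sections: the coefficients in the cut-off frame expansion are
  covector values, and \<open>\<theta>\<close> does not vanish at the chosen point.\<close>

lemma hsec_eqI:
  assumes "Y \<in> H" "Z \<in> H" "fst Y = fst Z"
    and "\<And>\<omega>. \<omega> \<in> covectors A E (- fst Y) \<Longrightarrow> \<omega> [Y] = \<omega> [Z]"
  shows "Y = Z"
proof (rule prod_eqI[OF assms(3)], rule ext)
  fix p
  obtain \<theta> J e \<epsilon> where f: "\<theta> \<in> C" "\<theta> p \<noteq> 0" "finite (J :: (int \<times> nat) set)"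
    "\<And>j. j \<in> J \<Longrightarrow> e j \<in> H" "\<And>j. j \<in> J \<Longrightarrow> \<epsilon> j \<in> covectors A E (- fst (e j))"
    "\<And>Y q. Y \<in> H \<Longrightarrow> (\<theta> q * \<theta> q) *\<^sub>R snd Y q =
      (\<Sum>j | j \<in> J \<and> fst (e j) = fst Y. \<epsilon> j [Y] q *\<^sub>R snd (e j) q)"
    using dual_frames by blast
  have "(\<theta> p * \<theta> p) *\<^sub>R snd Y p = (\<theta> p * \<theta> p) *\<^sub>R snd Z p"
    unfolding f(6)[OF assms(1)] f(6)[OF assms(2)] assms(3)
  proof (rule sum.cong[OF refl])
    fix j assume "j \<in> {j. j \<in> J \<and> fst (e j) = fst Z}"
    then have "\<epsilon> j \<in> covectors A E (- fst Y)" using f(5)[of j] assms(3) by simp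
    from assms(4)[OF this] show "\<epsilon> j [Y] p *\<^sub>R snd (e j) p = \<epsilon> j [Z] p *\<^sub>R snd (e j) p" by simp
  qed
  then show "snd Y p = snd Z p" using f(2) by simp
qed

lemma scaled_arg_expansion:
  assumes "\<omega> \<in> S" "Y \<in> H" "\<theta> \<in> C" "finite J" "\<And>j. j \<in> J \<Longrightarrow> e j \<in> H"
    and "\<And>j. j \<in> J \<Longrightarrow> \<epsilon> j \<in> covectors A E (- fst (e j))"
    and "\<And>q. (\<theta> q * \<theta> q) *\<^sub>R snd Y q = (\<Sum>j | j \<in> J \<and> fst (e j) = fst Y. \<epsilon> j [Y] q *\<^sub>R snd (e j) q)"
  shows "(\<Sum>j\<in>J. \<epsilon> j [Y] p * \<omega> (e j # Xs) p) = \<theta> p * \<theta> p * \<omega> (Y # Xs) p"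
proof (cases "set Xs \<subseteq> H")
  case True
  let ?J = "{j. j \<in> J \<and> fst (e j) = fst Y}"
  have pair: "(fst Y, snd (e j)) = e j" if "j \<in> ?J" for j
    using that by (simp add: prod_eq_iff)
  have "(\<Sum>j\<in>J. \<epsilon> j [Y] p * \<omega> (e j # Xs) p) = (\<Sum>j\<in>?J. \<epsilon> j [Y] p * \<omega> (e j # Xs) p)"
  proof (rule sum.mono_neutral_right[OF assms(4)])
    show "\<forall>j\<in>J - ?J. \<epsilon> j [Y] p * \<omega> (e j # Xs) p = 0"
    proof
      fix j assume "j \<in> J - ?J"
      then show "\<epsilon> j [Y] p * \<omega> (e j # Xs) p = 0"
        using covectorsD(4)[OF assms(6), of j Y] by fastforce
    qed
  qed auto
  also have "\<dots> = (\<Sum>j\<in>?J. \<epsilon> j [Y] p * \<omega> ((fst Y, snd (e j)) # Xs) p)"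
    by (rule sum.cong) (simp_all add: pair)
  also have "\<dots> = \<omega> ((fst Y, \<lambda>q. \<Sum>j\<in>?J. \<epsilon> j [Y] q *\<^sub>R snd (e j) q) # Xs) p"
    by (rule symalg_sum_arg[THEN conjunct2, symmetric])
      (use assms(1,4,5) True pair covectorsD(2)[OF assms(6)] in \<open>auto intro: symalg_Cinf\<close>)
  also have "(fst Y, \<lambda>q. \<Sum>j\<in>?J. \<epsilon> j [Y] q *\<^sub>R snd (e j) q) =
      gadd (gscale (\<lambda>q. \<theta> q * \<theta> q) Y) (gscale (\<lambda>_. 0) Y)"
    by (simp add: gadd_def gscale_def assms(7))
  also have "\<omega> (\<dots> # Xs) p = \<theta> p * \<theta> p * \<omega> (Y # Xs) p"
    using symalg_lin[OF assms(1) Cinf_mult[OF assms(3,3)] Cinf_const[of 0], of "[]" Y Y Xs p]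
      True assms(2) by simp
  finally show ?thesis .
qed (simp add: symalg_outside[OF assms(1)])

text \<open>Euler's formula, cut off by \<open>\<theta>\<^sup>2\<close>: \<open>\<Sum>\<^sub>j \<epsilon>\<^sub>j \<odot> i(e\<^sub>j)\<close> counts the generators. It writes a
  form locally as a combination of products of covectors with forms of smaller arity.\<close>

lemma euler_formula:
  assumes "\<theta> \<in> C" "finite J" "\<And>j. j \<in> J \<Longrightarrow> e j \<in> H"
    and "\<And>j. j \<in> J \<Longrightarrow> \<epsilon> j \<in> covectors A E (- fst (e j))"
    and exp: "\<And>Y q. Y \<in> H \<Longrightarrow> (\<theta> q * \<theta> q) *\<^sub>R snd Y q =
      (\<Sum>j | j \<in> J \<and> fst (e j) = fst Y. \<epsilon> j [Y] q *\<^sub>R snd (e j) q)"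
    and "\<omega> \<in> S"
  shows "(\<Sum>j\<in>J. pm (fst (e j)) * sprod (\<epsilon> j) (interior (e j) \<omega>) Xs p) =
    real (length Xs) * (\<theta> p * \<theta> p) * \<omega> Xs p"
  using assms(6)
proof (induction Xs arbitrary: \<omega>)
  case Nil
  then show ?case
    using covectorsD(3)[OF assms(4), of _ "[]"] by (simp add: sprod_Nil)
next
  case (Cons X Xs)
  show ?case
  proof (cases "set (X # Xs) \<subseteq> H")
    case False
    then show ?thesis
      using symalg_outside[OF Cons.prems]
        symalg_outside[OF sprod_symalg[OF covectorsD(2)[OF assms(4)]
            interior_symalg[OF assms(3) Cons.prems]]]
      by simp
  next
    case True
    \<comment> \<open>The new argument enters the covector, which leaves a function times the
      contracted form.\<close>
    have first: "pm (fst (e j)) * sprod (\<lambda>Ys. \<epsilon> j (X # Ys))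
        (\<lambda>Ys p. pm (fst X * tdeg Ys) * interior (e j) \<omega> Ys p) Xs p =
        \<epsilon> j [X] p * \<omega> (e j # Xs) p" if "j \<in> J" for j
    proof -
      have "(\<lambda>Ys. \<epsilon> j (X # Ys)) = fun_form (\<epsilon> j [X])"
        using covectorsD(3)[OF assms(4)[OF that]] by (auto simp: fun_form_def)
      moreover have "\<epsilon> j [X] p = 0" if "fst X \<noteq> fst (e j)"
        using covectorsD(4)[OF assms(4)[OF \<open>j \<in> J\<close>], of X] that by simp
      moreover have "pm x * (v * (pm (x * t) * (pm (x * (x + t)) * w))) = v * w" for x t v w
        by (auto simp: pm_def)
      ultimately show ?thesis
        by (cases "fst X = fst (e j)") (simp_all add: sprod_fun_form interior_def Cons.prems)
    qed
    \<comment> \<open>The new argument enters the contracted form; graded symmetry moves it behind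
      \<open>e j\<close>, and the sign in \<open>interior\<close> absorbs the exchange.\<close>
    have second: "sprod (\<epsilon> j) (\<lambda>Ys. interior (e j) \<omega> (X # Ys)) Xs p =
        sprod (\<epsilon> j) (interior (e j) (\<lambda>Ys. \<omega> (X # Ys))) Xs p" if "j \<in> J" for j
    proof (rule sprod_cong)
      fix Ys assume "set Ys \<subseteq> set Xs"
      then have "set Ys \<subseteq> H" "X \<in> H" using True by auto
      moreover have "pm (d * (d + (x + t))) * (pm (d * x) * w) = pm (d * (d + t)) * w" for d x t w
        by (auto simp: pm_def)
      ultimately show "interior (e j) \<omega> (X # Ys) p = interior (e j) (\<lambda>Ys. \<omega> (X # Ys)) Ys p"
        using symalg_swap[OF Cons.prems, of "[]" "e j" X Ys p] assms(3)[OF that]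
        by (simp add: interior_def Cons.prems symalg_insert)
    qed simp
    have "(\<Sum>j\<in>J. pm (fst (e j)) * sprod (\<epsilon> j) (interior (e j) \<omega>) (X # Xs) p) =
        (\<Sum>j\<in>J. \<epsilon> j [X] p * \<omega> (e j # Xs) p) +
        (\<Sum>j\<in>J. pm (fst (e j)) * sprod (\<epsilon> j) (interior (e j) (\<lambda>Ys. \<omega> (X # Ys))) Xs p)"
      by (simp add: sprod_Cons first second distrib_left sum.distrib)
    also have "(\<Sum>j\<in>J. \<epsilon> j [X] p * \<omega> (e j # Xs) p) = \<theta> p * \<theta> p * \<omega> (X # Xs) p"
      by (rule scaled_arg_expansion) (use Cons.prems True assms in auto)
    also have "(\<Sum>j\<in>J. pm (fst (e j)) * sprod (\<epsilon> j) (interior (e j) (\<lambda>Ys. \<omega> (X # Ys))) Xs p) =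
        real (length Xs) * (\<theta> p * \<theta> p) * \<omega> (X # Xs) p"
      using Cons.IH[OF symalg_insert[OF Cons.prems]] True by simp
    finally show ?thesis by (simp add: algebra_simps)
  qed
qed

text \<open>The factor 1 gives the sum the shape of \<open>derivation_sum\<close>.\<close>

lemma arity_part_decomposition:
  assumes "\<And>Xs. length Xs > N \<Longrightarrow> \<omega> Xs = (\<lambda>_. 0)"
  shows "\<omega> = (\<lambda>Xs p. \<Sum>r\<le>N. 1 * arity_part r \<omega> Xs p)"
proof (intro ext)
  fix Xs p
  have "(\<Sum>r\<le>N. 1 * arity_part r \<omega> Xs p) = (\<Sum>r\<le>N. if r = length Xs then \<omega> Xs p else 0)"
    by (intro sum.cong) (auto simp: arity_part_def)
  then show "\<omega> Xs p = (\<Sum>r\<le>N. 1 * arity_part r \<omega> Xs p)"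
    using assms[of Xs] by (auto simp: not_le)
qed

text \<open>Induction on the arity. Euler's formula writes a function \<open>h\<close> times a form
  of arity \<open>Suc r\<close> through products of covectors with forms of arity \<open>r\<close>,
  on which both derivations agree. The Leibniz rule for the product with \<open>h\<close> then
  returns to the form itself at a point where \<open>h\<close> is nonzero.\<close>

lemma derivation_eqI:
  assumes D: "derivation A E m D" and D': "derivation A E m D'"
    and on_fun: "\<And>f. f \<in> C \<Longrightarrow> D (fun_form f) = D' (fun_form f)"
    and cov: "\<And>k \<omega>. \<omega> \<in> covectors A E k \<Longrightarrow> D \<omega> = D' \<omega>"
  shows "D = D'"
proof -
  have pure: "D \<omega> = D' \<omega>" if "\<omega> \<in> S" "arity_part r \<omega> = \<omega>" for r \<omega>
    using that
  proof (induction r arbitrary: \<omega>)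
    case 0
    have "arity_part 0 \<omega> = fun_form (\<omega> [])"
      by (rule ext) (simp add: fun_form_def arity_part_def)
    with 0(2) have eq: "fun_form (\<omega> []) = \<omega>"
      by (simp only:)
    show ?case using on_fun[OF symalg_Cinf[OF 0(1), of "[]"]] unfolding eq .
  next
    case (Suc r)
    have zero: "\<omega> Xs = (\<lambda>_. 0)" if "length Xs \<noteq> Suc r" for Xs
      using that fun_cong[OF Suc.prems(2), of Xs] by (simp add: arity_part_def)
    show ?case
    proof (intro ext)
      fix Xs p
      obtain \<theta> J e \<epsilon> where f: "\<theta> \<in> C" "\<theta> p \<noteq> 0" "finite (J :: (int \<times> nat) set)"
        "\<And>j. j \<in> J \<Longrightarrow> e j \<in> H" "\<And>j. j \<in> J \<Longrightarrow> \<epsilon> j \<in> covectors A E (- fst (e j))"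
        "\<And>Y q. Y \<in> H \<Longrightarrow> (\<theta> q * \<theta> q) *\<^sub>R snd Y q =
          (\<Sum>j | j \<in> J \<and> fst (e j) = fst Y. \<epsilon> j [Y] q *\<^sub>R snd (e j) q)"
        using dual_frames by blast
      \<comment> \<open>The arity times the square of the bump function; nonzero at \<open>p\<close>
        because the arity is positive.\<close>
      define h where "h = (\<lambda>q. real (Suc r) * (\<theta> q * \<theta> q))"
      have h: "h \<in> C" unfolding h_def by (intro Cinf_mult Cinf_const f(1))
      let ?P = "\<lambda>j. sprod (\<epsilon> j) (interior (e j) \<omega>)"
      have PS: "?P j \<in> S" if "j \<in> J" for j
        by (intro sprod_symalg covectorsD(2)[OF f(5)] interior_symalg f(4) that Suc.prems(1))
      have eq: "sprod (fun_form h) \<omega> = (\<lambda>Xs p. \<Sum>j\<in>J. pm (fst (e j)) * ?P j Xs p)"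
        using euler_formula[OF f(1,3,4,5,6) Suc.prems(1)] zero
        by (fastforce simp: fun_eq_iff sprod_fun_form h_def)
      have "D (?P j) = D' (?P j)" if j: "j \<in> J" for j
      proof -
        have "arity_part r (interior (e j) \<omega>) = interior (e j) \<omega>"
          by (auto simp: arity_part_def interior_def fun_eq_iff zero)
        then have "D (interior (e j) \<omega>) = D' (interior (e j) \<omega>)"
          by (rule Suc.IH[OF interior_symalg[OF f(4)[OF j] Suc.prems(1)]])
        then show ?thesis
          using derivationD(5)[OF D covectorsD(1)[OF f(5)[OF j]] interior_symalg[OF f(4)[OF j] Suc.prems(1)]]
            derivationD(5)[OF D' covectorsD(1)[OF f(5)[OF j]] interior_symalg[OF f(4)[OF j] Suc.prems(1)]]
            cov[OF f(5)[OF j]]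
          by simp
      qed
      moreover have "D (\<lambda>Xs p. \<Sum>j\<in>J. pm (fst (e j)) * ?P j Xs p) =
          (\<lambda>Xs p. \<Sum>j\<in>J. pm (fst (e j)) * D (?P j) Xs p)"
        by (rule derivation_sum[OF D f(3)]) (rule PS)
      moreover have "D' (\<lambda>Xs p. \<Sum>j\<in>J. pm (fst (e j)) * ?P j Xs p) =
          (\<lambda>Xs p. \<Sum>j\<in>J. pm (fst (e j)) * D' (?P j) Xs p)"
        by (rule derivation_sum[OF D' f(3)]) (rule PS)
      ultimately have "D (sprod (fun_form h) \<omega>) = D' (sprod (fun_form h) \<omega>)"
        unfolding eq by simp
      \<comment> \<open>The terms in which the derivation hits \<open>h\<close> agree by the
        hypothesis on functions and drop out.\<close>
      then have "h p * D \<omega> Xs p = h p * D' \<omega> Xs p"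
        using derivationD(5)[OF D fun_form_deg[OF h] Suc.prems(1)]
          derivationD(5)[OF D' fun_form_deg[OF h] Suc.prems(1)] on_fun[OF h]
        by (simp add: sprod_fun_form fun_eq_iff)
      then show "D \<omega> Xs p = D' \<omega> Xs p"
        using f(2) by (simp add: h_def)
    qed
  qed
  show ?thesis
  proof
    fix \<omega>
    show "D \<omega> = D' \<omega>"
    proof (cases "\<omega> \<in> S")
      case True
      then obtain N where N: "\<And>Xs. length Xs > N \<Longrightarrow> \<omega> Xs = (\<lambda>_. 0)"
        using symalg_bound by meson
      have parts: "D (arity_part r \<omega>) = D' (arity_part r \<omega>)" for r
        by (rule pure[OF symalg_arity_part[OF True], of r]) (simp add: arity_part_def fun_eq_iff)
      have sums: "D (\<lambda>Xs p. \<Sum>r\<le>N. 1 * arity_part r \<omega> Xs p) = D' (\<lambda>Xs p. \<Sum>r\<le>N. 1 * arity_part r \<omega> Xs p)"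
        unfolding derivation_sum[OF D finite_atMost symalg_arity_part[OF True]]
          derivation_sum[OF D' finite_atMost symalg_arity_part[OF True]] parts ..
      have eq: "\<omega> = (\<lambda>Xs p. \<Sum>r\<le>N. 1 * arity_part r \<omega> Xs p)"
        by (rule arity_part_decomposition) (rule N)
      show ?thesis
        by (rule trans[OF arg_cong[OF eq, of D] trans[OF sums arg_cong[OF eq, of D', symmetric]]])
    qed (simp add: derivationD(1)[OF D] derivationD(1)[OF D'])
  qed
qed

lemma contraction_eqI:
  assumes X: "X \<in> H" and D: "derivation A E (fst X) D"
    and on_fun: "\<And>f. f \<in> C \<Longrightarrow> D (fun_form f) = (\<lambda>_ _. 0)"
    and cov: "\<And>k \<omega>. \<omega> \<in> covectors A E k \<Longrightarrow> D \<omega> = fun_form (\<lambda>p. pm (fst X) * \<omega> [X] p)"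
  shows "contraction A E X = D"
proof -
  have fn: "fun_form (\<lambda>p. if - fst X = k then (- 1) powi (- fst X * k) * \<omega> [X] p else 0) =
      fun_form (\<lambda>p. pm (fst X) * \<omega> [X] p)" if "\<omega> \<in> covectors A E k" for k \<omega>
    using covectorsD(4)[OF that, of X]
    by (intro arg_cong[where f = fun_form] ext) (auto simp: pm_def)
  show ?thesis
    unfolding contraction_def
  proof (rule the_equality)
    show "derivation A E (fst X) D \<and> (\<forall>f\<in>C. D (fun_form f) = (\<lambda>_ _. 0)) \<and>
      (\<forall>k. \<forall>\<omega>\<in>covectors A E k. D \<omega> =
        fun_form (\<lambda>p. if - fst X = k then (- 1) powi (- fst X * k) * \<omega> [X] p else 0))"
      by (intro conjI ballI allI D on_fun) (simp_all only: cov fn)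
  next
    fix D'
    assume D': "derivation A E (fst X) D' \<and> (\<forall>f\<in>C. D' (fun_form f) = (\<lambda>_ _. 0)) \<and>
      (\<forall>k. \<forall>\<omega>\<in>covectors A E k. D' \<omega> =
        fun_form (\<lambda>p. if - fst X = k then (- 1) powi (- fst X * k) * \<omega> [X] p else 0))"
    show "D' = D"
    proof (rule derivation_eqI[OF _ D])
      show "D' (fun_form f) = D (fun_form f)" if "f \<in> C" for f
        using D' on_fun[OF that] that by simp
      show "D' \<omega> = D \<omega>" if "\<omega> \<in> covectors A E k" for k \<omega>
        unfolding cov[OF that] fn[OF that, symmetric] using D' that by blast
    qed (use D' in blast)
  qed
qed

lemma contraction_eq_interior: "X \<in> H \<Longrightarrow> contraction A E X = interior X"
  by (intro contraction_eqI derivation_interior interior_fun_form interior_covector)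

text \<open>This makes the section described by \<open>derived_bracket\<close> unique.\<close>

lemma contraction_inj:
  assumes "Y \<in> H" "Z \<in> H" "fst Y = fst Z" "contraction A E Y = contraction A E Z"
  shows "Y = Z"
proof (rule hsec_eqI[OF assms(1-3)])
  fix \<omega> assume \<omega>: "\<omega> \<in> covectors A E (- fst Y)"
  have "interior Y \<omega> = interior Z \<omega>"
    using assms by (simp only: contraction_eq_interior)
  then have "(fun_form (\<lambda>p. pm (fst Y) * \<omega> [Y] p) :: ('m, 'v) form) =
      fun_form (\<lambda>p. pm (fst Y) * \<omega> [Z] p)"
    unfolding interior_covector[OF \<omega>] assms(3) .
  then have "(\<lambda>p. pm (fst Y) * \<omega> [Y] p) = (\<lambda>p. pm (fst Y) * \<omega> [Z] p)"
    by (auto simp: fun_form_def dest: fun_cong[of _ _ "[]"])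
  then show "\<omega> [Y] = \<omega> [Z]"
    by (auto simp: fun_eq_iff pm_def split: if_splits)
qed

subsection \<open>Commutators and arity components of derivations\<close>

lemma derivation_add:
  assumes "derivation A E m D" "\<omega> \<in> S" "\<eta> \<in> S"
  shows "D (\<lambda>Xs p. \<omega> Xs p + b * \<eta> Xs p) = (\<lambda>Xs p. D \<omega> Xs p + b * D \<eta> Xs p)"
  using derivationD(4)[OF assms, of 1 b] by simp

lemma sprod_diff_left:
  "sprod (\<lambda>Ys p. f Ys p - b * f' Ys p) g Xs p = sprod f g Xs p - b * sprod f' g Xs p"
  using sprod_lin_left[of "\<lambda>_. 1" f "\<lambda>_. - b" f' g Xs p] by simp

lemma sprod_diff_right:
  "sprod f (\<lambda>Ys p. g Ys p - b * g' Ys p) Xs p = sprod f g Xs p - b * sprod f g' Xs p"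
  using sprod_lin_right[of f "\<lambda>_. 1" g "\<lambda>_. - b" g' Xs p] by simp

lemma derivation_gcomm:
  assumes D: "derivation A E m D" and D': "derivation A E m' D'"
  shows "derivation A E (m + m') (snd (gcomm (m, D) (m', D')))"
proof -
  define s where "s = pm (m * m')"
  let ?G = "\<lambda>\<omega> Xs p. D (D' \<omega>) Xs p - s * D' (D \<omega>) Xs p"
  have GS: "?G \<omega> \<in> S" if "\<omega> \<in> S" for \<omega>
    using symalg_lincomb[OF derivationD(2)[OF D derivationD(2)[OF D' that]]
        derivationD(2)[OF D' derivationD(2)[OF D that]] Cinf_const[of 1] Cinf_const[of "- s"]] by simp
  have "derivation A E (m + m') ?G"
    unfolding derivation_def minus_one_powi
  proof (intro conjI allI impI ballI)
    fix \<omega> assume "\<omega> \<notin> S"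
    then show "?G \<omega> = (\<lambda>_ _. 0)"
      by (simp add: derivationD(1)[OF D] derivationD(1)[OF D'] derivation_0[OF D] derivation_0[OF D'])
  next
    fix \<omega> k assume "\<omega> \<in> symalg_deg A E k"
    then have "D (D' \<omega>) \<in> symalg_deg A E (k + m' + m)" "D' (D \<omega>) \<in> symalg_deg A E (k + m + m')"
      and "\<omega> \<in> S"
      using derivationD(3)[OF D] derivationD(3)[OF D'] symalg_degD(1) by blast+
    then show "?G \<omega> \<in> symalg_deg A E (k + (m + m'))"
      by (intro symalg_degI GS) (simp_all add: symalg_degD(2) add.assoc add.commute[of m m'])
  next
    fix \<omega> \<eta> a b assume S: "\<omega> \<in> S" "\<eta> \<in> S"
    then have "D \<omega> \<in> S" "D' \<omega> \<in> S" "D \<eta> \<in> S" "D' \<eta> \<in> S"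
      using derivationD(2) D D' by blast+
    then show "?G (\<lambda>Xs p. a * \<omega> Xs p + b * \<eta> Xs p) = (\<lambda>Xs p. a * ?G \<omega> Xs p + b * ?G \<eta> Xs p)"
      using S by (simp add: derivationD(4)[OF D] derivationD(4)[OF D'] algebra_simps)
  next
    fix \<omega> k \<eta> assume \<omega>: "\<omega> \<in> symalg_deg A E k" and \<eta>: "\<eta> \<in> S"
    have \<omega>S: "\<omega> \<in> S" using \<omega> by (rule symalg_degD)
    note in_S = \<omega>S \<eta> derivationD(2)[OF D \<omega>S] derivationD(2)[OF D' \<omega>S]
      derivationD(2)[OF D \<eta>] derivationD(2)[OF D' \<eta>]
    note L = derivationD(5)[OF D \<omega>] derivationD(5)[OF D' \<omega>]
      derivationD(5)[OF D derivationD(3)[OF D' \<omega>]] derivationD(5)[OF D' derivationD(3)[OF D \<omega>]]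
    have 1: "D (D' (sprod \<omega> \<eta>)) Xs p = sprod (D (D' \<omega>)) \<eta> Xs p +
        pm (m * (k + m')) * sprod (D' \<omega>) (D \<eta>) Xs p + pm (m' * k) * (sprod (D \<omega>) (D' \<eta>) Xs p +
        pm (m * k) * sprod \<omega> (D (D' \<eta>)) Xs p)" for Xs p
      using in_S by (simp add: L derivation_add[OF D] sprod_symalg)
    have 2: "D' (D (sprod \<omega> \<eta>)) Xs p = sprod (D' (D \<omega>)) \<eta> Xs p +
        pm (m' * (k + m)) * sprod (D \<omega>) (D' \<eta>) Xs p + pm (m * k) * (sprod (D' \<omega>) (D \<eta>) Xs p +
        pm (m' * k) * sprod \<omega> (D' (D \<eta>)) Xs p)" for Xs p
      using in_S by (simp add: L derivation_add[OF D'] sprod_symalg)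
    have sgn: "pm (m * (k + m')) = s * pm (m * k)" "pm (m' * (k + m)) = s * pm (m' * k)"
      "pm ((m + m') * k) = pm (m * k) * pm (m' * k)" "s * s = 1"
      by (auto simp: s_def pm_def)
    \<comment> \<open>Both mixed products occur with equal coefficients in the two compositions and
      cancel.\<close>
    have cancel: "(P + s * a * Q + b * (R + a * T)) - s * (P' + s * b * R + a * (Q + b * T')) =
        P - s * P' + a * b * (T - s * T')" for P Q R T P' T' a b :: real
      using sgn(4) by (simp add: algebra_simps)
    show "?G (sprod \<omega> \<eta>) =
        (\<lambda>Xs p. sprod (?G \<omega>) \<eta> Xs p + pm ((m + m') * k) * sprod \<omega> (?G \<eta>) Xs p)"
      unfolding 1 2 sgn(1-3) sprod_diff_left sprod_diff_right cancel ..
  qed (rule GS)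
  then show ?thesis
    by (simp add: gcomm_def s_def)
qed

text \<open>For negative \<open>r\<close> this says that \<open>\<omega>\<close> vanishes.\<close>

definition pure_arity :: "int \<Rightarrow> ('m, 'v) form \<Rightarrow> bool" where
  "pure_arity r \<omega> \<longleftrightarrow> (\<forall>Xs. int (length Xs) \<noteq> r \<longrightarrow> \<omega> Xs = (\<lambda>_. 0))"

text \<open>Integer shifts allow the value -1 of a contraction also at arity 0, where the statement
  says that the result vanishes.\<close>

definition shifts_arity :: "int \<Rightarrow> ('m, 'v) operator \<Rightarrow> bool" where
  "shifts_arity d D \<longleftrightarrow> (\<forall>\<omega>\<in>S. \<forall>r. pure_arity r \<omega> \<longrightarrow> pure_arity (r + d) (D \<omega>))"

lemma shifts_arity_interior: "shifts_arity (-1) (interior X)"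
  by (auto simp: shifts_arity_def pure_arity_def interior_def)

lemma shifts_arity_gcomm:
  assumes "derivation A E m D" "derivation A E m' D'" "shifts_arity d D" "shifts_arity d' D'"
  shows "shifts_arity (d + d') (snd (gcomm (m, D) (m', D')))"
  unfolding shifts_arity_def
proof (intro ballI allI impI)
  fix \<omega> r assume \<omega>: "\<omega> \<in> S" "pure_arity r \<omega>"
  have "pure_arity (r + d' + d) (D (D' \<omega>))" "pure_arity (r + d + d') (D' (D \<omega>))"
    using assms(3,4) \<omega> derivationD(2)[OF assms(1)] derivationD(2)[OF assms(2)]
    unfolding shifts_arity_def by blast+
  then show "pure_arity (r + (d + d')) (snd (gcomm (m, D) (m', D')) \<omega>)"
    by (simp add: pure_arity_def gcomm_def add.assoc add.commute[of d d'])
qed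

lemma arity_part_eq_0:
  "pure_arity r \<omega> \<Longrightarrow> int k \<noteq> r \<Longrightarrow> arity_part k \<omega> = (\<lambda>_ _. 0)"
  by (auto simp: pure_arity_def arity_part_def fun_eq_iff)

lemma shifts_arity_op_part:
  assumes "derivation A E m Q"
  shows "shifts_arity (int p) (op_part A E p Q)"
  unfolding shifts_arity_def
proof (intro ballI allI impI)
  fix \<omega> r assume \<omega>: "\<omega> \<in> S" "pure_arity r \<omega>"
  show "pure_arity (r + int p) (op_part A E p Q \<omega>)"
    unfolding pure_arity_def
  proof (intro allI impI)
    fix Xs :: "('m, 'v) hsec list" assume "int (length Xs) \<noteq> r + int p"
    then have "p \<le> length Xs \<Longrightarrow> arity_part (length Xs - p) \<omega> = (\<lambda>_ _. 0)"
      by (intro arity_part_eq_0[OF \<omega>(2)]) auto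
    then show "op_part A E p Q \<omega> Xs = (\<lambda>_. 0)"
      by (auto simp: op_part_def derivation_0[OF assms])
  qed
qed

text \<open>Complementary sublists have lengths adding up to that of the list, so at most one pair
  of arities contributes for each subset of positions.\<close>

lemma sprod_arity_part:
  fixes \<omega> \<eta> :: "('m, 'v) form"
  shows "arity_part M (sprod \<omega> \<eta>) = (\<lambda>Xs p. \<Sum>a\<le>M. 1 * sprod (arity_part a \<omega>) (arity_part (M - a) \<eta>) Xs p)"
proof (intro ext)
  fix Xs :: "('m, 'v) hsec list" and p
  let ?c = "\<lambda>I. subset_sign I Xs * pm (tdeg (nths Xs (- I)) * tdeg (nths Xs I))"
  have inner: "(\<Sum>a\<le>M. arity_part a \<omega> (nths Xs I) p * arity_part (M - a) \<eta> (nths Xs (- I)) p) =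
      (if length Xs = M then \<omega> (nths Xs I) p * \<eta> (nths Xs (- I)) p else 0)" for I
  proof -
    have "(\<Sum>a\<le>M. arity_part a \<omega> (nths Xs I) p * arity_part (M - a) \<eta> (nths Xs (- I)) p) =
        (\<Sum>a\<le>M. if a = length (nths Xs I)
          then (if length Xs = M then \<omega> (nths Xs I) p * \<eta> (nths Xs (- I)) p else 0) else 0)"
      using length_nths_add[of Xs I] by (intro sum.cong refl) (auto simp: arity_part_def)
    also have "\<dots> = (if length Xs = M then \<omega> (nths Xs I) p * \<eta> (nths Xs (- I)) p else 0)"
      using length_nths_add[of Xs I] by auto
    finally show ?thesis .
  qed
  have "(\<Sum>a\<le>M. 1 * sprod (arity_part a \<omega>) (arity_part (M - a) \<eta>) Xs p) =
      (\<Sum>I\<in>Pow {..<length Xs}. ?c I * (\<Sum>a\<le>M. arity_part a \<omega> (nths Xs I) p *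
        arity_part (M - a) \<eta> (nths Xs (- I)) p))"
    unfolding sprod_alt mult_1 sum_distrib_left by (subst sum.swap) (simp add: mult.assoc)
  also have "\<dots> = arity_part M (sprod \<omega> \<eta>) Xs p"
    unfolding inner by (simp add: arity_part_def sprod_alt mult.assoc)
  finally show "arity_part M (sprod \<omega> \<eta>) Xs p =
      (\<Sum>a\<le>M. 1 * sprod (arity_part a \<omega>) (arity_part (M - a) \<eta>) Xs p)" ..
qed

lemma arity_part_deg: "\<omega> \<in> symalg_deg A E k \<Longrightarrow> arity_part r \<omega> \<in> symalg_deg A E k"
  by (rule symalg_degI[OF symalg_arity_part[OF symalg_degD(1)]])
    (auto simp: arity_part_def symalg_degD)

text \<open>An arity component of a product splits into products of arity components. The Leibniz
  rule of \<open>Q\<close> applies to each of them, and after regrouping by subsets of positions at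
  most one pair of arities survives for each.\<close>

lemma derivation_op_part:
  assumes Q: "derivation A E m Q"
  shows "derivation A E m (op_part A E p Q)"
  unfolding derivation_def minus_one_powi
proof (intro conjI allI impI ballI)
  show S: "op_part A E p Q \<omega> \<in> S" if \<omega>: "\<omega> \<in> S" for \<omega>
  proof -
    obtain N where N: "\<And>Xs. length Xs > N \<Longrightarrow> \<omega> Xs = (\<lambda>_. 0)"
      using symalg_bound[OF \<omega>] by blast
    \<comment> \<open>Since \<open>\<omega>\<close> has bounded arity, this is a finite sum of arity
      components of elements of the algebra.\<close>
    have "op_part A E p Q \<omega> = (\<lambda>Xs q. \<Sum>r\<le>N. 1 * arity_part (r + p) (Q (arity_part r \<omega>)) Xs q)"
    proof (intro ext)
      fix Xs q
      have "(\<Sum>r\<le>N. 1 * arity_part (r + p) (Q (arity_part r \<omega>)) Xs q) =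
          (\<Sum>r\<le>N. if r = length Xs - p then op_part A E p Q \<omega> Xs q else 0)"
        using that by (intro sum.cong refl) (auto simp: op_part_def arity_part_def)
      also have "\<dots> = op_part A E p Q \<omega> Xs q"
      proof (cases "length Xs - p \<le> N")
        case False
        then have "arity_part (length Xs - p) \<omega> = (\<lambda>_ _. 0)"
          using N by (auto simp: arity_part_def fun_eq_iff)
        then show ?thesis using False by (simp add: op_part_def derivation_0[OF Q])
      qed simp
      finally show "op_part A E p Q \<omega> Xs q =
        (\<Sum>r\<le>N. 1 * arity_part (r + p) (Q (arity_part r \<omega>)) Xs q)" ..
    qed
    then show ?thesis
      using symalg_sum[of "{..N}" "\<lambda>r. arity_part (r + p) (Q (arity_part r \<omega>))" "\<lambda>_. 1"]
      by (simp add: symalg_arity_part derivationD(2)[OF Q] that)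
  qed
  show "op_part A E p Q \<omega> \<in> symalg_deg A E (k + m)" if "\<omega> \<in> symalg_deg A E k" for k \<omega>
    using symalg_degD(2)[OF derivationD(3)[OF Q arity_part_deg[OF that]]] symalg_degD(1)[OF that]
    by (intro symalg_degI S) (auto simp: op_part_def)
next
  fix \<omega> \<eta> a b assume S: "\<omega> \<in> S" "\<eta> \<in> S"
  have "arity_part r (\<lambda>Xs p. a * \<omega> Xs p + b * \<eta> Xs p) =
      (\<lambda>Xs p. a * arity_part r \<omega> Xs p + b * arity_part r \<eta> Xs p)" for r
    by (auto simp: arity_part_def)
  then show "op_part A E p Q (\<lambda>Xs p. a * \<omega> Xs p + b * \<eta> Xs p) =
      (\<lambda>Xs q. a * op_part A E p Q \<omega> Xs q + b * op_part A E p Q \<eta> Xs q)"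
    using S symalg_lincomb[OF S Cinf_const[of a] Cinf_const[of b]]
    by (intro ext) (simp add: op_part_def derivationD(4)[OF Q] symalg_arity_part)
next
  fix \<omega> k \<eta> assume \<omega>: "\<omega> \<in> symalg_deg A E k" and \<eta>: "\<eta> \<in> S"
  have \<omega>S: "\<omega> \<in> S" using \<omega> by (rule symalg_degD)
  show "op_part A E p Q (sprod \<omega> \<eta>) =
      (\<lambda>Xs q. sprod (op_part A E p Q \<omega>) \<eta> Xs q + pm (m * k) * sprod \<omega> (op_part A E p Q \<eta>) Xs q)"
  proof (intro ext)
    fix Xs :: "('m, 'v) hsec list" and q
    let ?c = "\<lambda>I. subset_sign I Xs * pm (tdeg (nths Xs (- I)) * tdeg (nths Xs I))"
    show "op_part A E p Q (sprod \<omega> \<eta>) Xs q =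
      sprod (op_part A E p Q \<omega>) \<eta> Xs q + pm (m * k) * sprod \<omega> (op_part A E p Q \<eta>) Xs q"
    proof (cases "p \<le> length Xs")
      case False
      then have "\<not> p \<le> length (nths Xs I)" "\<not> p \<le> length (nths Xs (- I))" for I
        using length_nths_add[of Xs I] by linarith+
      then have "op_part A E p Q \<omega> (nths Xs I) q = 0" "op_part A E p Q \<eta> (nths Xs (- I)) q = 0" for I
        by (simp_all add: op_part_def)
      moreover have "op_part A E p Q (sprod \<omega> \<eta>) Xs q = 0"
        using False by (simp add: op_part_def)
      ultimately show ?thesis
        by (simp add: sprod_alt)
    next
      case True
      define M where "M = length Xs - p"
      have len: "length (nths Xs I) + length (nths Xs (- I)) = M + p" for I
        using length_nths_add[of Xs I] True by (simp add: M_def)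
      have "op_part A E p Q (sprod \<omega> \<eta>) Xs q = Q (arity_part M (sprod \<omega> \<eta>)) Xs q"
        using True sprod_symalg[OF \<omega>S \<eta>] by (simp add: op_part_def M_def)
      also have "\<dots> =
          Q (\<lambda>Xs p. \<Sum>a\<le>M. 1 * sprod (arity_part a \<omega>) (arity_part (M - a) \<eta>) Xs p) Xs q"
        unfolding sprod_arity_part ..
      also have "\<dots> = (\<Sum>a\<le>M. 1 * Q (sprod (arity_part a \<omega>) (arity_part (M - a) \<eta>)) Xs q)"
        by (subst derivation_sum[OF Q]) (simp_all add: sprod_symalg symalg_arity_part \<omega>S \<eta>)
      also have "\<dots> = (\<Sum>a\<le>M. sprod (Q (arity_part a \<omega>)) (arity_part (M - a) \<eta>) Xs q) +
          pm (m * k) * (\<Sum>a\<le>M. sprod (arity_part a \<omega>) (Q (arity_part (M - a) \<eta>)) Xs q)"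
        by (simp add: derivationD(5)[OF Q arity_part_deg[OF \<omega>] symalg_arity_part[OF \<eta>]] sum.distrib
            sum_distrib_left)
      also have "(\<Sum>a\<le>M. sprod (Q (arity_part a \<omega>)) (arity_part (M - a) \<eta>) Xs q) =
          (\<Sum>I\<in>Pow {..<length Xs}. ?c I * (\<Sum>a\<le>M. Q (arity_part a \<omega>) (nths Xs I) q *
            arity_part (M - a) \<eta> (nths Xs (- I)) q))"
        unfolding sprod_alt sum_distrib_left by (subst sum.swap) (simp add: mult.assoc)
      also have "\<dots> = sprod (op_part A E p Q \<omega>) \<eta> Xs q"
        unfolding sprod_alt
      proof (rule sum.cong[OF refl])
        fix I
        \<comment> \<open>The second factor forces \<open>a\<close> to be the length of the first
          sublist minus \<open>p\<close>. When that subtraction truncates, both sides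
          vanish.\<close>
        have "(\<Sum>a\<le>M. Q (arity_part a \<omega>) (nths Xs I) q * arity_part (M - a) \<eta> (nths Xs (- I)) q) =
            (\<Sum>a\<le>M. if a = length (nths Xs I) - p
              then op_part A E p Q \<omega> (nths Xs I) q * \<eta> (nths Xs (- I)) q else 0)"
          using len[of I] \<omega>S by (intro sum.cong refl) (auto simp: arity_part_def op_part_def)
        also have "\<dots> = op_part A E p Q \<omega> (nths Xs I) q * \<eta> (nths Xs (- I)) q"
          using len[of I] by simp
        finally show "?c I * (\<Sum>a\<le>M. Q (arity_part a \<omega>) (nths Xs I) q *
            arity_part (M - a) \<eta> (nths Xs (- I)) q) = subset_sign I Xs *
            (pm (tdeg (nths Xs (- I)) * tdeg (nths Xs I)) * op_part A E p Q \<omega> (nths Xs I) q *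
            \<eta> (nths Xs (- I)) q)"
          by (simp add: mult.assoc)
      qed
      also have "(\<Sum>a\<le>M. sprod (arity_part a \<omega>) (Q (arity_part (M - a) \<eta>)) Xs q) =
          (\<Sum>I\<in>Pow {..<length Xs}. ?c I * (\<Sum>a\<le>M. arity_part a \<omega> (nths Xs I) q *
            Q (arity_part (M - a) \<eta>) (nths Xs (- I)) q))"
        unfolding sprod_alt sum_distrib_left by (subst sum.swap) (simp add: mult.assoc)
      also have "\<dots> = sprod \<omega> (op_part A E p Q \<eta>) Xs q"
        unfolding sprod_alt
      proof (rule sum.cong[OF refl])
        fix I
        have "(\<Sum>a\<le>M. arity_part a \<omega> (nths Xs I) q * Q (arity_part (M - a) \<eta>) (nths Xs (- I)) q) =
            (\<Sum>a\<le>M. if a = length (nths Xs I)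
              then \<omega> (nths Xs I) q * Q (arity_part (M - a) \<eta>) (nths Xs (- I)) q else 0)"
          by (intro sum.cong refl) (auto simp: arity_part_def)
        also have "\<dots> = \<omega> (nths Xs I) q * op_part A E p Q \<eta> (nths Xs (- I)) q"
        proof (cases "length (nths Xs I) \<le> M")
          case True
          then have "M - length (nths Xs I) = length (nths Xs (- I)) - p" "p \<le> length (nths Xs (- I))"
            using len[of I] by linarith+
          then show ?thesis using True \<eta> by (simp add: op_part_def)
        next
          case False
          then have "\<not> p \<le> length (nths Xs (- I))" using len[of I] by linarith
          then show ?thesis using False by (simp add: op_part_def)
        qed
        finally show "?c I * (\<Sum>a\<le>M. arity_part a \<omega> (nths Xs I) q *
            Q (arity_part (M - a) \<eta>) (nths Xs (- I)) q) = subset_sign I Xs *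
            (pm (tdeg (nths Xs (- I)) * tdeg (nths Xs I)) * \<omega> (nths Xs I) q *
            op_part A E p Q \<eta> (nths Xs (- I)) q)"
          by (simp add: mult.assoc)
      qed
      finally show ?thesis .
    qed
  qed
qed (simp add: op_part_def)

subsection \<open>Iterated commutators\<close>

text \<open>The starting operator is a parameter so that inductions can absorb the first contraction
  into it.\<close>

abbreviation iter :: "int \<Rightarrow> ('m, 'v) operator \<Rightarrow> ('m, 'v) hsec list \<Rightarrow> int \<times> ('m, 'v) operator" where
  "iter m D Xs \<equiv> foldl gcomm (m, D) (map (\<lambda>X. (fst X, contraction A E X)) Xs)"

lemma iter_properties:
  assumes "set Xs \<subseteq> H" "derivation A E m D" "shifts_arity d D"
  shows "derivation A E (m + tdeg Xs) (snd (iter m D Xs)) \<and>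
    shifts_arity (d - int (length Xs)) (snd (iter m D Xs))"
  using assms
proof (induction Xs arbitrary: m D d)
  case (Cons X Xs)
  have X: "X \<in> H" and Xs: "set Xs \<subseteq> H" using Cons.prems by auto
  let ?G = "gcomm (m, D) (fst X, interior X)"
  have eq: "iter m D (X # Xs) = iter (m + fst X) (snd ?G) Xs"
    by (simp add: contraction_eq_interior[OF X] gcomm_def)
  have der: "derivation A E (m + fst X) (snd ?G)"
    by (rule derivation_gcomm[OF Cons.prems(2) derivation_interior[OF X]])
  have ar: "shifts_arity (d + - 1) (snd ?G)"
    by (rule shifts_arity_gcomm[OF Cons.prems(2) derivation_interior[OF X] Cons.prems(3)
          shifts_arity_interior])
  show ?case unfolding eq using Cons.IH[OF Xs der ar] by (simp add: algebra_simps)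
qed simp_all

text \<open>If \<open>D\<close> vanishes on functions, then only the summand \<open>\<plusminus> i\<^bsub>X\<^sub>r\<^esub> \<dots> i\<^bsub>X\<^sub>1\<^esub> D\<close> of the iterated
  commutator contributes on covectors.\<close>

lemma iter_covector:
  assumes "set Xs \<subseteq> H" "derivation A E m D" "\<And>f. f \<in> C \<Longrightarrow> D (fun_form f) = (\<lambda>_ _. 0)"
    and \<omega>: "\<omega> \<in> covectors A E k"
  shows "snd (iter m D Xs) \<omega> [] p = (-1) ^ length Xs * pm ((m + 1) * tdeg Xs) * D \<omega> Xs p"
  using assms(1-3)
proof (induction Xs arbitrary: m D)
  case (Cons X Xs)
  have X: "X \<in> H" and Xs: "set Xs \<subseteq> H" using Cons.prems by auto
  have \<omega>S: "\<omega> \<in> S" using covectorsD(2)[OF \<omega>] .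
  let ?G = "gcomm (m, D) (fst X, interior X)"
  have eq: "iter m D (X # Xs) = iter (m + fst X) (snd ?G) Xs"
    by (simp add: contraction_eq_interior[OF X] gcomm_def)
  have der: "derivation A E (m + fst X) (snd ?G)"
    by (rule derivation_gcomm[OF Cons.prems(2) derivation_interior[OF X]])
  have 0: "snd ?G (fun_form f) = (\<lambda>_ _. 0)" if "f \<in> C" for f
    using that Cons.prems(3)[OF that] derivation_0[OF Cons.prems(2)]
      derivation_0[OF derivation_interior[OF X]]
    by (simp add: gcomm_def interior_fun_form)
  have "(\<lambda>p. pm (fst X) * \<omega> [X] p) \<in> C"
    by (intro Cinf_mult Cinf_const symalg_Cinf \<omega>S)
  \<comment> \<open>The contraction of a covector is a function, so one of the two summands of the
    commutator vanishes.\<close>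
  then have "D (interior X \<omega>) = (\<lambda>_ _. 0)"
    by (simp add: interior_covector[OF \<omega>] Cons.prems(3))
  then have "snd ?G \<omega> Xs p = - (pm (m * fst X) * (pm (fst X * (fst X + tdeg Xs)) * D \<omega> (X # Xs) p))"
    using derivationD(2)[OF Cons.prems(2) \<omega>S] by (simp add: gcomm_def interior_def)
  \<comment> \<open>The signs of the first commutator and of the induction hypothesis combine to the
    claimed one, which is trivial for \<open>m = 1\<close>.\<close>
  moreover have "pm ((m + x + 1) * t) * (pm (m * x) * (pm (x * (x + t)) * w)) =
      pm ((m + 1) * (x + t)) * w" for x t w
    by (auto simp: pm_def)
  moreover have "snd (iter (m + fst X) (snd ?G) Xs) \<omega> [] p =
      (-1) ^ length Xs * pm ((m + fst X + 1) * tdeg Xs) * snd ?G \<omega> Xs p"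
    by (rule Cons.IH[OF Xs der]) (rule 0)
  ultimately show ?case
    unfolding eq by (simp add: mult.assoc)
qed simp

text \<open>With \<open>r\<close> contractions the arity shift \<open>r - 1\<close> becomes -1, so
  the iterated commutator kills functions and turns covectors into functions. Being a derivation, it
  is determined by these, and for degree reasons only covectors dual to the degree of
  \<open>Y\<close> matter.\<close>

lemma derived_bracket_eqI:
  assumes Xs: "set Xs \<subseteq> H" "length Xs = r" "r \<ge> 1" and Q: "derivation A E 1 Q"
    and Y: "Y \<in> H" "fst Y = 1 + tdeg Xs"
    and val: "\<And>k \<omega> p. \<lbrakk>\<omega> \<in> covectors A E k; k = - fst Y\<rbrakk> \<Longrightarrow>
      snd (iter 1 (op_part A E (r - 1) Q) Xs) \<omega> [] p = pm (fst Y) * \<omega> [Y] p"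
  shows "derived_bracket A E Q r Xs = Y"
proof -
  let ?R = "snd (iter 1 (op_part A E (r - 1) Q) Xs)"
  have der: "derivation A E (fst Y) ?R" and ar: "shifts_arity (- 1) ?R"
    using iter_properties[OF Xs(1) derivation_op_part[OF Q] shifts_arity_op_part[OF Q], of "r - 1"]
      Xs(2,3) Y(2) by (simp_all add: of_nat_diff)
  have contr: "contraction A E Y = ?R"
  proof (rule contraction_eqI[OF Y(1) der])
    fix f assume f: "f \<in> C"
    have "pure_arity 0 (fun_form f :: ('m, 'v) form)" by (simp add: pure_arity_def fun_form_def)
    then have "pure_arity (0 + - 1) (?R (fun_form f))"
      using ar symalg_fun_form[OF f] unfolding shifts_arity_def by blast
    then show "?R (fun_form f) = (\<lambda>_ _. 0)" by (auto simp: pure_arity_def)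
  next
    fix k \<omega> assume \<omega>: "\<omega> \<in> covectors A E k"
    have "pure_arity 1 \<omega>" using covectorsD(3)[OF \<omega>] by (simp add: pure_arity_def)
    then have "pure_arity (1 + - 1) (?R \<omega>)"
      using ar covectorsD(2)[OF \<omega>] unfolding shifts_arity_def by blast
    then have 1: "?R \<omega> = fun_form (?R \<omega> [])"
      by (intro ext) (auto simp: pure_arity_def fun_form_def)
    have "?R \<omega> [] p = pm (fst Y) * \<omega> [Y] p" for p
    proof (cases "k = - fst Y")
      case True
      then show ?thesis by (rule val[OF \<omega>])
    next
      case False
      then have "?R \<omega> [] = (\<lambda>_. 0)"
        using symalg_degD(2)[OF derivationD(3)[OF der covectorsD(1)[OF \<omega>]], of "[]"] by simp
      then show ?thesis using covectorsD(4)[OF \<omega>, of Y] False by simp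
    qed
    then have 2: "?R \<omega> [] = (\<lambda>p. pm (fst Y) * \<omega> [Y] p)" by (rule ext)
    show "?R \<omega> = fun_form (\<lambda>p. pm (fst Y) * \<omega> [Y] p)" using 1 unfolding 2 .
  qed
  show ?thesis
    unfolding derived_bracket_def iterated_commutator_def
  proof (rule the_equality)
    show "Y \<in> H \<and> fst Y = 1 + tdeg Xs \<and> contraction A E Y = ?R"
      using Y contr by blast
  next
    fix Z assume "Z \<in> H \<and> fst Z = 1 + tdeg Xs \<and> contraction A E Z = ?R"
    then show "Z = Y" using contraction_inj[OF _ Y(1)] Y(2) contr by simp
  qed
qed

text \<open>Arguments with a nonzero section have degree at most -1, so total degree -1 leaves room
  for exactly one.\<close>

lemma symalg_deg_1_arity:
  assumes "\<omega> \<in> symalg_deg A E 1" "length Xs \<noteq> 1"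
  shows "\<omega> Xs p = 0"
proof (rule ccontr)
  assume nz: "\<omega> Xs p \<noteq> 0"
  then have H: "set Xs \<subseteq> H" and d: "tdeg Xs = -1"
    using symalg_outside[OF symalg_degD(1)[OF assms(1)]] symalg_degD(2)[OF assms(1)] by fastforce+
  have neg: "fst X \<le> - 1" if "X \<in> set Xs" for X
    using hsec_outside[of X] symalg_zero_mem[OF symalg_degD(1)[OF assms(1)] that] nz H that by fastforce
  have "tdeg Ys \<le> - int (length Ys)" if "set Ys \<subseteq> set Xs" for Ys
    using that neg by (induction Ys) fastforce+
  then have "length Xs \<le> 1" using d by force
  then show False using assms(2) d by (cases Xs) auto
qed

text \<open>A function has degree 0, so its image under \<open>Q\<close> has degree 1 and hence
  arity one.\<close>

lemma op_part_fun_form: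
  assumes Q: "derivation A E 1 Q" "f \<in> C"
  shows "p \<noteq> 1 \<Longrightarrow> op_part A E p Q (fun_form f) = (\<lambda>_ _. 0)"
    "op_part A E 1 Q (fun_form f) [X] = Q (fun_form f) [X]"
proof -
  have ar: "arity_part r (fun_form f) = (if r = 0 then fun_form f else (\<lambda>_ _. 0))" for r
    by (auto simp: arity_part_def fun_form_def fun_eq_iff)
  have "Q (fun_form f) \<in> symalg_deg A E 1"
    using derivationD(3)[OF Q(1) fun_form_deg[OF Q(2)]] by simp
  then show "p \<noteq> 1 \<Longrightarrow> op_part A E p Q (fun_form f) = (\<lambda>_ _. 0)"
    by (auto simp: op_part_def ar derivation_0[OF Q(1)] symalg_deg_1_arity fun_eq_iff)
  show "op_part A E 1 Q (fun_form f) [X] = Q (fun_form f) [X]"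
    by (simp add: op_part_def ar symalg_fun_form Q(2))
qed

lemma op_part_covector:
  assumes "\<omega> \<in> covectors A E k" "length Xs = p + 1"
  shows "op_part A E p Q \<omega> Xs = Q \<omega> Xs"
  using assms covectorsD(2)[OF assms(1)] by (simp add: op_part_def covectors_def)

text \<open>This covers the degrees for which \<open>homological_vector_field\<close> prescribes no
  formula on covectors.\<close>

lemma covector_outside:
  assumes "\<omega> \<in> covectors A E k" "k \<notin> {1..int n}"
  shows "\<omega> = (\<lambda>_ _. 0)"
proof (intro ext)
  fix Xs p
  show "\<omega> Xs p = 0"
  proof (cases "length Xs = 1 \<and> set Xs \<subseteq> H \<and> fst (hd Xs) = - k")
    case True
    then obtain X where X: "Xs = [X]" "X \<in> H" "fst X = - k" by (cases Xs) auto
    then have "snd X = (\<lambda>_. 0)" using assms(2) by (intro hsec_outside) auto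
    then show ?thesis using symalg_zero_arg[OF covectorsD(2)[OF assms(1)]] X by simp
  next
    case False
    then consider "length Xs \<noteq> 1" | "\<not> set Xs \<subseteq> H" | X where "Xs = [X]" "fst X \<noteq> - k"
      by (cases Xs) auto
    then show ?thesis
      by cases (simp_all add: covectorsD(3,4)[OF assms(1)] symalg_outside[OF covectorsD(2)[OF assms(1)]])
  qed
qed

lemma covector_gscale:
  assumes "\<omega> \<in> covectors A E k" "Z \<in> H"
  shows "\<omega> [gscale (\<lambda>_. c) Z] p = c * \<omega> [Z] p"
proof -
  have "gadd (gscale (\<lambda>_. c) Z) (gscale (\<lambda>_. 0) Z) = gscale (\<lambda>_. c) Z"
    by (simp add: gadd_def gscale_def)
  then show ?thesis
    using symalg_lin[OF covectorsD(2)[OF assms(1)] Cinf_const[of c] Cinf_const[of 0], of "[]" Z Z "[]" p]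
      assms(2) by simp
qed

end

section \<open>Split Lie n-algebroids\<close>

lemma neg_one_power_eq_pm: "(- 1 :: real) ^ k = pm (int k)"
  by (simp add: pm_def)

lemma sum_triangle: "(\<Sum>j<r. int r - int (j + 1)) = int (r * (r - 1) div 2)"
proof -
  have "2 * (\<Sum>j<r. int r - int (j + 1)) = int (r * (r - 1))"
  proof (induction r)
    case (Suc r)
    have "(\<Sum>j<Suc r. int (Suc r) - int (j + 1)) = (\<Sum>j<r. int r - int (j + 1)) + int r"
    proof -
      have "(\<Sum>j<Suc r. int (Suc r) - int (j + 1)) = (\<Sum>j<r. (int r - int (j + 1)) + 1)"
        by (simp add: algebra_simps)
      then show ?thesis unfolding sum.distrib by simp
    qed
    then show ?case using Suc by (cases r) (simp_all add: algebra_simps)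
  qed simp
  then show ?thesis by (simp add: zdiv_int)
qed

text \<open>Desuspension lowers every degree by one and so changes the exponent by the sum of its
  weights.\<close>

lemma shift_sign_desusp:
  "shift_sign Xs * shift_sign (map desusp Xs) = (- 1) ^ (length Xs * (length Xs - 1) div 2)"
proof -
  let ?r = "length Xs"
  have "(\<Sum>j<?r. (int ?r - int (j + 1)) * fst (map desusp Xs ! j)) =
      (\<Sum>j<?r. (int ?r - int (j + 1)) * fst (Xs ! j)) - (\<Sum>j<?r. int ?r - int (j + 1))"
    unfolding sum_subtractf[symmetric] by (intro sum.cong refl) (simp add: desusp_def algebra_simps)
  moreover have "pm a * pm (a - b) = pm b" for a b by (auto simp: pm_def)
  ultimately show ?thesis
    unfolding shift_sign_def minus_one_powi length_map neg_one_power_eq_pm sum_triangle[symmetric]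
    by simp
qed

lemma gscale_gscale [simp]: "gscale f (gscale g X) = gscale (\<lambda>p. f p * g p) X"
  and gscale_1 [simp]: "gscale (\<lambda>_. 1) X = X"
  and susp_gscale: "susp (gscale f X) = gscale f (susp X)" "desusp (gscale f X) = gscale f (desusp X)"
  by (simp_all add: gscale_def susp_def desusp_def)

lemma susp_desusp [simp]: "susp (desusp X) = X" "desusp (susp X) = X"
  by (simp_all add: susp_def desusp_def)

lemma map_susp_desusp [simp]: "map susp (map desusp Xs) = Xs"
  by (simp add: comp_def)

lemma tdeg_map_susp: "tdeg (map susp Xs) = tdeg Xs + int (length Xs)"
  "tdeg (map desusp Xs) = tdeg Xs - int (length Xs)"
  by (induction Xs) (simp_all add: susp_def desusp_def)

lemma hsections_susp: "X \<in> hsections A E \<Longrightarrow> susp X \<in> hsections A (shift E)"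
  "X \<in> hsections A (shift E) \<Longrightarrow> desusp X \<in> hsections A E"
  by (simp_all add: hsections_def susp_def desusp_def shift_def)

lemma hlists_susp: "Xs \<in> hlists A E r \<Longrightarrow> map susp Xs \<in> hlists A (shift E) r"
  "Xs \<in> hlists A (shift E) r \<Longrightarrow> map desusp Xs \<in> hlists A E r"
  by (auto simp: hlists_def dest!: subsetD intro: hsections_susp)

lemma card_Sh: "card (Sh i j) = (i + j) choose i"
proof -
  have "card (Sh i j) = card {I. I \<subseteq> {..<i + j} \<and> card I = i}"
    by (rule bij_betw_same_card[OF bij_betw_Sh])
  then show ?thesis using n_subsets[of "{..<i + j}" i] by simp
qed

lemma Sh_full: "Sh i 0 = {id}"
proof -
  have "id \<in> Sh i 0" by (simp add: Sh_def permutes_id strict_mono_on_def)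
  moreover obtain \<sigma> where "Sh i 0 = {\<sigma>}"
    using card_Sh[of i 0] by (auto simp: card_1_singleton_iff)
  ultimately show ?thesis by simp
qed

lemma Sh_2_1_distinct: "id \<noteq> Transposition.transpose 1 (2::nat)" "id \<noteq> Transposition.transpose 0 1 \<circ> Transposition.transpose 1 (2::nat)"
  "Transposition.transpose 1 2 \<noteq> Transposition.transpose 0 1 \<circ> Transposition.transpose 1 (2::nat)"
  by (auto simp: fun_eq_iff Transposition.transpose_def intro: exI[of _ 1] exI[of _ 0])

text \<open>Three shuffles are exhibited, and the count of subsets shows that there are no
  more.\<close>

lemma Sh_2_1: "Sh 2 1 = {id, Transposition.transpose 1 2, Transposition.transpose 0 1 \<circ> Transposition.transpose 1 2}" (is "_ = ?R")
proof -
  have "?R \<subseteq> Sh 2 1"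
  proof -
    have "Transposition.transpose a b permutes {..<2 + 1}" if "a < 3" "b < 3" for a b :: nat
      by (rule permutes_swap_id) (use that in auto)
    then have "\<sigma> permutes {..<2 + 1}" if "\<sigma> \<in> ?R" for \<sigma>
      using that by (auto intro: permutes_id permutes_compose)
    moreover have "strict_mono_on {..<2} \<sigma>" "strict_mono_on {2..<2 + 1} \<sigma>" if "\<sigma> \<in> ?R" for \<sigma>
      using that by (auto simp: strict_mono_on_def transpose_def less_2_cases_iff)
    ultimately show ?thesis by (auto simp: Sh_def)
  qed
  moreover have "card (Sh 2 1) = 3" by (simp add: card_Sh numeral_eq_Suc)
  moreover have "card ?R = 3"
    using Sh_2_1_distinct by (simp del: One_nat_def)
  moreover have "finite (Sh 2 1)"
    by (rule card_ge_0_finite) (use \<open>card (Sh 2 1) = 3\<close> in simp)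
  ultimately show ?thesis
    using card_subset_eq[of "Sh 2 1" ?R] by simp
qed

lemma subset_sign_degree_0: "(\<And>X. X \<in> set Xs \<Longrightarrow> fst X = 0) \<Longrightarrow> subset_sign I Xs = 1"
  unfolding subset_sign_def by (intro prod.neutral ballI) auto

locale split_algebroid = graded_mfd_bundle A E n
  for A :: "('m::{t2_space,second_countable_topology}, 'e::real_normed_vector) atlas"
    and E :: "('m, 'v::real_vector) gbundle" and n :: nat +
  fixes l :: "nat \<Rightarrow> ('m, 'v) bracket" and \<rho> :: "('m, 'v) anchor"
  assumes algebroid: "split_lie_algebroid A n (shift E) l \<rho>"
begin

abbreviation "L \<equiv> shift E"
abbreviation "HL \<equiv> hsections A L"

lemma algebroidD:
  "anchor_map A (L 0) \<rho>"
  "\<And>r xs. xs \<in> hlists A L r \<Longrightarrow> l r xs \<in> HL \<and> fst (l r xs) = 2 - int r + tdeg xs"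
  "\<And>r. multilinear_over (range (\<lambda>a _. a)) A L r (l r)"
  "\<And>r. graded_antisymmetric A L r (l r)"
  "\<And>r xs p. \<lbrakk>r \<ge> 1; xs \<in> hlists A L r\<rbrakk> \<Longrightarrow>
    (\<Sum>i=1..r. let j = r + 1 - i in \<Sum>\<sigma>\<in>Sh i (j - 1). let ys = permute_list \<sigma> xs in
      ((-1) ^ (i * (j - 1)) * real_of_int (sign \<sigma>) * koszul \<sigma> xs) *\<^sub>R
        snd (l j (l i (take i ys) # drop i ys)) p) = 0"
  "\<And>r. r \<noteq> 2 \<Longrightarrow> multilinear_over C A L r (l r)"
  "\<And>x y f. \<lbrakk>x \<in> HL; y \<in> HL; f \<in> C; fst x = 0\<rbrakk> \<Longrightarrow> l 2 [x, gscale f y] =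
    gadd (gscale f (l 2 [x, y])) (gscale (\<lambda>p. \<rho> p (snd x p) f) y)"
proof -
  note conj = algebroid[unfolded split_lie_algebroid_def]
  show "anchor_map A (L 0) \<rho>" using conj by (elim conjE)
  have 2: "\<forall>r. \<forall>xs\<in>hlists A L r. l r xs \<in> HL \<and> fst (l r xs) = 2 - int r + tdeg xs"
    using conj by (elim conjE)
  show "l r xs \<in> HL \<and> fst (l r xs) = 2 - int r + tdeg xs" if "xs \<in> hlists A L r" for r xs
    using 2[rule_format, OF that] .
  have 3: "\<forall>r. multilinear_over (range (\<lambda>a _. a)) A L r (l r)" using conj by (elim conjE)
  show "multilinear_over (range (\<lambda>a _. a)) A L r (l r)" for r using 3 by (rule spec)
  have 4: "\<forall>r. graded_antisymmetric A L r (l r)" using conj by (elim conjE)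
  show "graded_antisymmetric A L r (l r)" for r using 4 by (rule spec)
  have 5: "\<forall>r\<ge>1. \<forall>xs\<in>hlists A L r. \<forall>p.
    (\<Sum>i=1..r. let j = r + 1 - i in \<Sum>\<sigma>\<in>Sh i (j - 1). let ys = permute_list \<sigma> xs in
      ((-1) ^ (i * (j - 1)) * real_of_int (sign \<sigma>) * koszul \<sigma> xs) *\<^sub>R
        snd (l j (l i (take i ys) # drop i ys)) p) = 0"
    using conj by (elim conjE)
  show "(\<Sum>i=1..r. let j = r + 1 - i in \<Sum>\<sigma>\<in>Sh i (j - 1). let ys = permute_list \<sigma> xs in
      ((-1) ^ (i * (j - 1)) * real_of_int (sign \<sigma>) * koszul \<sigma> xs) *\<^sub>R
        snd (l j (l i (take i ys) # drop i ys)) p) = 0"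
    if "r \<ge> 1" "xs \<in> hlists A L r" for r xs p
    using 5[rule_format, OF that] .
  have 6: "\<forall>r. r \<noteq> 2 \<longrightarrow> multilinear_over C A L r (l r)" using conj by (elim conjE)
  show "multilinear_over C A L r (l r)" if "r \<noteq> 2" for r using 6[rule_format, OF that] .
  have 7: "\<forall>x\<in>HL. \<forall>y\<in>HL. \<forall>f\<in>C. fst x = 0 \<longrightarrow> l 2 [x, gscale f y] =
      gadd (gscale f (l 2 [x, y])) (gscale (\<lambda>p. \<rho> p (snd x p) f) y)"
    using conj by (elim conjE)
  show "l 2 [x, gscale f y] = gadd (gscale f (l 2 [x, y])) (gscale (\<lambda>p. \<rho> p (snd x p) f) y)"
    if "x \<in> HL" "y \<in> HL" "f \<in> C" "fst x = 0" for x y f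
    using 7[rule_format, OF that] .
qed

lemma bracket_HL: "xs \<in> hlists A L r \<Longrightarrow> l r xs \<in> HL"
  and fst_bracket: "xs \<in> hlists A L r \<Longrightarrow> fst (l r xs) = 2 - int r + tdeg xs"
  using algebroidD(2) by blast+

lemma HL_iff: "x \<in> HL \<longleftrightarrow> desusp x \<in> H"
  using hsections_susp[of "desusp x"] hsections_susp(2)[of x] by auto

lemma HL_gscale: "x \<in> HL \<Longrightarrow> f \<in> C \<Longrightarrow> gscale f x \<in> HL"
  by (simp add: HL_iff susp_gscale hsec_gscale)

lemma anchor_tangent: "v \<in> fibre (L 0) p \<Longrightarrow> \<rho> p v \<in> tangent_space A p"
  using algebroidD(1) by (simp add: anchor_map_def)

lemma anchor_0: "\<rho> p 0 f = 0"
proof -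
  have z: "0 \<in> fibre (L 0) p" unfolding shift_def by (rule subspace_0[OF component.subspace_fibre])
  have "\<rho> p (0 *\<^sub>R 0 + 0 *\<^sub>R 0) f = 0 * \<rho> p 0 f + 0 * \<rho> p 0 f"
    using algebroidD(1) z unfolding anchor_map_def by blast
  then show ?thesis by simp
qed

lemma anchor_nonsmooth: "v \<in> fibre (L 0) p \<Longrightarrow> f \<notin> C \<Longrightarrow> \<rho> p v f = 0"
  using anchor_tangent by (simp add: tangent_space_def)

lemma anchor_scale: "v \<in> fibre (L 0) p \<Longrightarrow> f \<in> C \<Longrightarrow> \<rho> p v (\<lambda>q. c * f q) = c * \<rho> p v f"
proof -
  assume v: "v \<in> fibre (L 0) p" and f: "f \<in> C"
  have "\<rho> p v (\<lambda>q. c * f q + 0 * f q) = c * \<rho> p v f + 0 * \<rho> p v f"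
    using anchor_tangent[OF v] f unfolding tangent_space_def by blast
  then show ?thesis by simp
qed

lemma anchor_fun_0: "v \<in> fibre (L 0) p \<Longrightarrow> \<rho> p v (\<lambda>_. 0) = 0"
  using anchor_scale[of v p "\<lambda>_. 0" 0] by (simp add: Cinf_const)

lemma HL_fibre: "x \<in> HL \<Longrightarrow> fst x = 0 \<Longrightarrow> snd x p \<in> fibre (L 0) p"
  using component.section_fibre[of "snd x" "- 1"] by (simp add: hsections_def shift_def)

lemma anchor_Cinf:
  assumes "x \<in> HL" "fst x = 0" "f \<in> C"
  shows "(\<lambda>p. \<rho> p (snd x p) f) \<in> C"
proof -
  have "snd x \<in> sections A (L 0)" using assms(1,2) by (simp add: hsections_def)
  then have "(\<lambda>p. \<rho> p (snd x p)) \<in> vector_fields A"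
    using algebroidD(1) unfolding anchor_map_def by blast
  then show ?thesis using assms(3) unfolding vector_fields_def by blast
qed

subsection \<open>The anchor is a morphism of brackets\<close>

lemma gadd_gscale_0: "gadd (gscale f X) (gscale (\<lambda>_. 0) X) = gscale f X"
  by (simp add: gadd_def gscale_def)

lemma bracket_gscale:
  assumes "multilinear_over F A L r (l r)" "f \<in> F" "(\<lambda>_. 0) \<in> F" "us @ X # vs \<in> hlists A L r"
  shows "l r (us @ gscale f X # vs) = gscale f (l r (us @ X # vs))"
proof -
  have "X \<in> HL" using assms(4) by (simp add: hlists_def)
  then have "l r (us @ gadd (gscale f X) (gscale (\<lambda>_. 0) X) # vs) =
      gadd (gscale f (l r (us @ X # vs))) (gscale (\<lambda>_. 0) (l r (us @ X # vs)))"
    using assms unfolding multilinear_over_def by blast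
  then show ?thesis by (simp add: gadd_gscale_0)
qed

lemma bracket_zero_arg:
  assumes "X # vs \<in> hlists A L r" "snd X = (\<lambda>_. 0)"
  shows "snd (l r (X # vs)) p = 0"
proof -
  have "gscale (\<lambda>_. 0) X = X" using assms(2) by (simp add: gscale_def prod_eq_iff)
  then have "l r (X # vs) = gscale (\<lambda>_. 0) (l r (X # vs))"
    using bracket_gscale[OF algebroidD(3), of "\<lambda>_. 0" "[]" X vs r] assms(1) by simp
  then have "snd (l r (X # vs)) p = snd (gscale (\<lambda>_. 0) (l r (X # vs))) p" by simp
  then show ?thesis by (simp add: snd_gscale)
qed

lemma bracket_antisym:
  assumes "x \<in> HL" "y \<in> HL" "fst x = 0"
  shows "snd (l 2 [x, y]) p = - snd (l 2 [y, x]) p"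
proof -
  have "[] @ x # y # [] \<in> hlists A L 2" using assms by (simp add: hlists_def)
  then have "l 2 ([] @ x # y # []) = gscale (\<lambda>_. - ((-1) powi (fst x * fst y))) (l 2 ([] @ y # x # []))"
    using algebroidD(4)[of 2] unfolding graded_antisymmetric_def by blast
  then show ?thesis using assms(3) by (simp add: snd_gscale)
qed

text \<open>In degree 0 all Koszul signs are 1. Terms starting with \<open>l 1\<close> vanish, since
  it lands in degree 1 where the bundle is zero. The term with \<open>l 3\<close> remains and is
  removed later by linearity over functions.\<close>

lemma jacobi_degree_0:
  assumes "x \<in> HL" "y \<in> HL" "z \<in> HL" "fst x = 0" "fst y = 0" "fst z = 0"
  shows "snd (l 2 [l 2 [x, y], z]) p - snd (l 2 [l 2 [x, z], y]) p + snd (l 2 [l 2 [y, z], x]) p +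
    snd (l 1 [l 3 [x, y, z]]) p = 0"
proof -
  let ?xs = "[x, y, z]"
  define T where "T = (\<lambda>i. let j = 3 + 1 - i in \<Sum>\<sigma>\<in>Sh i (j - 1). let ys = permute_list \<sigma> ?xs in
      ((-1) ^ (i * (j - 1)) * real_of_int (sign \<sigma>) * koszul \<sigma> ?xs) *\<^sub>R
        snd (l j (l i (take i ys) # drop i ys)) p)"
  have xs: "?xs \<in> hlists A L 3" using assms by (simp add: hlists_def)
  have "sum T {1..3} = 0"
    unfolding T_def using algebroidD(5)[OF _ xs, of p] by simp
  moreover have "{1..3} = {1, 2, 3::nat}" by auto
  ultimately have sum: "T 1 + T 2 + T 3 = 0" by (simp add: add.assoc)
  have kos: "koszul \<sigma> ?xs = 1" if "\<sigma> \<in> Sh i j" "i + j = 3" for \<sigma> i j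
  proof -
    have "koszul \<sigma> ?xs = subset_sign (\<sigma> ` {..<i}) ?xs"
      by (rule koszul_Sh[OF that(1)]) (use that(2) in simp)
    also have "\<dots> = 1"
      by (rule subset_sign_degree_0) (use assms in auto)
    finally show ?thesis .
  qed
  have perm: "permute_list \<sigma> ?xs = [?xs ! \<sigma> 0, ?xs ! \<sigma> 1, ?xs ! \<sigma> 2]" for \<sigma>
    by (simp add: permute_list_def upt_rec numeral_2_eq_2)
  have "T 1 = 0"
    unfolding T_def Let_def
  proof (rule sum.neutral, rule ballI)
    fix \<sigma> assume "\<sigma> \<in> Sh 1 (3 + 1 - 1 - 1)"
    then have "\<sigma> permutes {..<length ?xs}" by (simp add: Sh_def numeral_eq_Suc)
    from set_permute_list[OF this] obtain a b c where abc: "permute_list \<sigma> ?xs = [a, b, c]"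
      "a \<in> set ?xs" "b \<in> set ?xs" "c \<in> set ?xs"
      unfolding perm by (metis list.set_intros)
    then have H: "a \<in> HL" "b \<in> HL" "c \<in> HL" "fst a = 0" using assms by auto
    then have "[a] \<in> hlists A L 1" by (simp add: hlists_def)
    then have l1: "l 1 [a] \<in> HL" "fst (l 1 [a]) = 1"
      using algebroidD(2)[of "[a]" 1] H(4) by auto
    then have "snd (desusp (l 1 [a])) = (\<lambda>_. 0)"
      by (intro hsec_outside) (simp_all add: HL_iff desusp_def)
    then have "snd (l 3 (l 1 [a] # [b, c])) p = 0"
      using l1 H by (intro bracket_zero_arg) (simp_all add: hlists_def desusp_def)
    then show "((- 1) ^ (1 * (3 + 1 - 1 - 1)) * real_of_int (sign \<sigma>) * koszul \<sigma> ?xs) *\<^sub>R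
        snd (l (3 + 1 - 1) (l 1 (take 1 (permute_list \<sigma> ?xs)) # drop 1 (permute_list \<sigma> ?xs))) p = 0"
      unfolding abc(1) by simp
  qed
  moreover have "T 2 = snd (l 2 [l 2 [x, y], z]) p - snd (l 2 [l 2 [x, z], y]) p +
      snd (l 2 [l 2 [y, z], x]) p"
  proof -
    have sg: "sign (Transposition.transpose 1 (2::nat)) = - 1" "sign (Transposition.transpose 0 1 \<circ> Transposition.transpose 1 (2::nat)) = 1"
      by (simp_all add: sign_swap_id sign_compose permutation_swap_id)
    have "T 2 = (\<Sum>\<sigma>\<in>Sh 2 1. real_of_int (sign \<sigma>) *\<^sub>R
        snd (l 2 (l 2 [?xs ! \<sigma> 0, ?xs ! \<sigma> 1] # [?xs ! \<sigma> 2])) p)"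
      unfolding T_def Let_def perm by (intro sum.cong) (simp_all add: kos numeral_eq_Suc)
    then show ?thesis
      unfolding Sh_2_1 using Sh_2_1_distinct sg
      by (simp add: sign_id Transposition.transpose_def del: One_nat_def)
  qed
  moreover have "T 3 = snd (l 1 [l 3 [x, y, z]]) p"
    using kos[of id 3 0] by (simp add: T_def Let_def Sh_full sign_id)
  ultimately show ?thesis using sum by simp
qed

text \<open>The Leibniz rule is stated for the second argument, hence the outer bracket is first
  turned by antisymmetry.\<close>

lemma bracket_leibniz_twice:
  assumes "x \<in> HL" "y \<in> HL" "z \<in> HL" "fst x = 0" "fst y = 0" "fst z = 0" "f \<in> C"
  shows "snd (l 2 [l 2 [x, gscale f z], y]) p =
    - (f p *\<^sub>R snd (l 2 [y, l 2 [x, z]]) p + \<rho> p (snd y p) f *\<^sub>R snd (l 2 [x, z]) p +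
      \<rho> p (snd x p) f *\<^sub>R snd (l 2 [y, z]) p +
      \<rho> p (snd y p) (\<lambda>q. \<rho> q (snd x q) f) *\<^sub>R snd z p)"
proof -
  let ?g = "\<lambda>p. \<rho> p (snd x p) f"
  have g: "?g \<in> C" using anchor_Cinf assms by blast
  have xz: "[x, z] \<in> hlists A L 2" using assms by (simp add: hlists_def)
  have w: "l 2 [x, z] \<in> HL" "fst (l 2 [x, z]) = 0"
    using bracket_HL[OF xz] fst_bracket[OF xz] assms by simp_all
  have xfz: "[x, gscale f z] \<in> hlists A L 2" using assms by (simp add: hlists_def HL_gscale)
  have eq: "l 2 [x, gscale f z] = gadd (gscale f (l 2 [x, z])) (gscale ?g z)"
    using algebroidD(7) assms by blast
  have "snd (l 2 [l 2 [x, gscale f z], y]) p = - snd (l 2 [y, l 2 [x, gscale f z]]) p"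
    using bracket_antisym[OF bracket_HL[OF xfz] assms(2)] fst_bracket[OF xfz] assms by simp
  also have "l 2 [y, l 2 [x, gscale f z]] =
      gadd (l 2 [y, gscale f (l 2 [x, z])]) (l 2 [y, gscale ?g z])"
  proof -
    have a: "[y] @ gscale f (l 2 [x, z]) # [] \<in> hlists A L 2 \<and> gscale ?g z \<in> HL \<and>
        fst (gscale f (l 2 [x, z])) = fst (gscale ?g z)"
      using assms w g by (simp add: hlists_def HL_gscale)
    have c: "(\<lambda>_. 1) \<in> range (\<lambda>(a :: real) (_ :: 'm). a)" by blast
    have "l 2 ([y] @ gadd (gscale (\<lambda>_. 1) (gscale f (l 2 [x, z]))) (gscale (\<lambda>_. 1) (gscale ?g z)) # []) =
        gadd (gscale (\<lambda>_. 1) (l 2 ([y] @ gscale f (l 2 [x, z]) # [])))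
          (gscale (\<lambda>_. 1) (l 2 ([y] @ gscale ?g z # [])))"
      using algebroidD(3)[of 2] a c unfolding multilinear_over_def by blast
    then show ?thesis unfolding eq by simp
  qed
  also have "l 2 [y, gscale f (l 2 [x, z])] = gadd (gscale f (l 2 [y, l 2 [x, z]]))
      (gscale (\<lambda>p. \<rho> p (snd y p) f) (l 2 [x, z]))"
    using algebroidD(7) assms w by blast
  also have "l 2 [y, gscale ?g z] = gadd (gscale ?g (l 2 [y, z])) (gscale (\<lambda>p. \<rho> p (snd y p) ?g) z)"
    using algebroidD(7) assms g by blast
  finally show ?thesis by (simp add: snd_gadd snd_gscale)
qed

text \<open>In the difference of the two Jacobi identities the multiples of \<open>f p\<close>
  cancel, also in the term with \<open>l 3\<close> because \<open>l 1\<close> and \<open>l 3\<close>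
  are linear over functions. The first-order terms along \<open>l 2 [x, z]\<close> and
  \<open>l 2 [y, z]\<close> cancel in pairs.\<close>

lemma anchor_defect:
  assumes x: "x \<in> HL" "fst x = 0" and y: "y \<in> HL" "fst y = 0" and z: "z \<in> HL" "fst z = 0"
    and f: "f \<in> C"
  shows "(\<rho> p (snd (l 2 [x, y]) p) f -
    lie_bracket (\<lambda>p. \<rho> p (snd x p)) (\<lambda>p. \<rho> p (snd y p)) p f) *\<^sub>R snd z p = 0"
proof -
  have xy: "[x, y] \<in> hlists A L 2" using x y by (simp add: hlists_def)
  have u: "l 2 [x, y] \<in> HL" "fst (l 2 [x, y]) = 0"
    using bracket_HL[OF xy] fst_bracket[OF xy] x y by simp_all
  have xz: "[x, z] \<in> hlists A L 2" "[y, z] \<in> hlists A L 2" using x y z by (simp_all add: hlists_def)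
  have fz: "gscale f z \<in> HL" "fst (gscale f z) = 0" using z f by (simp_all add: HL_gscale)
  have C0: "(\<lambda>_. 0) \<in> C" by (rule Cinf_const)
  have xyz: "[x, y, z] \<in> hlists A L 3" using x y z by (simp add: hlists_def)
  have 3: "l 3 [x, y, gscale f z] = gscale f (l 3 [x, y, z])"
    using bracket_gscale[OF algebroidD(6) f C0, of 3 "[x, y]" z "[]"] xyz by simp
  have 1: "l 1 [gscale f (l 3 [x, y, z])] = gscale f (l 1 [l 3 [x, y, z]])"
    using bracket_gscale[OF algebroidD(6) f C0, of 1 "[]" "l 3 [x, y, z]" "[]"] bracket_HL[OF xyz]
    by (simp add: hlists_def)
  have 2: "l 2 [l 2 [x, y], gscale f z] = gadd (gscale f (l 2 [l 2 [x, y], z]))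
      (gscale (\<lambda>p. \<rho> p (snd (l 2 [x, y]) p) f) z)"
    using algebroidD(7) u z f by blast
  have J: "snd (l 2 [l 2 [x, y], z]) p + snd (l 2 [y, l 2 [x, z]]) p - snd (l 2 [x, l 2 [y, z]]) p +
      snd (l 1 [l 3 [x, y, z]]) p = 0"
    using jacobi_degree_0[OF x(1) y(1) z(1) x(2) y(2) z(2), of p]
      bracket_antisym[OF bracket_HL[OF xz(1)] y(1), of p]
      bracket_antisym[OF bracket_HL[OF xz(2)] x(1), of p]
      fst_bracket[OF xz(1)] fst_bracket[OF xz(2)] x y z by simp
  have "f p *\<^sub>R (snd (l 2 [l 2 [x, y], z]) p + snd (l 2 [y, l 2 [x, z]]) p -
      snd (l 2 [x, l 2 [y, z]]) p + snd (l 1 [l 3 [x, y, z]]) p) = 0"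
    unfolding J by simp
  moreover note jacobi_degree_0[OF x(1) y(1) fz(1) x(2) y(2) fz(2), of p]
  ultimately show ?thesis
    unfolding 1 2 3 bracket_leibniz_twice[OF x(1) y(1) z(1) x(2) y(2) z(2) f]
      bracket_leibniz_twice[OF y(1) x(1) z(1) y(2) x(2) z(2) f] lie_bracket_def
    by (simp add: snd_gadd snd_gscale algebra_simps)
qed

text \<open>Evaluating the defect on the sections \<open>x\<close>, \<open>y\<close> and \<open>\<ell>\<^sub>2(x, y)\<close> themselves suffices: if all
  three vanish at \<open>p\<close>, then so do both sides.\<close>

lemma anchor_bracket:
  assumes "X \<in> sections A (L 0)" "Y \<in> sections A (L 0)"
  shows "(\<lambda>p. \<rho> p (snd (l 2 [(0, X), (0, Y)]) p)) = lie_bracket (\<lambda>p. \<rho> p (X p)) (\<lambda>p. \<rho> p (Y p))"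
proof (intro ext)
  fix p f
  let ?x = "(0, X)" and ?y = "(0, Y)"
  have x: "?x \<in> HL" "fst ?x = 0" and y: "?y \<in> HL" "fst ?y = 0"
    using assms by (simp_all add: hsections_def)
  have xy: "[?x, ?y] \<in> hlists A L 2" using x y by (simp add: hlists_def)
  have u: "l 2 [?x, ?y] \<in> HL" "fst (l 2 [?x, ?y]) = 0"
    using bracket_HL[OF xy] fst_bracket[OF xy] by simp_all
  show "\<rho> p (snd (l 2 [?x, ?y]) p) f = lie_bracket (\<lambda>p. \<rho> p (X p)) (\<lambda>p. \<rho> p (Y p)) p f"
  proof (cases "f \<in> C")
    case True
    show ?thesis
    proof (rule ccontr)
      assume "\<rho> p (snd (l 2 [?x, ?y]) p) f \<noteq> lie_bracket (\<lambda>p. \<rho> p (X p)) (\<lambda>p. \<rho> p (Y p)) p f"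
      then have "X p = 0" "Y p = 0" "snd (l 2 [?x, ?y]) p = 0"
        using anchor_defect[OF x y x True, of p] anchor_defect[OF x y y True, of p]
          anchor_defect[OF x y u True, of p] by simp_all
      then show False
        using \<open>\<rho> p _ f \<noteq> _\<close> by (simp add: lie_bracket_def anchor_0)
    qed
  next
    case False
    have "\<rho> q (X q) f = 0" "\<rho> q (Y q) f = 0" for q
      using anchor_nonsmooth[OF _ False] HL_fibre[OF x] HL_fibre[OF y] by simp_all
    moreover have "\<rho> p (snd (l 2 [?x, ?y]) p) f = 0"
      by (rule anchor_nonsmooth[OF HL_fibre[OF u] False])
    moreover have "\<rho> p (X p) (\<lambda>_. 0) = 0" "\<rho> p (Y p) (\<lambda>_. 0) = 0"
      using anchor_fun_0 HL_fibre[OF x] HL_fibre[OF y] by simp_all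
    ultimately show ?thesis by (simp add: lie_bracket_def)
  qed
qed

subsection \<open>The derived brackets\<close>

lemma bracket'_H:
  assumes "Xs \<in> hlists A E r"
  shows "bracket' l r Xs \<in> H" "fst (bracket' l r Xs) = 1 + tdeg Xs"
proof -
  note Xs = hlists_susp(1)[OF assms]
  have "desusp (l r (map susp Xs)) \<in> H"
    using bracket_HL[OF Xs] by (simp add: HL_iff)
  then show "bracket' l r Xs \<in> H"
    by (simp add: bracket'_def multi_susp_def susp_gscale hsec_gscale Cinf_const)
  show "fst (bracket' l r Xs) = 1 + tdeg Xs"
    using fst_bracket[OF Xs] assms
    by (simp add: bracket'_def multi_susp_def susp_gscale tdeg_map_susp hlists_def)
      (simp add: desusp_def)
qed

lemma anchor'_scale:
  assumes "X \<in> H" "g \<in> C"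
  shows "anchor' \<rho> X (\<lambda>q. c * g q) p = c * anchor' \<rho> X g p"
  using HL_fibre[OF hsections_susp(1)[OF assms(1)], of p] anchor_scale[OF _ assms(2)]
  by (simp add: anchor'_def susp_def)

context
  fixes Q :: "('m, 'v) operator"
  assumes Q: "homological_vector_field A n E l \<rho> Q"
begin

lemma QD:
  "derivation A E 1 Q"
  "\<And>f X. \<lbrakk>f \<in> C; X \<in> H\<rbrakk> \<Longrightarrow> Q (fun_form f) [X] = (\<lambda>p. - anchor' \<rho> X f p)"
  "\<And>k \<omega> r Xs. \<lbrakk>k \<in> {1..int n}; \<omega> \<in> covectors A E k; r \<ge> 1; Xs \<in> hlists A E r; tdeg Xs = - (k + 1);
    r \<noteq> 2\<rbrakk> \<Longrightarrow> Q \<omega> Xs = (\<lambda>p. pm k * \<omega> [bracket' l r Xs] p)"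
  "\<And>k \<omega> X Y. \<lbrakk>k \<in> {1..int n}; \<omega> \<in> covectors A E k; X \<in> H; Y \<in> H; tdeg [X, Y] = - (k + 1)\<rbrakk> \<Longrightarrow>
    Q \<omega> [X, Y] = (\<lambda>p. pm k * \<omega> [bracket' l 2 [X, Y]] p - pm k * anchor' \<rho> X (\<omega> [Y]) p
      - pm (fst X * fst Y + k) * anchor' \<rho> Y (\<omega> [X]) p)"
  using Q unfolding homological_vector_field_def minus_one_powi by blast+

text \<open>For two arguments the operator need not vanish on functions. Of the four summands of the
  double commutator, the one contracting twice first is zero, the one applying the operator first
  gives \<open>Q\<close>, and the two mixed ones give the anchor terms.\<close>

lemma iter_2_covector:
  assumes X: "X \<in> H" and Y: "Y \<in> H" and \<omega>: "\<omega> \<in> covectors A E k"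
  shows "snd (iter 1 (op_part A E 1 Q) [X, Y]) \<omega> [] p = Q \<omega> [X, Y] p +
    pm k * anchor' \<rho> X (\<omega> [Y]) p + pm (fst X * fst Y + k) * anchor' \<rho> Y (\<omega> [X]) p"
proof -
  let ?D = "op_part A E 1 Q" and ?x = "fst X" and ?y = "fst Y"
  have \<omega>S: "\<omega> \<in> S" using covectorsD(2)[OF \<omega>] .
  have der: "derivation A E 1 ?D" by (rule derivation_op_part[OF QD(1)])
  have sgn: "(\<lambda>p. pm (fst Z) * \<omega> [Z] p) = (\<lambda>p. pm k * \<omega> [Z] p)" for Z
    using covectorsD(4)[OF \<omega>, of Z] by (cases "fst Z = - k") auto
  have C: "(\<lambda>p. pm k * \<omega> [Z] p) \<in> C" for Z
    by (intro Cinf_mult Cinf_const symalg_Cinf \<omega>S)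
  have int: "interior Z \<omega> = fun_form (\<lambda>p. pm k * \<omega> [Z] p)" for Z
    by (simp add: interior_covector[OF \<omega>] sgn)
  have Dint: "?D (interior Z \<omega>) [W] p = - (pm k * anchor' \<rho> W (\<omega> [Z]) p)" if "W \<in> H" for Z W
    unfolding int op_part_fun_form(2)[OF QD(1) C] QD(2)[OF C that] anchor'_scale[OF that symalg_Cinf[OF \<omega>S]] ..
  have DS: "?D \<omega> \<in> S" "?D (interior Z \<omega>) \<in> S" if "Z \<in> H" for Z
    using derivationD(2)[OF der] \<omega>S interior_symalg[OF that] by blast+
  define G where "G = snd (gcomm (1, ?D) (?x, interior X))"
  have G: "G \<eta> Xs p = ?D (interior X \<eta>) Xs p - pm ?x * interior X (?D \<eta>) Xs p" for \<eta> Xs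
    by (simp add: G_def gcomm_def)
  have GS: "G \<omega> \<in> S"
    unfolding G_def by (rule derivationD(2)[OF derivation_gcomm[OF der derivation_interior[OF X]] \<omega>S])
  have "snd (iter 1 ?D [X, Y]) \<omega> [] p =
      G (interior Y \<omega>) [] p - pm ((1 + ?x) * ?y) * interior Y (G \<omega>) [] p"
    by (simp add: contraction_eq_interior X Y gcomm_def G_def)
  also have "G (interior Y \<omega>) [] p = pm k * anchor' \<rho> X (\<omega> [Y]) p"
  proof -
    have "interior X (interior Y \<omega>) = (\<lambda>_ _. 0)" unfolding int[of Y] by (rule interior_fun_form[OF C])
    moreover have "interior X (?D (interior Y \<omega>)) [] p = pm (?x * ?x) * ?D (interior Y \<omega>) [X] p"
      unfolding interior_def[of X "?D (interior Y \<omega>)"] using DS(2)[OF Y] by simp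
    ultimately show ?thesis
      unfolding G Dint[OF X] using fun_cong[OF fun_cong[OF derivation_0[OF der]], of "[]" p]
      by (simp add: pm_def)
  qed
  also have "interior Y (G \<omega>) [] p = pm (?y * ?y) * (- (pm k * anchor' \<rho> Y (\<omega> [X]) p) -
      pm ?x * (pm (?x * (?x + ?y)) * Q \<omega> [X, Y] p))"
  proof -
    have "interior X (?D \<omega>) [Y] p = pm (?x * (?x + ?y)) * Q \<omega> [X, Y] p"
      using DS(1)[OF X] op_part_covector[OF \<omega>, of "[X, Y]" 1 Q] by (simp add: interior_def)
    moreover have "interior Y (G \<omega>) [] p = pm (?y * ?y) * G \<omega> [Y] p"
      using GS by (simp add: interior_def)
    ultimately show ?thesis unfolding G Dint[OF Y] by simp
  qed
  \<comment> \<open>A parity check that collects the signs of both commutators and of the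
    contractions.\<close>
  also have "pm k * a - pm ((1 + x) * y) * (pm (y * y) * (- (pm k * b) - pm x * (pm (x * (x + y)) * q))) =
      q + pm k * a + pm (x * y + k) * b" for a b q x y
    by (auto simp: pm_def)
  finally show ?thesis .
qed

text \<open>Each of the \<open>r\<close> commutators contributes -1, and the other sign in
  \<open>iter_covector\<close> has an even exponent since \<open>Q\<close> has degree 1. For
  \<open>r = 2\<close> the anchor terms of \<open>iter_2_covector\<close> cancel those in the
  formula for \<open>Q\<close>, leaving the sign +1.\<close>

lemma derived_bracket_eq_bracket':
  assumes Xs: "Xs \<in> hlists A E r" and r: "r \<ge> 1"
  shows "derived_bracket A E Q r Xs = gscale (\<lambda>_. (-1) ^ r) (bracket' l r Xs)" (is "_ = ?Y")
proof (rule derived_bracket_eqI[OF _ _ r QD(1)])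
  note B = bracket'_H[OF Xs]
  show H: "set Xs \<subseteq> H" and len: "length Xs = r" using Xs by (simp_all add: hlists_def)
  show "?Y \<in> H" by (intro hsec_gscale B Cinf_const)
  show "fst ?Y = 1 + tdeg Xs" using B by simp
  fix k \<omega> p assume \<omega>: "\<omega> \<in> covectors A E k" and k: "k = - fst ?Y"
  let ?D = "op_part A E (r - 1) Q"
  have der: "derivation A E 1 ?D" by (rule derivation_op_part[OF QD(1)])
  have tdeg: "tdeg Xs = - (k + 1)" "fst ?Y = - k" using k B by simp_all
  have "snd (iter 1 ?D Xs) \<omega> [] p = pm k * (-1) ^ r * \<omega> [bracket' l r Xs] p"
  proof (cases "k \<in> {1..int n}")
    case False
    then have "\<omega> = (\<lambda>_ _. 0)" by (rule covector_outside[OF \<omega>])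
    then show ?thesis
      using derivation_0[OF iter_properties[OF H der shifts_arity_op_part[OF QD(1)], THEN conjunct1]]
      by simp
  next
    case True
    show ?thesis
    proof (cases "r = 2")
      case False
      have "snd (iter 1 ?D Xs) \<omega> [] p = (-1) ^ length Xs * pm ((1 + 1) * tdeg Xs) * ?D \<omega> Xs p"
      proof (rule iter_covector[OF H der _ \<omega>])
        show "?D (fun_form f) = (\<lambda>_ _. 0)" if "f \<in> C" for f
          using op_part_fun_form(1)[OF QD(1) that] False r by simp
      qed
      also have "?D \<omega> Xs = Q \<omega> Xs"
        using len r by (intro op_part_covector[OF \<omega>]) simp
      also have "Q \<omega> Xs = (\<lambda>p. pm k * \<omega> [bracket' l r Xs] p)"
        by (rule QD(3)[OF True \<omega> r Xs tdeg(1) False])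
      finally show ?thesis by (simp add: len pm_def)
    next
      case r2: True
      then obtain X Y where XY: "Xs = [X, Y]"
        using len by (metis (no_types, lifting) One_nat_def Suc_1 length_0_conv length_Suc_conv)
      have "X \<in> H" "Y \<in> H" using H XY by simp_all
      then show ?thesis
        using iter_2_covector[OF _ _ \<omega>, of X Y p] QD(4)[OF True \<omega>, of X Y] tdeg(1)
        by (simp add: XY r2)
    qed
  qed
  also have "\<dots> = pm (fst ?Y) * \<omega> [?Y] p"
    unfolding covector_gscale[OF \<omega> B(1)] tdeg(2) by simp
  finally show "snd (iter 1 ?D Xs) \<omega> [] p = pm (fst ?Y) * \<omega> [?Y] p" .
qed

lemma bracket_eq_derived_bracket:
  assumes xs: "xs \<in> hlists A L r" and r: "r \<ge> 1"
  shows "l r xs = gscale (\<lambda>_. (-1) ^ r) (susp (multi_desusp (derived_bracket A E Q r) xs))"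
proof -
  have len: "length xs = r" using xs by (simp add: hlists_def)
  \<comment> \<open>The factor \<open>(-1) ^ r\<close> of the claim cancels that of the derived
    bracket, and the sign in \<open>bracket'\<close> cancels the product of the two shift
    signs.\<close>
  have s: "(-1) ^ r * (shift_sign xs * ((-1) ^ r * ((-1) ^ (r * (r - 1) div 2) * shift_sign (map desusp xs)))) =
      (1 :: real)"
  proof -
    have "(-1) ^ r * (shift_sign xs * ((-1) ^ r * ((-1) ^ (r * (r - 1) div 2) * shift_sign (map desusp xs)))) =
        ((-1) ^ r * (-1) ^ r) * (((-1) ^ (r * (r - 1) div 2)) * (shift_sign xs * shift_sign (map desusp xs)))"
      by simp
    also have "\<dots> = 1"
      unfolding shift_sign_desusp len by (simp flip: power_add mult_2)
    finally show ?thesis .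
  qed
  show ?thesis
    unfolding multi_desusp_def derived_bracket_eq_bracket'[OF hlists_susp(2)[OF xs] r]
      bracket'_def multi_susp_def map_susp_desusp susp_gscale susp_desusp gscale_gscale
    by (simp only: s gscale_1 mult.assoc)
qed

text \<open>The contraction kills functions, so one summand of the commutator remains. Its sign is
  +1 because the degrees are 1 and -1, and the sign -1 of the contraction compensates that of
  \<open>Q\<close> on functions.\<close>

lemma anchor_eq_derived_anchor:
  assumes "X \<in> sections A (L 0)"
  shows "(\<lambda>p. \<rho> p (X p)) = derived_anchor A E Q (desusp (0, X))"
proof (intro ext)
  fix p f
  let ?X = "desusp (0, X)"
  have HLX: "(0, X) \<in> HL" using assms by (simp add: hsections_def)
  then have X: "?X \<in> H" by (rule hsections_susp)
  show "\<rho> p (X p) f = derived_anchor A E Q ?X p f"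
  proof (cases "f \<in> C")
    case True
    have der: "derivation A E 1 (op_part A E 1 Q)" by (rule derivation_op_part[OF QD(1)])
    have "op_part A E 1 Q (fun_form f) [?X] p = - \<rho> p (X p) f"
      using op_part_fun_form(2)[OF QD(1) True, of ?X] QD(2)[OF True X]
      by (simp add: anchor'_def susp_def desusp_def)
    moreover have "op_part A E 1 Q (fun_form f) \<in> S"
      by (rule derivationD(2)[OF der symalg_fun_form[OF True]])
    ultimately have "interior ?X (op_part A E 1 Q (fun_form f)) [] p = \<rho> p (X p) f"
      by (simp add: interior_def desusp_def pm_def)
    then show ?thesis
      using True X
      by (simp add: derived_anchor_def iterated_commutator_def contraction_eq_interior gcomm_def
          interior_fun_form derivation_0[OF der[unfolded One_nat_def]]) (simp add: desusp_def pm_def)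
  next
    case False
    then show ?thesis
      using anchor_nonsmooth[OF HL_fibre[OF HLX]] by (simp add: derived_anchor_def)
  qed
qed

end

end

theorem mainTheorem4:
  fixes A :: "('m::{t2_space,second_countable_topology}, 'e::real_normed_vector) atlas"
    and E :: "('m, 'v::real_vector) gbundle"
    and l :: "nat \<Rightarrow> ('m, 'v) bracket"
    and \<rho> :: "('m, 'v) anchor"
    and n :: nat
  assumes "n \<ge> 1"
    and "smooth_manifold A"
    and "graded_bundle A (- int n) (-1) E"
    and "split_lie_algebroid A n (shift E) l \<rho>"
  shows "(\<forall>X\<in>sections A (shift E 0). \<forall>Y\<in>sections A (shift E 0).
           (\<lambda>p. \<rho> p (snd (l 2 [(0, X), (0, Y)]) p)) =
             lie_bracket (\<lambda>p. \<rho> p (X p)) (\<lambda>p. \<rho> p (Y p))) \<and>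
         (\<forall>Q. homological_vector_field A n E l \<rho> Q \<longrightarrow>
           (\<forall>r\<in>{1..n + 1}. \<forall>xs\<in>hlists A (shift E) r.
              l r xs = gscale (\<lambda>_. (-1) ^ r) (susp (multi_desusp (derived_bracket A E Q r) xs))) \<and>
           (\<forall>X\<in>sections A (shift E 0).
              (\<lambda>p. \<rho> p (X p)) = derived_anchor A E Q (desusp (0, X))))"
proof -
  interpret split_algebroid A E n l \<rho>
    by unfold_locales (fact assms)+
  show ?thesis
    using anchor_bracket bracket_eq_derived_bracket anchor_eq_derived_anchor by auto
qed

end
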